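(* Let $f$ be a $C^1$-diffeomorphism of a compact $C^r$-differentiable ($r \geq 1$) manifold $M$ that satisfies Axiom A. Suppose that $X$ is an elementary basic set of $(M,f)$ and let $f|_X \colon X \to X$ denote the restriction of $f$ to $X$. Then the dynamical system $(X, f|_X)$ has the Myhill property.
   Context: Dynamical systems. A dynamical system is a pair $(X,g)$ where $X$ is a compact metrizable space and $g \colon X \to X$ is a homeomorphism. Let $d$ be a metric on $X$ compatible with the topology. Two points $x,y \in X$ are $g$-homoclinic if $d(g^k(x), g^k(y)) \to 0$ as $|k| \to \infty$ ($k \in \mathbb{Z}$). This is an equivalence relation, independent of the choice of $d$. An endomorphism of $(X,g)$ is a continuous map $\tau \colon X \to X$ with $\tau \circ g = g \circ \tau$. It is pre-injective if its restriction to each $g$-homoclinicity class is injective. $(X,g)$ has the Myhill property if every pre-injective endomorphism of $(X,g)$ is surjective. $(X,g)$ is topologically mixing if for any pair of non-empty open subsets $U,V \subset X$ there is an integer $N$ such that $g^n(U)$ meets $V$ for all $n \ge N$. A subset $Y \subset X$ is invariant if $g(Y) = Y$. Axiom A. Let $f$ be a $C^1$-diffeomorphism of $M$. A closed $f$-invariant subset $\Lambda \subset M$ is a hyperbolic set if the restriction to $\Lambda$ of the tangent bundle of $M$ continuously splits as a direct sum of two $df$-invariant subbundles $E_s$ and $E_u$ such that, with respect to some (equivalently any) Riemannian metric on $M$, there are constants $C>0$ and $0<\lambda<1$ with $\|df^n(v)\| \le C\lambda^n\|v\|$ and $\|df^{-n}(w)\| \le C\lambda^n\|w\|$ for all $x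 \in \Lambda$, $v \in E_s(x)$, $w \in E_u(x)$, $n \ge 0$. A point $x \in M$ is non-wandering if for every neighborhood $U$ of $x$ there is an integer $n \ge 1$ such that $f^n(U)$ meets $U$; $\Omega(f)$ denotes the (closed, invariant) set of non-wandering points. One says that $f$ satisfies Axiom A if $\Omega(f)$ is hyperbolic and the periodic points of $f$ are dense in $\Omega(f)$. Basic sets. If $f$ satisfies Axiom A, then (spectral decomposition theorem) $\Omega(f)$ can be uniquely written as a disjoint union of closed invariant subsets $\Omega(f) = X_1 \cup \dots \cup X_k$ such that the restriction of $f$ to each $X_i$ is topologically transitive. The $X_i$ are called the basic sets of $(M,f)$. A basic set $X_i$ is elementary if the restriction of $f$ to $X_i$ is topologically mixing. *)

theory Defs
  imports "HOL-Analysis.Analysis" "HOL-Library.Function_Algebras"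
begin

section \<open>Dynamical systems\<close>

text \<open>
  A space is an abstract topology and a map is a total HOL function of which only the values on
  the carrier matter. In particular the restriction of a map \<open>f\<close> to an invariant
  subset \<open>X\<close> of \<open>M\<close> is represented by the pair \<open>(subtopology M X, f)\<close>.
\<close>

definition dynamical_system :: "'a topology \<Rightarrow> ('a \<Rightarrow> 'a) \<Rightarrow> bool" where
  "dynamical_system X g \<longleftrightarrow>
     compact_space X \<and> metrizable_space X \<and> homeomorphic_map X X g"

definition int_iterate :: "'a topology \<Rightarrow> ('a \<Rightarrow> 'a) \<Rightarrow> int \<Rightarrow> 'a \<Rightarrow> 'a" where
  "int_iterate X g k =
     (if 0 \<le> k then g ^^ nat k else inv_into (topspace X) g ^^ nat (- k))"

text \<open>The filter describes \<open>\<bar>k\<bar> \<rightarrow> \<infinity>\<close>, that is, both ends of the integers. The relation does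
  not depend on the compatible metric \<open>d\<close>, since \<open>X\<close> is compact.\<close>

definition homoclinic :: "'a topology \<Rightarrow> ('a \<Rightarrow> 'a) \<Rightarrow> 'a \<Rightarrow> 'a \<Rightarrow> bool" where
  "homoclinic X g x y \<longleftrightarrow>
     x \<in> topspace X \<and> y \<in> topspace X \<and>
     (\<exists>d. Metric_space (topspace X) d \<and> Metric_space.mtopology (topspace X) d = X \<and>
        ((\<lambda>k. d (int_iterate X g k x) (int_iterate X g k y)) \<longlongrightarrow> 0)
          (filtercomap (\<lambda>k::int. \<bar>k\<bar>) at_top))"

definition dyn_endomorphism :: "'a topology \<Rightarrow> ('a \<Rightarrow> 'a) \<Rightarrow> ('a \<Rightarrow> 'a) \<Rightarrow> bool" where
  "dyn_endomorphism X g \<tau> \<longleftrightarrow>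
     continuous_map X X \<tau> \<and> (\<forall>x\<in>topspace X. \<tau> (g x) = g (\<tau> x))"

definition pre_injective :: "'a topology \<Rightarrow> ('a \<Rightarrow> 'a) \<Rightarrow> ('a \<Rightarrow> 'a) \<Rightarrow> bool" where
  "pre_injective X g \<tau> \<longleftrightarrow> (\<forall>x\<in>topspace X. inj_on \<tau> {y. homoclinic X g x y})"

definition Myhill_property :: "'a topology \<Rightarrow> ('a \<Rightarrow> 'a) \<Rightarrow> bool" where
  "Myhill_property X g \<longleftrightarrow>
     (\<forall>\<tau>. dyn_endomorphism X g \<tau> \<and> pre_injective X g \<tau> \<longrightarrow> \<tau> ` topspace X = topspace X)"

definition topologically_mixing :: "'a topology \<Rightarrow> ('a \<Rightarrow> 'a) \<Rightarrow> bool" where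
  "topologically_mixing X g \<longleftrightarrow>
     (\<forall>U V. openin X U \<and> U \<noteq> {} \<and> openin X V \<and> V \<noteq> {} \<longrightarrow>
        (\<exists>N. \<forall>n\<ge>N. (g ^^ n) ` U \<inter> V \<noteq> {}))"

definition topologically_transitive :: "'a topology \<Rightarrow> ('a \<Rightarrow> 'a) \<Rightarrow> bool" where
  "topologically_transitive X g \<longleftrightarrow>
     (\<forall>U V. openin X U \<and> U \<noteq> {} \<and> openin X V \<and> V \<noteq> {} \<longrightarrow>
        (\<exists>n. (g ^^ n) ` U \<inter> V \<noteq> {}))"

definition nonwandering_set :: "'a topology \<Rightarrow> ('a \<Rightarrow> 'a) \<Rightarrow> 'a set" where
  "nonwandering_set M f =
     {x \<in> topspace M. \<forall>U. openin M U \<and> x \<in> U \<longrightarrow> (\<exists>n\<ge>1. (f ^^ n) ` U \<inter> U \<noteq> {})}"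

definition periodic_points :: "'a topology \<Rightarrow> ('a \<Rightarrow> 'a) \<Rightarrow> 'a set" where
  "periodic_points M f = {x \<in> topspace M. \<exists>n\<ge>1. (f ^^ n) x = x}"


section \<open>Differentiable manifolds\<close>

text \<open>
  Maps of class \<open>C\<^sup>k\<close> on an open subset \<open>S\<close> of a finite-dimensional space, via iterated
  directional derivatives. In finite dimension, continuity of all directional derivatives is
  continuity of the derivative.
\<close>

primrec Ck_on ::
  "nat \<Rightarrow> 'b::real_normed_vector set \<Rightarrow> ('b \<Rightarrow> 'c::real_normed_vector) \<Rightarrow> bool" where
  "Ck_on 0 S f \<longleftrightarrow> continuous_on S f"
| "Ck_on (Suc k) S f \<longleftrightarrow>
     (\<forall>x\<in>S. f differentiable (at x)) \<and>
     (\<forall>v. Ck_on k S (\<lambda>x. frechet_derivative f (at x) v))"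

definition Cr_on ::
  "enat \<Rightarrow> 'b::real_normed_vector set \<Rightarrow> ('b \<Rightarrow> 'c::real_normed_vector) \<Rightarrow> bool" where
  "Cr_on r S f \<longleftrightarrow> (\<forall>k. enat k \<le> r \<longrightarrow> Ck_on k S f)"

text \<open>A chart is a coordinate domain together with a coordinate map.\<close>

type_synonym ('a, 'b) chart = "'a set \<times> ('a \<Rightarrow> 'b)"

definition is_chart :: "'a topology \<Rightarrow> ('a, 'b::real_normed_vector) chart \<Rightarrow> bool" where
  "is_chart M c \<longleftrightarrow>
     openin M (fst c) \<and> open (snd c ` fst c) \<and>
     homeomorphic_map (subtopology M (fst c)) (top_of_set (snd c ` fst c)) (snd c)"

definition chart_inv :: "('a, 'b) chart \<Rightarrow> 'b \<Rightarrow> 'a" where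
  "chart_inv c = inv_into (fst c) (snd c)"

text \<open>
  The model space \<open>'b\<close> is an arbitrary finite-dimensional real normed space. Unlike
  \<open>euclidean_space\<close>, this includes dimension 0.
\<close>

definition Cr_manifold ::
  "enat \<Rightarrow> 'a topology \<Rightarrow> ('a, 'b::real_normed_vector) chart set \<Rightarrow> bool" where
  "Cr_manifold r M A \<longleftrightarrow>
     (\<exists>B::'b set. finite B \<and> span B = UNIV) \<and>
     Hausdorff_space M \<and> second_countable M \<and>
     (\<forall>c\<in>A. is_chart M c) \<and> (\<Union>c\<in>A. fst c) = topspace M \<and>
     (\<forall>c\<in>A. \<forall>c'\<in>A. Cr_on r (snd c ` (fst c \<inter> fst c')) (snd c' \<circ> chart_inv c))"

definition C1_map ::
  "'a topology \<Rightarrow> ('a, 'b::real_normed_vector) chart set \<Rightarrow> ('a \<Rightarrow> 'a) \<Rightarrow> bool" where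
  "C1_map M A f \<longleftrightarrow>
     continuous_map M M f \<and>
     (\<forall>c\<in>A. \<forall>c'\<in>A.
        Cr_on 1 (snd c ` {x \<in> fst c. f x \<in> fst c'}) (snd c' \<circ> f \<circ> chart_inv c))"

definition C1_diffeo ::
  "'a topology \<Rightarrow> ('a, 'b::real_normed_vector) chart set \<Rightarrow> ('a \<Rightarrow> 'a) \<Rightarrow> bool" where
  "C1_diffeo M A f \<longleftrightarrow>
     bij_betw f (topspace M) (topspace M) \<and> C1_map M A f \<and>
     C1_map M A (inv_into (topspace M) f)"


section \<open>The tangent bundle\<close>

text \<open>
  A tangent vector at \<open>p\<close> is the family of its coordinate vectors in all charts at \<open>p\<close>,
  related by the derivatives of the coordinate changes (derivations are not an option in
  class \<open>C\<^sup>1\<close>). It is extended by 0 to the other charts, so that tangent vectors are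
  determined by their coordinates and the linear structure is the pointwise one.
\<close>

instantiation "fun" :: (type, real_vector) real_vector
begin

definition scaleR_fun :: "real \<Rightarrow> ('a \<Rightarrow> 'b) \<Rightarrow> 'a \<Rightarrow> 'b" where
  "scaleR_fun a v = (\<lambda>x. a *\<^sub>R v x)"

instance
  by standard (auto simp: scaleR_fun_def fun_eq_iff scaleR_add_right scaleR_add_left)

end

type_synonym ('a, 'b) tvec = "('a, 'b) chart \<Rightarrow> 'b"

definition charts_at :: "('a, 'b) chart set \<Rightarrow> 'a \<Rightarrow> ('a, 'b) chart set" where
  "charts_at A p = {c \<in> A. p \<in> fst c}"

definition tangent_space ::
  "('a, 'b::real_normed_vector) chart set \<Rightarrow> 'a \<Rightarrow> ('a, 'b) tvec set" where
  "tangent_space A p =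
     {v. (\<forall>c\<in>charts_at A p. \<forall>c'\<in>charts_at A p.
            v c' = frechet_derivative (snd c' \<circ> chart_inv c) (at (snd c p)) (v c)) \<and>
         (\<forall>c. c \<notin> charts_at A p \<longrightarrow> v c = 0)}"

text \<open>By the chain rule, the value does not depend on the chosen chart \<open>c\<close> at \<open>p\<close>.\<close>

definition differential ::
  "('a, 'b::real_normed_vector) chart set \<Rightarrow> ('a \<Rightarrow> 'a) \<Rightarrow> 'a \<Rightarrow> ('a, 'b) tvec \<Rightarrow> ('a, 'b) tvec" where
  "differential A f p v =
     (\<lambda>c'. if c' \<in> charts_at A (f p)
           then (let c = (SOME c. c \<in> charts_at A p)
                 in frechet_derivative (snd c' \<circ> f \<circ> chart_inv c) (at (snd c p)) (v c))
           else 0)"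

definition continuous_section ::
  "'a topology \<Rightarrow> ('a, 'b::real_normed_vector) chart set \<Rightarrow> 'a set \<Rightarrow>
     ('a \<Rightarrow> ('a, 'b) tvec) \<Rightarrow> bool" where
  "continuous_section M A W s \<longleftrightarrow>
     (\<forall>p\<in>W. s p \<in> tangent_space A p) \<and>
     (\<forall>c\<in>A. continuous_map (subtopology M (W \<inter> fst c)) euclidean (\<lambda>p. s p c))"

text \<open>A subbundle over \<open>\<Lambda>\<close> has a continuous frame near every point of \<open>\<Lambda>\<close>. The rank may vary
  between points, but is locally constant.\<close>

definition continuous_subbundle ::
  "'a topology \<Rightarrow> ('a, 'b::real_normed_vector) chart set \<Rightarrow> 'a set \<Rightarrow>
     ('a \<Rightarrow> ('a, 'b) tvec set) \<Rightarrow> bool" where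
  "continuous_subbundle M A \<Lambda> E \<longleftrightarrow>
     (\<forall>x\<in>\<Lambda>. \<exists>W (n::nat) e. openin (subtopology M \<Lambda>) W \<and> x \<in> W \<and>
        (\<forall>i<n. continuous_section M A W (e i)) \<and>
        (\<forall>y\<in>W. inj_on (\<lambda>i. e i y) {..<n} \<and> independent ((\<lambda>i. e i y) ` {..<n}) \<and>
               E y = span ((\<lambda>i. e i y) ` {..<n})))"

text \<open>On a \<open>C\<^sup>1\<close> manifold a Riemannian metric is in general no better than continuous; its
  continuity is expressed by pairing continuous vector fields.\<close>

definition riemannian_metric ::
  "'a topology \<Rightarrow> ('a, 'b::real_normed_vector) chart set \<Rightarrow>
     ('a \<Rightarrow> ('a, 'b) tvec \<Rightarrow> ('a, 'b) tvec \<Rightarrow> real) \<Rightarrow> bool" where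
  "riemannian_metric M A G \<longleftrightarrow>
     (\<forall>p\<in>topspace M. \<forall>u\<in>tangent_space A p. \<forall>v\<in>tangent_space A p.
        (\<forall>w\<in>tangent_space A p. \<forall>a b. G p (a *\<^sub>R u + b *\<^sub>R v) w = a * G p u w + b * G p v w) \<and>
        G p u v = G p v u \<and> (u \<noteq> 0 \<longrightarrow> G p u u > 0)) \<and>
     (\<forall>W s t. openin M W \<and> continuous_section M A W s \<and> continuous_section M A W t \<longrightarrow>
        continuous_map (subtopology M W) euclideanreal (\<lambda>p. G p (s p) (t p)))"


section \<open>Axiom A and basic sets\<close>

definition hyperbolic_set ::
  "'a topology \<Rightarrow> ('a, 'b::real_normed_vector) chart set \<Rightarrow> ('a \<Rightarrow> 'a) \<Rightarrow> 'a set \<Rightarrow> bool" where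
  "hyperbolic_set M A f \<Lambda> \<longleftrightarrow>
     closedin M \<Lambda> \<and> f ` \<Lambda> = \<Lambda> \<and>
     (\<exists>Es Eu.
        continuous_subbundle M A \<Lambda> Es \<and> continuous_subbundle M A \<Lambda> Eu \<and>
        (\<forall>x\<in>\<Lambda>. Es x \<inter> Eu x = {0} \<and>
                tangent_space A x = {v + w | v w. v \<in> Es x \<and> w \<in> Eu x} \<and>
                differential A f x ` Es x = Es (f x) \<and>
                differential A f x ` Eu x = Eu (f x)) \<and>
        (\<exists>G C l. riemannian_metric M A G \<and> 0 < C \<and> 0 < l \<and> l < 1 \<and>
           (let nrm = (\<lambda>p v. sqrt (G p v v)); f' = inv_into (topspace M) f in
              \<forall>x\<in>\<Lambda>. \<forall>v\<in>Es x. \<forall>w\<in>Eu x. \<forall>n.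
                nrm ((f ^^ n) x) (differential A (f ^^ n) x v) \<le> C * l ^ n * nrm x v \<and>
                nrm ((f' ^^ n) x) (differential A (f' ^^ n) x w) \<le> C * l ^ n * nrm x w)))"

definition Axiom_A ::
  "'a topology \<Rightarrow> ('a, 'b::real_normed_vector) chart set \<Rightarrow> ('a \<Rightarrow> 'a) \<Rightarrow> bool" where
  "Axiom_A M A f \<longleftrightarrow>
     hyperbolic_set M A f (nonwandering_set M f) \<and>
     nonwandering_set M f \<subseteq> M closure_of periodic_points M f"

definition spectral_decomposition ::
  "'a topology \<Rightarrow> ('a \<Rightarrow> 'a) \<Rightarrow> 'a set set \<Rightarrow> bool" where
  "spectral_decomposition M f \<X> \<longleftrightarrow>
     finite \<X> \<and> disjoint \<X> \<and> \<Union>\<X> = nonwandering_set M f \<and>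
     (\<forall>X\<in>\<X>. X \<noteq> {} \<and> closedin M X \<and> f ` X = X \<and>
             topologically_transitive (subtopology M X) f)"

text \<open>Under Axiom A the spectral decomposition exists and is unique.\<close>

definition basic_set :: "'a topology \<Rightarrow> ('a \<Rightarrow> 'a) \<Rightarrow> 'a set \<Rightarrow> bool" where
  "basic_set M f X \<longleftrightarrow> (\<exists>\<X>. spectral_decomposition M f \<X> \<and> X \<in> \<X>)"

definition elementary_basic_set :: "'a topology \<Rightarrow> ('a \<Rightarrow> 'a) \<Rightarrow> 'a set \<Rightarrow> bool" where
  "elementary_basic_set M f X \<longleftrightarrow>
     basic_set M f X \<and> topologically_mixing (subtopology M X) f"

end

(* Counting argument: if an endomorphism \<tau> of an expansive system with specification misses a
   point x0, take a maximal separated set E of orbit segments of length n in the image of \<tau>.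
   Specification yields, for every e in E and many times t in [0, n), a point asymptotic in both
   directions to a fixed orbit that follows e on [0, n) except for a visit to x0 near t. Their number
   exceeds every fixed multiple of card E as n grows, while up to a bounded factor their images
   are counted by E. By the pigeonhole principle two of them have images staying close for all
   times, so the images agree and \<tau> is not pre-injective.

   Expansivity and shadowing on the hyperbolic set use no continuity of the splitting: a sequence
   of bounded almost-solutions of the linearised equation v(k+1) = Df v(k) along pseudo-orbits
   would converge to a nonzero bounded orbit of Df, and hyperbolicity excludes these. The
   resulting lower bound gives injectivity of the linearised operator on periodic sequences, hence
   invertibility by finite dimension, and a contraction argument then produces a periodic
   shadowing orbit. It is non-wandering, so near a basic set it lies in the basic set; pseudo-orbits
   in the basic set are closed up to periodic ones by mixing. *)

theory Submission
  imports Defs "HOL-Library.Diagonal_Subsequence"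
begin

section \<open>Compact dynamical systems with specification\<close>

text \<open>No comparison of entropies is needed. The image of \<tau> is compact, invariant and
  misses a neighbourhood of \<open>x0\<close>, so a point that otherwise follows an orbit of the
  image betrays the time at which it visits \<open>x0\<close>. Two losses occur in the count:
  forgetting \<open>e\<close> around the visit, and recording image orbits on the transitions at
  both ends of \<open>[0, n)\<close>. Both depend on the transition time \<open>N\<close> and not on
  \<open>n\<close>, so the linearly many visit times outweigh them.

  The detour through periodic pseudo-orbits is forced by the location of the shadow: the shadow of a
  general pseudo-orbit is a priori just some point of the manifold near the basic set.

  The lower bound for the linearised equation takes a halving form: a sequence bounded by
  \<open>b\<close> with errors at most \<open>\<kappa> * b\<close> is bounded by
  \<open>b / 2\<close>. Iterated, it annihilates the coordinate difference of two orbits that stay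
  close; applied to a maximal term, it bounds the inverse of the linearised operator.\<close>

definition zpow :: "('a \<Rightarrow> 'a) \<Rightarrow> ('a \<Rightarrow> 'a) \<Rightarrow> int \<Rightarrow> 'a \<Rightarrow> 'a" where
  "zpow g h k = (if 0 \<le> k then g ^^ nat k else h ^^ nat (- k))"

lemma card_le_if_inj:
  assumes "inj_on f A" "f ` A \<subseteq> B" "finite B"
  shows "finite A \<and> card A \<le> card B"
  using assms by (meson card_inj_on_le inj_on_finite)

lemma null_seq_le:
  fixes a b :: "nat \<Rightarrow> real"
  assumes "b \<longlonglongrightarrow> 0" "\<And>j. \<bar>a j\<bar> \<le> b j"
  shows "a \<longlonglongrightarrow> 0"
  by (rule Lim_null_comparison[OF _ assms(1)]) (use assms(2) in simp)

lemma null_seq_le_inverse: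
  fixes a :: "nat \<Rightarrow> real"
  assumes "\<And>j. \<bar>a j\<bar> \<le> inverse (Suc j)"
  shows "a \<longlonglongrightarrow> 0"
  using LIMSEQ_inverse_real_of_nat assms by (rule null_seq_le)

lemma (in Metric_space) limitin_dist:
  assumes "limitin mtopology s x sequentially" "limitin mtopology t y sequentially"
  shows "(\<lambda>n. d (s n) (t n)) \<longlonglongrightarrow> d x y"
proof -
  have M: "x \<in> M" "y \<in> M" "\<forall>\<^sub>F n in sequentially. s n \<in> M" "\<forall>\<^sub>F n in sequentially. t n \<in> M"
    and lim: "(\<lambda>n. d (s n) x) \<longlonglongrightarrow> 0" "(\<lambda>n. d (t n) y) \<longlonglongrightarrow> 0"
    using assms by (auto simp: limitin_metric_dist_null)
  have "\<forall>\<^sub>F n in sequentially. norm (d (s n) (t n) - d x y) \<le> d (s n) x + d (t n) y"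
    using M(3,4)
  proof eventually_elim
    case (elim n)
    have "d (s n) (t n) \<le> d (s n) x + (d x y + d y (t n))"
      using elim M(1,2) triangle by (smt (verit))
    moreover have "d x y \<le> d x (s n) + (d (s n) (t n) + d (t n) y)"
      using elim M(1,2) triangle by (smt (verit))
    ultimately show ?case by (simp add: commute abs_le_iff)
  qed
  moreover have "(\<lambda>n. d (s n) x + d (t n) y) \<longlonglongrightarrow> 0"
    using tendsto_add[OF lim] by simp
  ultimately have "(\<lambda>n. d (s n) (t n) - d x y) \<longlonglongrightarrow> 0"
    by (rule Lim_null_comparison)
  then show ?thesis by (simp add: LIM_zero_iff)
qed

text \<open>The inverse is a parameter \<open>h\<close> and not an \<open>inv_into\<close>, whose
  value depends on the carrier: on an invariant subset the iterates \<open>zpow g h\<close> remain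
  the same terms.\<close>

locale compact_homeo = Metric_space +
  fixes g h :: "'a \<Rightarrow> 'a"
  assumes compact: "compact_space mtopology"
    and cont_g: "continuous_map mtopology mtopology g"
    and cont_h: "continuous_map mtopology mtopology h"
    and hg [simp]: "x \<in> M \<Longrightarrow> h (g x) = x"
    and gh [simp]: "x \<in> M \<Longrightarrow> g (h x) = x"
begin

abbreviation it :: "int \<Rightarrow> 'a \<Rightarrow> 'a" where "it \<equiv> zpow g h"

lemma g_in [simp]: "x \<in> M \<Longrightarrow> g x \<in> M" and h_in [simp]: "x \<in> M \<Longrightarrow> h x \<in> M"
  using cont_g cont_h by (auto simp: continuous_map_def Pi_iff)

lemma it_0 [simp]: "it 0 x = x" by (simp add: zpow_def)

lemma it_in [simp]: "x \<in> M \<Longrightarrow> it k x \<in> M"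
proof -
  assume x: "x \<in> M"
  have "(g ^^ n) x \<in> M" "(h ^^ n) x \<in> M" for n by (induction n) (use x in auto)
  then show ?thesis by (simp add: zpow_def)
qed

lemma it_Suc: "x \<in> M \<Longrightarrow> it (k + 1) x = g (it k x)"
proof -
  assume x: "x \<in> M"
  show ?thesis
  proof (cases "0 \<le> k")
    case True
    then show ?thesis by (simp add: zpow_def nat_add_distrib)
  next
    case False
    define n where "n = nat (- (k + 1))"
    have n: "nat (- k) = Suc n" "k + 1 = - int n" using False by (auto simp: n_def)
    have hM: "(h ^^ n) x \<in> M" by (induction n) (use x in auto)
    have "it (k + 1) x = (h ^^ n) x" unfolding n by (simp add: zpow_def)
    with False n hM show ?thesis by (simp add: zpow_def)
  qed
qed

lemma it_pred: "x \<in> M \<Longrightarrow> it (k - 1) x = h (it k x)"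
  using it_Suc[of x "k - 1"] by simp

lemma it_add: "x \<in> M \<Longrightarrow> it (k + l) x = it k (it l x)"
proof (induction k rule: int_induct[where k = 0])
  case (step1 i)
  then show ?case using it_Suc[of x "i + l"] it_Suc[of "it l x" i] by (simp add: algebra_simps)
next
  case (step2 i)
  then show ?case using it_pred[of x "i + l"] it_pred[of "it l x" i] by (simp add: algebra_simps)
qed auto

lemma seq_compact:
  assumes "\<And>j::nat. s j \<in> M"
  obtains x r where "x \<in> M" "strict_mono (r::nat\<Rightarrow>nat)"
    "limitin mtopology (\<lambda>j. s (r j)) x sequentially"
proof -
  have "range s \<subseteq> M" using assms by auto
  with compact that show thesis unfolding compact_space_sequentially o_def by blast
qed

lemma limitin_it:
  assumes "limitin mtopology s x sequentially"
  shows "limitin mtopology (\<lambda>j. it k (s j)) (it k x) sequentially"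
proof -
  have "continuous_map mtopology mtopology (g ^^ n)" "continuous_map mtopology mtopology (h ^^ n)"
    for n
    using cont_g cont_h by (induction n) (auto intro: continuous_map_compose simp flip: id_def)
  then have "continuous_map mtopology mtopology (it k)" by (simp add: zpow_def)
  from continuous_map_limit[OF this assms] show ?thesis by (simp add: o_def)
qed

lemma limitin_in: "limitin mtopology s x sequentially \<Longrightarrow> x \<in> M"
  by (simp add: limitin_metric)

lemma limitin_subseq:
  "limitin mtopology s x sequentially \<Longrightarrow> strict_mono (r::nat\<Rightarrow>nat) \<Longrightarrow>
      limitin mtopology (\<lambda>j. s (r j)) x sequentially"
  using limitin_subsequence[of r mtopology s x] by (simp add: o_def)

lemma limitin_same:
  assumes "limitin mtopology s x sequentially" "(\<lambda>j. d (s j) (t j)) \<longlonglongrightarrow> 0" "\<And>j. t j \<in> M" "\<And>j. s j \<in> M"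
  shows "limitin mtopology t x sequentially"
proof -
  have x: "x \<in> M" using assms(1) limitin_in by blast
  have "(\<lambda>j. d (s j) x + d (s j) (t j)) \<longlonglongrightarrow> 0"
    using assms(1,2) by (intro tendsto_add_zero) (auto simp: limitin_metric_dist_null)
  moreover have "\<bar>d (t j) x\<bar> \<le> d (s j) x + d (s j) (t j)" for j
    using triangle[of "t j" "s j" x] commute[of "t j" "s j"] assms(3,4) x by simp
  ultimately have "(\<lambda>j. d (t j) x) \<longlonglongrightarrow> 0"
    by (rule null_seq_le)
  then show ?thesis using x assms(3) by (simp add: limitin_metric_dist_null)
qed

text \<open>Heine-Cantor: both members of pairs violating the modulus would converge to one point
  along a subsequence.\<close>

lemma uniformly_continuous:
  assumes "continuous_map mtopology mtopology \<tau>" "0 < e"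
  obtains r where "0 < r" "\<And>u v. u \<in> M \<Longrightarrow> v \<in> M \<Longrightarrow> d u v < r \<Longrightarrow> d (\<tau> u) (\<tau> v) < e"
proof (rule ccontr)
  assume "\<not> thesis"
  then have "\<exists>u v. u \<in> M \<and> v \<in> M \<and> d u v < inverse (Suc j) \<and> \<not> d (\<tau> u) (\<tau> v) < e" for j :: nat
    using that[of "inverse (Suc j)"] by auto
  then obtain u v where uv: "\<And>j. u j \<in> M" "\<And>j. v j \<in> M" "\<And>j. d (u j) (v j) < inverse (Suc j)"
      "\<And>j. \<not> d (\<tau> (u j)) (\<tau> (v j)) < e" by metis
  obtain x r where x: "x \<in> M" "strict_mono (r::nat\<Rightarrow>nat)"
    "limitin mtopology (\<lambda>j. u (r j)) x sequentially"
    using seq_compact[of u] uv(1) by blast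
  have "(\<lambda>j. d (u j) (v j)) \<longlonglongrightarrow> 0"
    by (rule null_seq_le_inverse) (use uv(3) in \<open>auto intro: less_imp_le\<close>)
  then have "(\<lambda>j. d (u (r j)) (v (r j))) \<longlonglongrightarrow> 0"
    using LIMSEQ_subseq_LIMSEQ[OF _ x(2), of "\<lambda>j. d (u j) (v j)"] by (simp add: o_def)
  then have "limitin mtopology (\<lambda>j. v (r j)) x sequentially"
    by (rule limitin_same[OF x(3)]) (rule uv)+
  from continuous_map_limit[OF assms(1) this] continuous_map_limit[OF assms(1) x(3)]
  have "(\<lambda>j. d (\<tau> (u (r j))) (\<tau> (v (r j)))) \<longlonglongrightarrow> d (\<tau> x) (\<tau> x)"
    using limitin_dist by (auto simp: o_def)
  moreover have "d (\<tau> x) (\<tau> x) = 0"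
    using assms(1) x(1) by (auto simp: continuous_map_def Pi_iff)
  ultimately have "e \<le> 0"
    by (intro LIMSEQ_le_const) (use uv(4) in \<open>auto simp: not_less\<close>)
  with assms(2) show False by simp
qed

section \<open>Expansivity, pseudo-orbits and gluing\<close>

definition expansive :: "real \<Rightarrow> bool" where
  "expansive c \<longleftrightarrow> 0 < c \<and> (\<forall>x\<in>M. \<forall>y\<in>M. (\<forall>k. d (it k x) (it k y) \<le> c) \<longrightarrow> x = y)"

definition pseudo_orbit :: "real \<Rightarrow> (int \<Rightarrow> 'a) \<Rightarrow> bool" where
  "pseudo_orbit \<delta> \<xi> \<longleftrightarrow> (\<forall>k. \<xi> k \<in> M \<and> d (g (\<xi> k)) (\<xi> (k + 1)) < \<delta>)"

definition shadowing :: bool where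
  "shadowing \<longleftrightarrow> (\<forall>\<epsilon>>0. \<exists>\<delta>>0. \<forall>\<xi>. pseudo_orbit \<delta> \<xi> \<longrightarrow> (\<exists>y\<in>M. \<forall>k. d (it k y) (\<xi> k) \<le> \<epsilon>))"

text \<open>One transition time \<open>N\<close> serves all pairs of endpoints. All gaps then have
  the same length, and the loss they cause in the count is a constant.\<close>

definition connecting :: bool where
  "connecting \<longleftrightarrow> (\<forall>\<delta>>0. \<exists>N\<ge>1. \<forall>a\<in>M. \<forall>b\<in>M. \<exists>z\<in>M. d z a < \<delta> \<and> d (it (int N) z) b < \<delta>)"

lemma pseudo_orbit_it: "x \<in> M \<Longrightarrow> 0 < \<delta> \<Longrightarrow> pseudo_orbit \<delta> (\<lambda>k. it (k - t) x)"
  using it_Suc[of x "_ - t"] by (simp add: pseudo_orbit_def algebra_simps)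

text \<open>The orbit of \<open>z\<close> fills the times from \<open>s\<close> to
  \<open>s + N\<close>. It starts near the successor \<open>g (\<xi> (s - 1))\<close> and arrives
  near \<open>\<zeta> (s + N)\<close>, so the two seams are again errors below \<delta>.\<close>

lemma glue_pseudo_orbits:
  assumes \<xi>: "pseudo_orbit \<delta> \<xi>" and \<zeta>: "pseudo_orbit \<delta> \<zeta>" and N: "N \<ge> 1"
    and conn: "\<And>a b. a \<in> M \<Longrightarrow> b \<in> M \<Longrightarrow> \<exists>z\<in>M. d z a < \<delta> \<and> d (it (int N) z) b < \<delta>"
  obtains \<eta> where "pseudo_orbit \<delta> \<eta>" "\<And>k. k < s \<Longrightarrow> \<eta> k = \<xi> k" "\<And>k. s + int N \<le> k \<Longrightarrow> \<eta> k = \<zeta> k"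
proof -
  have in_M: "\<xi> k \<in> M" "\<zeta> k \<in> M" for k using \<xi> \<zeta> by (auto simp: pseudo_orbit_def)
  have \<delta>: "0 < \<delta>" using \<xi> nonneg unfolding pseudo_orbit_def by (meson le_less_trans)
  obtain z where z: "z \<in> M" "d z (g (\<xi> (s - 1))) < \<delta>" "d (it (int N) z) (\<zeta> (s + int N)) < \<delta>"
    using conn[of "g (\<xi> (s - 1))" "\<zeta> (s + int N)"] in_M by auto
  define \<eta> where "\<eta> k = (if k < s then \<xi> k else if k < s + int N then it (k - s) z else \<zeta> k)" for k
  have "d (g (\<eta> k)) (\<eta> (k + 1)) < \<delta>" for k
  proof -
    consider "k + 1 < s" | "k = s - 1" | "s \<le> k" "k + 1 < s + int N" | "s \<le> k" "k + 1 = s + int N" |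
      "s + int N \<le> k"
      by linarith
    then show ?thesis
    proof cases
      case 1 then show ?thesis using \<xi> by (simp add: \<eta>_def pseudo_orbit_def)
    next
      case 2 then show ?thesis using z N by (simp add: \<eta>_def commute)
    next
      case 3
      then have "\<eta> (k + 1) = g (\<eta> k)" using it_Suc[OF z(1), of "k - s"]
        by (simp add: \<eta>_def algebra_simps)
      moreover have "g (\<eta> k) \<in> M" using 3 z by (simp add: \<eta>_def)
      ultimately show ?thesis using \<delta> by simp
    next
      case 4
      then have "g (it (k - s) z) = it (int N) z" using it_Suc[OF z(1), of "k - s"]
        by (simp add: algebra_simps)
      then show ?thesis using 4 z by (simp add: \<eta>_def)
    next
      case 5 then show ?thesis using \<zeta> N by (simp add: \<eta>_def pseudo_orbit_def)
    qed
  qed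
  moreover have "\<eta> k \<in> M" for k using in_M z by (simp add: \<eta>_def)
  ultimately show thesis using that[of \<eta>] N by (auto simp: \<eta>_def pseudo_orbit_def)
qed

text \<open>Otherwise translates along times of unbounded modulus accumulate at two distinct points.
  The window of uncontrolled times is pushed to infinity, so the orbits of these limits stay within
  \<open>c\<close> at all times, contrary to expansivity. The non-strict inequality in
  \<open>expansive\<close> is what survives the limit.\<close>

lemma asymptotic_if_close:
  assumes c: "expansive c" and z: "z \<in> M" "z' \<in> M"
    and close: "\<And>k. K \<le> \<bar>k\<bar> \<Longrightarrow> d (it k z) (it k z') \<le> c"
  shows "((\<lambda>k. d (it k z) (it k z')) \<longlongrightarrow> 0) (filtercomap (\<lambda>k::int. \<bar>k\<bar>) at_top)"
proof (rule tendstoI)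
  fix e :: real assume e: "0 < e"
  have "\<exists>K'. \<forall>k. K' \<le> \<bar>k\<bar> \<longrightarrow> d (it k z) (it k z') < e"
  proof (rule ccontr)
    assume "\<not> ?thesis"
    then have "\<exists>k. int j \<le> \<bar>k\<bar> \<and> e \<le> d (it k z) (it k z')" for j
      by (auto simp: not_less)
    then obtain k where k: "\<And>j. int j \<le> \<bar>k j\<bar>" "\<And>j. e \<le> d (it (k j) z) (it (k j) z')" by metis
    obtain u r where u: "u \<in> M" "strict_mono (r::nat\<Rightarrow>nat)"
      "limitin mtopology (\<lambda>j. it (k (r j)) z) u sequentially"
      using seq_compact[of "\<lambda>j. it (k j) z"] z by auto
    obtain u' r' where u': "u' \<in> M" "strict_mono (r'::nat\<Rightarrow>nat)"
      "limitin mtopology (\<lambda>j. it (k (r (r' j))) z') u' sequentially"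
      using seq_compact[of "\<lambda>j. it (k (r j)) z'"] z by auto
    define s where "s j = k (r (r' j))" for j
    have s: "limitin mtopology (\<lambda>j. it (s j) z) u sequentially"
      "limitin mtopology (\<lambda>j. it (s j) z') u' sequentially"
      using limitin_subseq[OF u(3) u'(2)] u'(3) by (auto simp: s_def)
    have sj: "int j \<le> \<bar>s j\<bar>" for j
    proof -
      have "j \<le> r (r' j)" using seq_suble[OF u(2)] seq_suble[OF u'(2)] le_trans by blast
      then show ?thesis using k(1)[of "r (r' j)"] by (simp add: s_def)
    qed
    have "d (it i u) (it i u') \<le> c" for i
    proof (rule LIMSEQ_le_const2)
      show "(\<lambda>j. d (it i (it (s j) z)) (it i (it (s j) z'))) \<longlonglongrightarrow> d (it i u) (it i u')"
        by (intro limitin_dist limitin_it s)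
      have "d (it i (it (s j) z)) (it i (it (s j) z')) \<le> c" if "nat (\<bar>i\<bar> + \<bar>K\<bar>) \<le> j" for j
      proof -
        have "K \<le> \<bar>i + s j\<bar>" using that sj[of j] by linarith
        then show ?thesis using close z by (simp flip: it_add)
      qed
      then show "\<exists>N. \<forall>n\<ge>N. d (it i (it (s n) z)) (it i (it (s n) z')) \<le> c" by blast
    qed
    then have "u = u'" using c u(1) u'(1) by (auto simp: expansive_def)
    moreover have "e \<le> d u u'"
      by (rule LIMSEQ_le_const[OF limitin_dist[OF s]]) (use k(2) in \<open>auto simp: s_def\<close>)
    ultimately show False using e u(1) by simp
  qed
  then obtain K' where "\<forall>k. K' \<le> \<bar>k\<bar> \<longrightarrow> d (it k z) (it k z') < e" by blast
  then show "\<forall>\<^sub>F k in filtercomap (\<lambda>k::int. \<bar>k\<bar>) at_top. dist (d (it k z) (it k z')) 0 < e"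
    unfolding eventually_filtercomap
    by (intro exI[of _ "\<lambda>i. K' \<le> i"]) (auto simp: eventually_ge_at_top)
qed

text \<open>A finite colouring turns closeness into equality of colours, so that orbit segments can
  be counted through injections into finite function sets.\<close>

lemma finite_cells:
  assumes "0 < e"
  shows "\<exists>(F :: 'a set) cell. finite F \<and> (\<forall>x\<in>M. cell x \<in> F) \<and> (\<forall>x\<in>M. \<forall>y\<in>M. cell x = cell y \<longrightarrow>
      d x y \<le> e)"
proof -
  have "mtotally_bounded M"
    using compact compact_space_eq_mcomplete_mtotally_bounded by blast
  then obtain F where F: "finite F" "F \<subseteq> M" "M \<subseteq> (\<Union>x\<in>F. mball x (e/2))"
    using assms unfolding mtotally_bounded_def by (meson half_gt_zero)
  have "\<forall>x\<in>M. \<exists>y. y \<in> F \<and> d y x < e/2"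
  proof
    fix x assume "x \<in> M"
    then obtain y where "y \<in> F" "x \<in> mball y (e/2)" using F(3) by blast
    then show "\<exists>y. y \<in> F \<and> d y x < e/2" by auto
  qed
  then obtain cell where cell: "\<forall>x\<in>M. cell x \<in> F \<and> d (cell x) x < e/2" by metis
  have "d x y \<le> e" if "x \<in> M" "y \<in> M" "cell x = cell y" for x y
  proof -
    have "d x y \<le> d x (cell x) + d (cell x) y" using that cell F(2) triangle by blast
    moreover have "d (cell x) x < e/2" "d (cell x) y < e/2" using that cell by auto
    ultimately show ?thesis using commute[of x "cell x"] by linarith
  qed
  then show ?thesis using F(1) cell by blast
qed


text \<open>Four gluings, in the order \<open>p\<close>, \<open>e\<close>, \<open>x\<close>,
  \<open>e\<close>, \<open>p\<close>. The excursion to \<open>x\<close> takes the single time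
  \<open>t\<close>, with a transition of length \<open>N\<close> on either side; the bounds on
  \<open>t\<close> keep these transitions inside \<open>[0, n)\<close>.\<close>

lemma specification_point:
  assumes shadow: "\<And>\<xi>. pseudo_orbit \<delta> \<xi> \<Longrightarrow> \<exists>y\<in>M. \<forall>k. d (it k y) (\<xi> k) \<le> \<epsilon>" and \<delta>: "0 < \<delta>" and N:
    "N \<ge> 1"
    and conn: "\<And>a b. a \<in> M \<Longrightarrow> b \<in> M \<Longrightarrow> \<exists>z\<in>M. d z a < \<delta> \<and> d (it (int N) z) b < \<delta>"
    and M: "p \<in> M" "e \<in> M" "x \<in> M" and t: "int N \<le> t" "t + 1 + int N \<le> n"
  obtains z where "z \<in> M" "\<And>k. k < - int N \<or> n + int N \<le> k \<Longrightarrow> d (it k z) (it k p) \<le> \<epsilon>"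
    "d (it t z) x \<le> \<epsilon>" "\<And>k. 0 \<le> k \<and> k < t - int N \<or> t + 1 + int N \<le> k \<and> k < n \<Longrightarrow>
        d (it k z) (it k e) \<le> \<epsilon>"
proof -
  note po = pseudo_orbit_it[OF _ \<delta>, of _ 0, simplified] and glue = glue_pseudo_orbits[OF _ _ N conn]
  obtain \<xi>1 where 1: "pseudo_orbit \<delta> \<xi>1" "\<And>k. k < - int N \<Longrightarrow> \<xi>1 k = it k p" "\<And>k. 0 \<le> k \<Longrightarrow>
      \<xi>1 k = it k e"
    using glue[OF po[OF M(1)] po[OF M(2)], of "- int N"] by (metis add.left_inverse)
  obtain \<xi>2 where 2: "pseudo_orbit \<delta> \<xi>2" "\<And>k. k < t - int N \<Longrightarrow> \<xi>2 k = \<xi>1 k" "\<And>k. t \<le> k \<Longrightarrow>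
      \<xi>2 k = it (k - t) x"
    using glue[OF 1(1) pseudo_orbit_it[OF M(3) \<delta>, of t], of "t - int N"] by (metis diff_add_cancel)
  obtain \<xi>3 where 3: "pseudo_orbit \<delta> \<xi>3" "\<And>k. k < t + 1 \<Longrightarrow> \<xi>3 k = \<xi>2 k" "\<And>k. t + 1 + int N \<le> k \<Longrightarrow>
      \<xi>3 k = it k e"
    using glue[OF 2(1) po[OF M(2)], of "t + 1"] by metis
  obtain \<xi>4 where 4: "pseudo_orbit \<delta> \<xi>4" "\<And>k. k < n \<Longrightarrow> \<xi>4 k = \<xi>3 k" "\<And>k. n + int N \<le> k \<Longrightarrow>
      \<xi>4 k = it k p"
    using glue[OF 3(1) po[OF M(1)], of n] by metis
  obtain z where z: "z \<in> M" "\<And>k. d (it k z) (\<xi>4 k) \<le> \<epsilon>" using shadow[OF 4(1)] by blast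
  have "\<xi>4 k = it k p" if "k < - int N \<or> n + int N \<le> k" for k
    using that 1 2 3 4 t N by auto
  moreover have "\<xi>4 t = x" using 2 3 4 t by auto
  moreover have "\<xi>4 k = it k e" if "0 \<le> k \<and> k < t - int N \<or> t + 1 + int N \<le> k \<and> k < n" for k
    using that 1 2 3 4 t by auto
  ultimately show thesis using z by (intro that[of z]) metis+
qed

section \<open>Bowen's separated sets and the counting argument\<close>

definition separated :: "'a set \<Rightarrow> real \<Rightarrow> int \<Rightarrow> 'a set \<Rightarrow> bool" where
  "separated Y e n E \<longleftrightarrow> E \<subseteq> Y \<and> (\<forall>x\<in>E. \<forall>y\<in>E. x \<noteq> y \<longrightarrow> (\<exists>k\<in>{0..<n}. e < d (it k x) (it k y)))"

text \<open>Separated points have different colour itineraries on \<open>[0, n)\<close>, which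
  bounds their number and provides a set of largest cardinality. A point followed by none of its
  elements could be added to it.\<close>

lemma maximal_separated:
  assumes "Y \<subseteq> M" "0 < e" "Y \<noteq> {}"
  obtains E where "finite E" "E \<noteq> {}" "separated Y e n E"
    "\<And>y. y \<in> Y \<Longrightarrow> \<exists>x\<in>E. \<forall>k\<in>{0..<n}. d (it k y) (it k x) \<le> e"
proof -
  obtain F :: "'a set" and cell where F: "finite F" "\<And>x. x \<in> M \<Longrightarrow> cell x \<in> F"
    "\<And>x y. x \<in> M \<Longrightarrow> y \<in> M \<Longrightarrow> cell x = cell y \<Longrightarrow> d x y \<le> e"
    using finite_cells[OF assms(2)] by metis
  let ?C = "{0..<n} \<rightarrow>\<^sub>E F"
  have fin: "finite E \<and> card E \<le> card ?C" if sep: "separated Y e n E" for E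
  proof (rule card_le_if_inj)
    show "finite ?C" using F(1) by (intro finite_PiE) auto
    have EM: "E \<subseteq> M" using sep assms by (auto simp: separated_def)
    show "(\<lambda>x. \<lambda>k\<in>{0..<n}. cell (it k x)) ` E \<subseteq> ?C" using EM F(2) by auto
    show "inj_on (\<lambda>x. \<lambda>k\<in>{0..<n}. cell (it k x)) E"
    proof (rule inj_onI, rule ccontr)
      fix x y assume xy: "x \<in> E" "y \<in> E" "(\<lambda>k\<in>{0..<n}. cell (it k x)) = (\<lambda>k\<in>{0..<n}. cell (it k y))"
        "x \<noteq> y"
      obtain k where k: "k \<in> {0..<n}" "e < d (it k x) (it k y)"
        using sep[unfolded separated_def, THEN conjunct2, rule_format, OF xy(1,2,4)] by blast
      then have "cell (it k x) = cell (it k y)" using fun_cong[OF xy(3), of k] by simp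
      moreover have "it k x \<in> M" "it k y \<in> M" using xy(1,2) EM by auto
      ultimately have "d (it k x) (it k y) \<le> e" using F(3) by blast
      then show False using k by simp
    qed
  qed
  obtain y0 where "y0 \<in> Y" using assms by auto
  then have "separated Y e n {y0}" by (auto simp: separated_def)
  moreover have "\<forall>E. separated Y e n E \<longrightarrow> card E < Suc (card ?C)"
    using fin by (simp add: less_Suc_eq_le)
  ultimately obtain E where E: "separated Y e n E" "\<And>E'. separated Y e n E' \<Longrightarrow> card E' \<le> card E"
    using ex_has_greatest_nat[of "separated Y e n" "{y0}" card "Suc (card ?C)"] by blast
  have "E \<noteq> {}" using E(2)[OF \<open>separated Y e n {y0}\<close>] by auto
  moreover have "\<exists>x\<in>E. \<forall>k\<in>{0..<n}. d (it k y) (it k x) \<le> e" if y: "y \<in> Y" for y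
  proof (rule ccontr)
    assume no: "\<not> ?thesis"
    have "y \<notin> E"
    proof
      assume "y \<in> E"
      moreover have "d (it k y) (it k y) \<le> e" for k using y assms by auto
      ultimately show False using no by blast
    qed
    have far: "\<exists>k\<in>{0..<n}. e < d (it k y) (it k x)" if "x \<in> E" for x
      using no that by (meson not_le)
    then have "\<exists>k\<in>{0..<n}. e < d (it k x) (it k y)" if "x \<in> E" for x
      using that by (simp add: commute)
    with far have "separated Y e n (insert y E)"
      using E(1) y unfolding separated_def by blast
    from E(2)[OF this] fin[OF E(1)] \<open>y \<notin> E\<close> show False by simp
  qed
  ultimately show thesis using that E fin by blast
qed

text \<open>The set \<open>P\<close> of constructed points is counted twice: from below by
  recovering \<open>(j, e)\<close> from a point, from above by recovering a point from its
  image.\<close>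

theorem surj_if_injective_on_asymptotic:
  assumes c: "expansive c" and shadowing connecting
    and \<tau>: "continuous_map mtopology mtopology \<tau>" "\<And>x. x \<in> M \<Longrightarrow> \<tau> (g x) = g (\<tau> x)"
    and inj: "\<And>x y. x \<in> M \<Longrightarrow> y \<in> M \<Longrightarrow> \<tau> x = \<tau> y \<Longrightarrow>
      ((\<lambda>k. d (it k x) (it k y)) \<longlongrightarrow> 0) (filtercomap (\<lambda>k::int. \<bar>k\<bar>) at_top) \<Longrightarrow> x = y"
  shows "\<tau> ` M = M"
proof (rule ccontr)
  have \<tau>M [simp]: "\<tau> x \<in> M" if "x \<in> M" for x using \<tau>(1) that
    by (auto simp: continuous_map_def Pi_iff)
  have \<tau>h: "\<tau> (h x) = h (\<tau> x)" if "x \<in> M" for x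
    using \<tau>(2)[of "h x"] that by (metis \<tau>M gh h_in hg)
  have \<tau>it: "\<tau> (it k x) = it k (\<tau> x)" if "x \<in> M" for k x
  proof (induction k rule: int_induct[where k = 0])
    case (step1 i) then show ?case using that by (simp add: it_Suc \<tau>)
  next
    case (step2 i) then show ?case using that by (simp add: it_pred \<tau>h)
  qed simp
  assume "\<tau> ` M \<noteq> M"
  then obtain x0 where x0: "x0 \<in> M" "x0 \<notin> \<tau> ` M" using \<tau>M by blast
  have c0: "0 < c" using c by (simp add: expansive_def)
  \<comment> \<open>The image of \<tau> is compact and omits \<open>x0\<close>, hence keeps a
    positive distance from it.\<close>
  obtain r1 where r1: "0 < r1" "\<And>y. y \<in> M \<Longrightarrow> r1 \<le> d x0 (\<tau> y)"
  proof (rule ccontr)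
    assume "\<not> thesis"
    then have "\<exists>y. y \<in> M \<and> d x0 (\<tau> y) < inverse (Suc j)" for j :: nat
      using that[of "inverse (real (Suc j))"] by (force simp: not_le simp del: of_nat_Suc)
    then obtain y where y: "\<And>j. y j \<in> M" "\<And>j. d x0 (\<tau> (y j)) < inverse (Suc j)" by metis
    obtain l r where l: "l \<in> M" "strict_mono (r::nat\<Rightarrow>nat)"
      "limitin mtopology (\<lambda>j. y (r j)) l sequentially"
      using seq_compact[of y] y(1) by blast
    have "limitin mtopology (\<lambda>j. x0) x0 sequentially" using x0 by simp
    moreover have "limitin mtopology (\<lambda>j. \<tau> (y (r j))) (\<tau> l) sequentially"
      using continuous_map_limit[OF \<tau>(1) l(3)] by (simp add: o_def)
    ultimately have "(\<lambda>j. d x0 (\<tau> (y (r j)))) \<longlonglongrightarrow> d x0 (\<tau> l)" by (rule limitin_dist)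
    moreover have "(\<lambda>j. d x0 (\<tau> (y j))) \<longlonglongrightarrow> 0"
      by (rule null_seq_le_inverse) (use y in \<open>auto intro: less_imp_le\<close>)
    then have "(\<lambda>j. d x0 (\<tau> (y (r j)))) \<longlonglongrightarrow> 0" using LIMSEQ_subseq_LIMSEQ l(2)
      by (fastforce simp: o_def)
    ultimately have "d x0 (\<tau> l) = 0" using LIMSEQ_unique by blast
    then show False using x0 l(1) by auto
  qed
  obtain r2 where r2: "0 < r2" "\<And>u v. u \<in> M \<Longrightarrow> v \<in> M \<Longrightarrow> d u v < r2 \<Longrightarrow> d (\<tau> u) (\<tau> v) < c"
    using uniformly_continuous[OF \<tau>(1) c0] by blast
  \<comment> \<open>Two points that shadow the same orbit are 2\<epsilon> apart. Below
    \<open>r1\<close> this separates visits to \<open>x0\<close> from the image, below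
    \<open>r2\<close> it passes through \<tau> with error \<open>c\<close>, and being at most
    \<open>c/2\<close> it lets the separated set distinguish its elements.\<close>
  define \<epsilon> where "\<epsilon> = min (c/4) (min (r1/3) (r2/3))"
  have \<epsilon>: "0 < \<epsilon>" "2*\<epsilon> \<le> c/2" "2*\<epsilon> < r1" "2*\<epsilon> < r2" using c0 r1(1) r2(1) by (auto simp: \<epsilon>_def)
  obtain \<delta> where \<delta>: "0 < \<delta>" "\<And>\<xi>. pseudo_orbit \<delta> \<xi> \<Longrightarrow> \<exists>y\<in>M. \<forall>k. d (it k y) (\<xi> k) \<le> \<epsilon>"
    using \<open>shadowing\<close> \<epsilon>(1) unfolding shadowing_def by blast
  obtain N where N: "N \<ge> 1" "\<And>a b. a \<in> M \<Longrightarrow> b \<in> M \<Longrightarrow> \<exists>z\<in>M. d z a < \<delta> \<and> d (it (int N) z) b < \<delta>"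
    using \<open>connecting\<close> \<delta>(1) unfolding connecting_def by blast
  obtain F :: "'a set" and cell where F: "finite F" "\<And>x. x \<in> M \<Longrightarrow> cell x \<in> F"
    "\<And>x y. x \<in> M \<Longrightarrow> y \<in> M \<Longrightarrow> cell x = cell y \<Longrightarrow> d x y \<le> c/2"
    using finite_cells[OF half_gt_zero[OF c0]] by metis
  define q where "q = card F"
  \<comment> \<open>The exponent adds the two losses: \<open>2 * N + 1\<close> colours around a
    visit and \<open>2 * N\<close> colours on the outer transitions. One visit time more than this
    power is enough.\<close>
  define m where "m = Suc (q ^ (4 * N + 1))"
  define n where "n = int ((m + 2) * (N + 1))"
  \<comment> \<open>Visits are \<open>N + 1\<close> apart, so none falls into the window disturbed
    by another.\<close>
  define t where "t j = int ((j + 1) * (N + 1))" for j :: nat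
  let ?Y = "\<tau> ` M"
  obtain E where E: "finite E" "E \<noteq> {}" "separated ?Y (c/2) n E"
    "\<And>y. y \<in> ?Y \<Longrightarrow> \<exists>x\<in>E. \<forall>k\<in>{0..<n}. d (it k y) (it k x) \<le> c/2"
    using maximal_separated[of ?Y "c/2" n] c0 \<tau>M x0
      by (metis equals0D half_gt_zero image_is_empty image_subsetI)
  have EY: "E \<subseteq> ?Y" and EM: "E \<subseteq> M" using E(3) by (auto simp: separated_def)
  have t: "int N \<le> t j" "t j + 1 + int N \<le> n" if "j < m" for j
  proof -
    have "(j + 2) * (N + 1) \<le> (m + 2) * (N + 1)" using that by (intro mult_right_mono) auto
    moreover have "t j + 1 + int N = int ((j + 2) * (N + 1))" by (simp add: t_def algebra_simps)
    ultimately show "t j + 1 + int N \<le> n" unfolding n_def by linarith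
    show "int N \<le> t j" by (simp add: t_def algebra_simps)
  qed
  have t_gap: "t j + 1 + int N \<le> t j'" if "j < j'" for j j'
  proof -
    have "(j + 2) * (N + 1) \<le> (j' + 1) * (N + 1)" using that by (intro mult_right_mono) auto
    moreover have "t j + 1 + int N = int ((j + 2) * (N + 1))" by (simp add: t_def algebra_simps)
    ultimately show ?thesis unfolding t_def by linarith
  qed
  define Q where "Q j e z \<longleftrightarrow> z \<in> M \<and> (\<forall>k. k < - int N \<or> n + int N \<le> k \<longrightarrow> d (it k z) (it k x0) \<le> \<epsilon>) \<and>
    d (it (t j) z) x0 \<le> \<epsilon> \<and> (\<forall>k. 0 \<le> k \<and> k < t j - int N \<or> t j + 1 + int N \<le> k \<and> k < n \<longrightarrow> d (it k z)
      (it k e) \<le> \<epsilon>)" for j e z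
  \<comment> \<open>The exterior orbit is that of \<open>x0\<close> too. It is common to all
    constructed points, which makes any two of them close outside a bounded time interval.\<close>
  have "\<exists>z. Q j e z" if "j < m" "e \<in> E" for j e
    by (rule specification_point[OF \<delta>(2,1) N x0(1) subsetD[OF EM that(2)] x0(1) t(1)[OF that(1)]
      t(2)[OF that(1)]])
       (auto simp: Q_def)
  then have "\<forall>j e. \<exists>z. j < m \<and> e \<in> E \<longrightarrow> Q j e z" by blast
  then obtain z where "\<And>j e. j < m \<Longrightarrow> e \<in> E \<Longrightarrow> Q j e (z j e)" by metis
  then have z: "\<And>j e. j < m \<Longrightarrow> e \<in> E \<Longrightarrow> z j e \<in> M"
    "\<And>j e k. j < m \<Longrightarrow> e \<in> E \<Longrightarrow> k < - int N \<or> n + int N \<le> k \<Longrightarrow> d (it k (z j e)) (it k x0) \<le> \<epsilon>"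
    "\<And>j e. j < m \<Longrightarrow> e \<in> E \<Longrightarrow> d (it (t j) (z j e)) x0 \<le> \<epsilon>"
    "\<And>j e k. j < m \<Longrightarrow> e \<in> E \<Longrightarrow> 0 \<le> k \<and> k < t j - int N \<or> t j + 1 + int N \<le> k \<and> k < n \<Longrightarrow>
        d (it k (z j e)) (it k e) \<le> \<epsilon>"
    unfolding Q_def by blast+
  have tri: "d u w \<le> 2 * \<epsilon>" if "u \<in> M" "v \<in> M" "w \<in> M" "d v u \<le> \<epsilon>" "d v w \<le> \<epsilon>" for u v w
    using triangle[of u v w] that commute[of u v] by simp
  \<comment> \<open>At time \<open>t j\<close> the first point is near \<open>x0\<close>, while the
    second follows \<open>e'\<close>, whose orbit stays in the image of \<tau> and hence at distance
    at least \<open>r1\<close> from \<open>x0\<close>.\<close>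
  have far: "z j e \<noteq> z j' e'" if "j < m" "j' < m" "e \<in> E" "e' \<in> E" "j \<noteq> j'" for j j' e e'
  proof
    assume eq: "z j e = z j' e'"
    have "t j < t j' - int N \<or> t j' + 1 + int N \<le> t j"
      using t_gap[of j j'] t_gap[of j' j] that(5) by linarith
    moreover have "0 \<le> t j" "t j < n" using t[OF that(1)] by auto
    ultimately have "d (it (t j) (z j e)) (it (t j) e') \<le> \<epsilon>" using z(4)[OF that(2,4)] eq by metis
    then have "d x0 (it (t j) e') \<le> 2 * \<epsilon>"
      using tri z(1,3) that EM x0(1) by (meson it_in subsetD)
    moreover obtain y where "y \<in> M" "e' = \<tau> y" using EY \<open>e' \<in> E\<close> by blast
    ultimately show False using r1(2)[of "it (t j) y"] \<tau>it \<epsilon>(3) by simp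
  qed
  define P where "P = (\<lambda>(j, e). z j e) ` ({..<m} \<times> E)"
  have PM: "P \<subseteq> M" and finP: "finite P" using z(1) E(1) by (auto simp: P_def)
  \<comment> \<open>Lower bound for \<open>card P\<close>. A point determines \<open>j\<close> by
    \<open>far\<close>, and it determines \<open>e\<close> up to 2\<epsilon> on
    \<open>[0, n)\<close> outside the window of \<open>2 * N + 1\<close> times around
    \<open>t j\<close>. The colours of \<open>e\<close> in that window supply the rest, because
    \<open>E\<close> is separated.\<close>
  have "finite ({..<m} \<times> E) \<and> card ({..<m} \<times> E) \<le> card (P \<times> ({0..<2*N+1} \<rightarrow>\<^sub>E F))"
  proof (rule card_le_if_inj)
    let ?f = "\<lambda>(j, e). (z j e, \<lambda>i\<in>{0..<2*N+1}. cell (it (t j - int N + int i) e))"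
    show "finite (P \<times> ({0..<2*N+1} \<rightarrow>\<^sub>E F))" using F(1) finP
      by (intro finite_cartesian_product finite_PiE) auto
    show "?f ` ({..<m} \<times> E) \<subseteq> P \<times> ({0..<2*N+1} \<rightarrow>\<^sub>E F)" using EM F(2) by (auto simp: P_def)
    show "inj_on ?f ({..<m} \<times> E)"
    proof (rule inj_onI, clarsimp)
      fix j e j' e' assume *: "j < m" "e \<in> E" "j' < m" "e' \<in> E" and zeq: "z j e = z j' e'"
        and ceq: "(\<lambda>i\<in>{0..<Suc (2*N)}. cell (it (t j - int N + int i) e)) = (\<lambda>i\<in>{0..<Suc (2*N)}.
            cell (it (t j' - int N + int i) e'))"
      have j: "j = j'" using far * zeq by blast
      have "d (it k e) (it k e') \<le> c/2" if k: "k \<in> {0..<n}" for k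
      proof (cases "k < t j - int N \<or> t j + 1 + int N \<le> k")
        case True
        then have "d (it k (z j e)) (it k e) \<le> \<epsilon>" "d (it k (z j e)) (it k e') \<le> \<epsilon>"
          using z(4)[OF *(1,2), of k] z(4)[OF *(3,4), of k] zeq j k by auto
        then have "d (it k e) (it k e') \<le> 2 * \<epsilon>" using tri z(1) * EM by (meson it_in subsetD)
        then show ?thesis using \<epsilon>(2) by simp
      next
        case False
        define i where "i = nat (k - (t j - int N))"
        have i: "i < Suc (2*N)" "t j - int N + int i = k" using False by (auto simp: i_def)
        have "cell (it k e) = cell (it k e')" using fun_cong[OF ceq, of i] i j by simp
        moreover have "it k e \<in> M" "it k e' \<in> M" using * EM by auto
        ultimately show ?thesis using F(3) by blast
      qed
      then have "e = e'" using E(3) * unfolding separated_def by fastforce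
      with j show "j = j' \<and> e = e'" by simp
    qed
  qed
  then have le1: "m * card E \<le> card P * q ^ (2 * N + 1)"
    using F(1) by (simp add: card_cartesian_product card_PiE q_def)
  let ?W = "{- int N..<0} \<union> {n..<n + int N}"
  have W: "card ?W = 2 * N"
    by (subst card_Un_disjoint) (auto simp: n_def)
  obtain nb where nb: "\<And>y. y \<in> ?Y \<Longrightarrow> nb y \<in> E" "\<And>y k. y \<in> ?Y \<Longrightarrow> k \<in> {0..<n} \<Longrightarrow>
      d (it k y) (it k (nb y)) \<le> c/2"
    using E(4) by metis
  \<comment> \<open>Upper bound for \<open>card P\<close>. A point is encoded by an element of
    \<open>E\<close> that its image follows on \<open>[0, n)\<close> and by the colours of its image
    on the outer transitions \<open>?W\<close>. At the remaining times the common exterior orbit and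
    \<open>r2\<close> control the images, so equal codes mean images within \<open>c\<close> at all
    times.\<close>
  have "finite P \<and> card P \<le> card (E \<times> (?W \<rightarrow>\<^sub>E F))"
  proof (rule card_le_if_inj)
    let ?f = "\<lambda>u. (nb (\<tau> u), \<lambda>k\<in>?W. cell (it k (\<tau> u)))"
    show "finite (E \<times> (?W \<rightarrow>\<^sub>E F))" using F(1) E(1)
      by (intro finite_cartesian_product finite_PiE) auto
    show "?f ` P \<subseteq> E \<times> (?W \<rightarrow>\<^sub>E F)"
    proof (intro image_subsetI SigmaI)
      fix u assume "u \<in> P"
      then have u: "u \<in> M" using PM by blast
      then show "nb (\<tau> u) \<in> E" using nb(1) by blast
      show "(\<lambda>k\<in>?W. cell (it k (\<tau> u))) \<in> ?W \<rightarrow>\<^sub>E F"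
        unfolding restrict_PiE_iff using u F(2) by simp
    qed
    show "inj_on ?f P"
    proof (rule inj_onI)
      fix u v assume uv: "u \<in> P" "v \<in> P" and eq: "?f u = ?f v"
      have M: "u \<in> M" "v \<in> M" using uv PM by auto
      have out: "d (it k u) (it k v) \<le> 2 * \<epsilon>" if "k < - int N \<or> n + int N \<le> k" for k
      proof -
        have "d (it k u) (it k x0) \<le> \<epsilon>" "d (it k v) (it k x0) \<le> \<epsilon>"
          using uv z(2) that by (auto simp: P_def)
        then show ?thesis using tri[of "it k u" "it k x0" "it k v"] M x0(1) commute by simp
      qed
      have "d (it k (\<tau> u)) (it k (\<tau> v)) \<le> c" for k
      proof -
        consider "k < - int N \<or> n + int N \<le> k" | "k \<in> ?W" | "k \<in> {0..<n}" by force
        then show ?thesis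
        proof cases
          case 1
          then have "d (\<tau> (it k u)) (\<tau> (it k v)) < c" using out[of k] \<epsilon>(4) M by (intro r2(2)) auto
          then show ?thesis using M \<tau>it by simp
        next
          case 2
          have "cell (it k (\<tau> u)) = cell (it k (\<tau> v))"
          proof -
            have "(\<lambda>k\<in>?W. cell (it k (\<tau> u))) = (\<lambda>k\<in>?W. cell (it k (\<tau> v)))" using eq by simp
            from fun_cong[OF this, of k] show ?thesis using 2 by (simp only: restrict_apply')
          qed
          then have "d (it k (\<tau> u)) (it k (\<tau> v)) \<le> c/2" using M by (intro F(3)) auto
          then show ?thesis using c0 by simp
        next
          case 3
          have "nb (\<tau> u) = nb (\<tau> v)" using eq by simp
          moreover have "nb (\<tau> u) \<in> M" using nb(1) M EM by blast
          ultimately show ?thesis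
            using nb(2)[of "\<tau> u" k] nb(2)[of "\<tau> v" k] M 3
              triangle[of "it k (\<tau> u)" "it k (nb (\<tau> u))" "it k (\<tau> v)"]
              commute[of "it k (\<tau> v)"] by fastforce
        qed
      qed
      then have "\<tau> u = \<tau> v" using c M by (auto simp: expansive_def)
      \<comment> \<open>Equal images alone do not suffice: the hypothesis on \<tau> concerns
        asymptotic pairs, and these two points are close at all large times.\<close>
      moreover have "d (it k u) (it k v) \<le> c" if "n + int N + 1 \<le> \<bar>k\<bar>" for k
      proof -
        have "0 \<le> n" by (simp add: n_def)
        then have "k < - int N \<or> n + int N \<le> k" using that by linarith
        from out[OF this] show ?thesis using \<epsilon>(2) c0 by linarith
      qed
      then have "((\<lambda>k. d (it k u) (it k v)) \<longlongrightarrow> 0) (filtercomap (\<lambda>k::int. \<bar>k\<bar>) at_top)"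
        by (rule asymptotic_if_close[OF c M])
      ultimately show "u = v" using inj M by blast
    qed
  qed
  then have "card P \<le> card E * q ^ (2 * N)"
    using F(1) by (simp add: card_cartesian_product card_PiE q_def W)
  then have "m * card E \<le> card E * q ^ (2 * N) * q ^ (2 * N + 1)" using le1
    by (meson le_trans mult_right_mono zero_le)
  also have "\<dots> = q ^ (4 * N + 1) * card E" by (simp flip: power_add)
  finally show False using E(1,2) by (simp add: m_def)
qed


section \<open>Comparison with the definitions, subsystems and mixing\<close>

lemma homeomorphic_g: "homeomorphic_map mtopology mtopology g"
proof -
  have "homeomorphic_maps mtopology mtopology g h"
    using cont_g cont_h by (simp add: homeomorphic_maps_def)
  then show ?thesis using homeomorphic_map_maps by blast
qed

lemma dynamical_system_mtopology: "dynamical_system mtopology g"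
  unfolding dynamical_system_def using compact homeomorphic_g metrizable_space_mtopology by blast

lemma inv_into_eq: "x \<in> M \<Longrightarrow> inv_into M g x = h x"
  by (rule inv_into_f_eq) (auto intro: inj_on_inverseI[where g = h])

lemma int_iterate_eq:
  assumes x: "x \<in> M"
  shows "int_iterate mtopology g k x = it k x"
proof -
  have "(inv_into M g ^^ n) x = (h ^^ n) x \<and> (h ^^ n) x \<in> M" for n
    by (induction n) (use x inv_into_eq in auto)
  then show ?thesis by (simp add: int_iterate_def zpow_def)
qed

lemma it_int: "it (int n) x = (g ^^ n) x"
  by (simp add: zpow_def)

text \<open>This puts a periodic shadowing orbit, constructed in the ambient manifold, into the
  hyperbolic set.\<close>

lemma periodic_nonwandering:
  assumes x: "x \<in> M" and P: "0 < P" "it P x = x"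
  shows "x \<in> nonwandering_set mtopology g"
proof -
  have "(g ^^ nat P) x = x" using P it_int[of "nat P" x] by simp
  moreover have "nat P \<ge> 1" using P by simp
  ultimately show ?thesis using x unfolding nonwandering_set_def by (auto intro!: exI[of _ "nat P"])
qed

lemma invariant_subsystem:
  assumes X: "closedin mtopology X" "g ` X = X"
  shows "compact_homeo X d g h" "Metric_space.mtopology X d = subtopology mtopology X"
proof -
  have XM: "X \<subseteq> M" using closedin_subset[OF X(1)] by simp
  interpret S: Submetric M d X by unfold_locales (rule XM)
  show top: "S.sub.mtopology = subtopology mtopology X" by (rule S.mtopology_submetric)
  have hX: "h x \<in> X" if "x \<in> X" for x
  proof -
    obtain z where z: "z \<in> X" "x = g z" using X(2) \<open>x \<in> X\<close> by (metis imageE)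
    then show ?thesis using hg[OF subsetD[OF XM z(1)]] by simp
  qed
  have "compactin mtopology X" using closedin_compact_space[OF compact X(1)] .
  then have comp: "compact_space (subtopology mtopology X)" by (rule compact_space_subtopology)
  have cg: "continuous_map (subtopology mtopology X) (subtopology mtopology X) g"
    using continuous_map_from_subtopology[OF cont_g] X(2)
      by (auto simp: continuous_map_in_subtopology)
  have ch: "continuous_map (subtopology mtopology X) (subtopology mtopology X) h"
    using continuous_map_from_subtopology[OF cont_h] hX
      by (auto simp: continuous_map_in_subtopology)
  show "compact_homeo X d g h"
  proof unfold_locales
    show "compact_space S.sub.mtopology" unfolding top by (rule comp)
    show "continuous_map S.sub.mtopology S.sub.mtopology g" unfolding top by (rule cg)
    show "continuous_map S.sub.mtopology S.sub.mtopology h" unfolding top by (rule ch)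
    show "h (g x) = x" "g (h x) = x" if "x \<in> X" for x using hg gh subsetD[OF XM that] by blast+
  qed
qed

lemma disjoint_closed_distance:
  assumes C: "closedin mtopology C" and D: "closedin mtopology D" and CD: "C \<inter> D = {}"
  shows "\<exists>e>0. \<forall>x\<in>C. \<forall>y\<in>D. e \<le> d x y"
proof (rule ccontr)
  assume no: "\<not> ?thesis"
  have "\<exists>x y. x \<in> C \<and> y \<in> D \<and> d x y < inverse (Suc j)" for j
  proof -
    have "0 < inverse (real (Suc j))" by simp
    with no show ?thesis by (meson not_le)
  qed
  then obtain x y where xy: "\<And>j. x j \<in> C" "\<And>j. y j \<in> D" "\<And>j. d (x j) (y j) < inverse (Suc j)"
    by metis
  have M: "x j \<in> M" "y j \<in> M" for j using xy closedin_subset[OF C] closedin_subset[OF D] by auto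
  obtain l r where l: "l \<in> M" "strict_mono (r::nat\<Rightarrow>nat)"
    "limitin mtopology (\<lambda>j. x (r j)) l sequentially"
    using seq_compact[of x] M by blast
  have "(\<lambda>j. d (x j) (y j)) \<longlonglongrightarrow> 0"
    by (rule null_seq_le_inverse) (use xy(3) in \<open>auto intro: less_imp_le\<close>)
  then have "(\<lambda>j. d (x (r j)) (y (r j))) \<longlonglongrightarrow> 0"
    using LIMSEQ_subseq_LIMSEQ[OF _ l(2), of "\<lambda>j. d (x j) (y j)"] by (simp add: o_def)
  then have yl: "limitin mtopology (\<lambda>j. y (r j)) l sequentially"
    by (rule limitin_same[OF l(3)]) (rule M)+
  have "l \<in> C" by (rule limitin_closedin[OF l(3) C]) (use xy in auto)
  moreover have "l \<in> D" by (rule limitin_closedin[OF yl D]) (use xy in auto)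
  ultimately show False using CD by blast
qed

text \<open>Mixing provides all sufficiently late times for each pair of open sets. The balls of
  radius \<open>\<delta>/2\<close> of a finite cover form finitely many pairs, so the largest
  threshold is a common transition time.\<close>

lemma connecting_if_mixing:
  assumes mix: "topologically_mixing mtopology g"
  shows connecting
  unfolding connecting_def
proof (intro allI impI)
  fix \<delta> :: real assume \<delta>: "0 < \<delta>"
  have "mtotally_bounded M"
    using compact compact_space_eq_mcomplete_mtotally_bounded by blast
  then obtain F where F: "finite F" "F \<subseteq> M" "M \<subseteq> (\<Union>x\<in>F. mball x (\<delta>/2))"
    using \<delta> unfolding mtotally_bounded_def by (meson half_gt_zero)
  have "\<exists>N. \<forall>n\<ge>N. (g ^^ n) ` mball p (\<delta>/2) \<inter> mball q (\<delta>/2) \<noteq> {}" if "p \<in> F" "q \<in> F" for p q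
  proof -
    have "p \<in> mball p (\<delta>/2)" "q \<in> mball q (\<delta>/2)" using that F(2) \<delta> by auto
    then have "mball p (\<delta>/2) \<noteq> {}" "mball q (\<delta>/2) \<noteq> {}" by blast+
    with mix show ?thesis unfolding topologically_mixing_def by (simp add: openin_mball)
  qed
  then obtain N where N: "\<And>p q n. p \<in> F \<Longrightarrow> q \<in> F \<Longrightarrow> N p q \<le> n \<Longrightarrow>
      (g ^^ n) ` mball p (\<delta>/2) \<inter> mball q (\<delta>/2) \<noteq> {}"
    by metis
  \<comment> \<open>\<open>Suc\<close> makes the time positive, as \<open>connecting\<close>
    demands.\<close>
  define N0 where "N0 = Suc (Max ((\<lambda>(p, q). N p q) ` (F \<times> F)))"
  have le: "N p q \<le> N0" if "p \<in> F" "q \<in> F" for p q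
  proof -
    have "N p q \<in> (\<lambda>(p, q). N p q) ` (F \<times> F)" using that by force
    then have "N p q \<le> Max ((\<lambda>(p, q). N p q) ` (F \<times> F))" using F(1) by (intro Max_ge) auto
    then show ?thesis by (simp add: N0_def)
  qed
  have "\<exists>z\<in>M. d z a < \<delta> \<and> d (it (int N0) z) b < \<delta>" if a: "a \<in> M" and b: "b \<in> M" for a b
  proof -
    obtain p q where p: "p \<in> F" "a \<in> mball p (\<delta>/2)" and q: "q \<in> F" "b \<in> mball q (\<delta>/2)"
      using F(3) a b by blast
    obtain z where z: "z \<in> mball p (\<delta>/2)" "(g ^^ N0) z \<in> mball q (\<delta>/2)"
      using N[OF p(1) q(1) le[OF p(1) q(1)]] by blast
    have "d z a \<le> d p z + d p a" using z p triangle'[of z a p] triangle[of z p a] commute[of z p]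
      by auto
    moreover have "d ((g ^^ N0) z) b \<le> d q ((g ^^ N0) z) + d q b"
      using z q triangle[of "(g ^^ N0) z" q b] commute[of "(g ^^ N0) z" q] by auto
    ultimately show ?thesis using z p q it_int[of N0 z] by (intro bexI[of _ z]) auto
  qed
  then show "\<exists>N\<ge>1. \<forall>a\<in>M. \<forall>b\<in>M. \<exists>z\<in>M. d z a < \<delta> \<and> d (it (int N) z) b < \<delta>"
    by (intro exI[of _ N0]) (auto simp: N0_def)
qed

lemma Myhill_property_if_specification:
  assumes "expansive c" shadowing connecting
  shows "Myhill_property mtopology g"
  unfolding Myhill_property_def
proof (intro allI impI)
  fix \<tau> assume \<tau>: "dyn_endomorphism mtopology g \<tau> \<and> pre_injective mtopology g \<tau>"
  have hom: "homoclinic mtopology g x y" if "x \<in> M" "y \<in> M"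
    "((\<lambda>k. d (it k x) (it k y)) \<longlongrightarrow> 0) (filtercomap (\<lambda>k::int. \<bar>k\<bar>) at_top)" for x y
    unfolding homoclinic_def using that Metric_space_axioms
      by (auto simp: int_iterate_eq intro!: exI[of _ d])
  have "\<tau> ` M = M"
  proof (rule surj_if_injective_on_asymptotic[OF assms])
    show "continuous_map mtopology mtopology \<tau>" "\<And>x. x \<in> M \<Longrightarrow> \<tau> (g x) = g (\<tau> x)"
      using \<tau> by (auto simp: dyn_endomorphism_def)
    fix x y assume xy: "x \<in> M" "y \<in> M" "\<tau> x = \<tau> y"
      "((\<lambda>k. d (it k x) (it k y)) \<longlongrightarrow> 0) (filtercomap (\<lambda>k::int. \<bar>k\<bar>) at_top)"
    \<comment> \<open>Injectivity is given on the class of \<open>x\<close>, so \<open>x\<close> has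
      to be seen as a member of its own class.\<close>
    have "homoclinic mtopology g x x" by (rule hom[OF xy(1,1)]) (use xy(1) in simp)
    moreover have "homoclinic mtopology g x y" by (rule hom[OF xy(1,2,4)])
    moreover have "inj_on \<tau> {y. homoclinic mtopology g x y}" using \<tau> xy(1)
      by (simp add: pre_injective_def)
    ultimately show "x = y" using xy(3) by (simp add: inj_on_def)
  qed
  then show "\<tau> ` topspace mtopology = topspace mtopology" by simp
qed

text \<open>One period consists of the \<open>2 * n + 1\<close> values of \<xi> on
  \<open>[-n, n]\<close>, shifted to start at index 0, followed by \<open>N\<close> points of the
  orbit of \<open>z\<close> that leads back to \<open>\<xi> (- n)\<close>.\<close>

lemma periodic_closing:
  assumes \<xi>: "pseudo_orbit \<delta> \<xi>" and N: "N \<ge> 1" and z: "z \<in> M" "d z (g (\<xi> (int n))) < \<delta>"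
    "d (it (int N) z) (\<xi> (- int n)) < \<delta>"
  obtains x where "\<And>k. x k \<in> M" "\<And>k. x (k + (2 * int n + 1 + int N)) = x k"
    "\<And>k. d (g (x k)) (x (k + 1)) < \<delta>"
    "\<And>k. \<bar>k\<bar> \<le> int n \<Longrightarrow> x (k + int n) = \<xi> k"
proof -
  define P where "P = 2 * int n + 1 + int N"
  have P: "0 < P" by (simp add: P_def)
  define b where "b i = (if i \<le> 2 * int n then \<xi> (i - int n) else it (i - 2 * int n - 1) z)" for i
  define x where "x i = b (i mod P)" for i
  have \<xi>M: "\<xi> k \<in> M" and \<xi>d: "d (g (\<xi> k)) (\<xi> (k + 1)) < \<delta>" for k using \<xi>
    by (auto simp: pseudo_orbit_def)
  have bM: "b i \<in> M" for i using \<xi>M z(1) by (simp add: b_def)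
  have \<delta>: "0 < \<delta>" using \<xi>d[of 0] nonneg le_less_trans by blast
  have step: "d (g (b i)) (b (i + 1)) < \<delta>" if "0 \<le> i" "i + 1 < P" for i
  proof -
    consider "i + 1 \<le> 2 * int n" | "i = 2 * int n" | "2 * int n < i" by linarith
    then show ?thesis
    proof cases
      case 1 then show ?thesis using \<xi>d[of "i - int n"] by (simp add: b_def algebra_simps)
    next
      case 2 then show ?thesis using z by (simp add: b_def commute \<xi>M)
    next
      case 3
      then have "b (i + 1) = g (b i)" using it_Suc[OF z(1), of "i - 2 * int n - 1"]
        by (simp add: b_def algebra_simps)
      moreover have "g (b i) \<in> M" using bM by simp
      ultimately show ?thesis using \<delta> by simp
    qed
  qed
  \<comment> \<open>The seam between consecutive periods: the last point of the connecting orbit is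
    sent near \<open>\<xi> (- n)\<close>.\<close>
  have wrap: "d (g (b (P - 1))) (b 0) < \<delta>"
  proof -
    have "b (P - 1) = it (int N - 1) z" using N by (simp add: b_def P_def)
    then have "g (b (P - 1)) = it (int N) z" using it_Suc[OF z(1), of "int N - 1"] by simp
    then show ?thesis using z(3) by (simp add: b_def)
  qed
  show thesis
  proof (rule that[of x])
    show "x k \<in> M" for k using bM by (simp add: x_def)
    show "x (k + (2 * int n + 1 + int N)) = x k" for k unfolding x_def P_def[symmetric] by simp
    show "d (g (x k)) (x (k + 1)) < \<delta>" for k
    proof -
      define a where "a = k mod P"
      have a: "0 \<le> a" "a < P" using P by (auto simp: a_def)
      have "(k + 1) mod P = (a + 1) mod P" by (simp add: a_def mod_simps)
      then have "(k + 1) mod P = (if a + 1 = P then 0 else a + 1)" using a by auto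
      then show ?thesis using step[of a] wrap a by (auto simp: x_def simp flip: a_def)
    qed
    show "x (k + int n) = \<xi> k" if "\<bar>k\<bar> \<le> int n" for k
      using that by (auto simp: x_def b_def P_def)
  qed
qed

end

section \<open>Finite-dimensional normed spaces\<close>

lemma finite_basis_exists:
  assumes "finite (B0::'b::real_vector set)" "span B0 = UNIV"
  obtains B where "finite B" "independent B" "span B = (UNIV :: 'b set)"
proof -
  obtain B where B: "B \<subseteq> B0" "independent B" "B0 \<subseteq> span B"
    using maximal_independent_subset[of B0] by blast
  have "span B0 \<subseteq> span B" using B(3) by (simp add: span_minimal)
  with assms that B show thesis by (metis finite_subset top.extremum_uniqueI)
qed

text \<open>The diagonal sequence is a subsequence of the \<open>n\<close>-th stage from some index
  on. Hence \<open>P\<close> has to pass to subsequences and to be insensitive to finitely many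
  initial terms. The integer indices are enumerated by \<open>from_nat\<close>.\<close>

lemma diagonal_subsequence:
  fixes P :: "int \<Rightarrow> (nat \<Rightarrow> nat) \<Rightarrow> bool"
  assumes ex: "\<And>k s. strict_mono (s :: nat \<Rightarrow> nat) \<Longrightarrow> \<exists>r. strict_mono (r :: nat \<Rightarrow> nat) \<and> P k (s \<circ> r)"
    and sub: "\<And>k s r. strict_mono (r :: nat \<Rightarrow> nat) \<Longrightarrow> P k s \<Longrightarrow> P k (s \<circ> r)"
    and tail: "\<And>k s n. P k (s \<circ> (+) n) \<Longrightarrow> P k s"
  obtains r where "strict_mono r" "\<And>k. P k r"
proof -
  interpret subseqs "\<lambda>n. P (from_nat n)" using ex by unfold_locales blast
  have "P (from_nat n) diagseq" for n
    using diagseq_holds[of n] sub tail by blast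
  then have "P k diagseq" for k by (metis from_nat_to_nat)
  with subseq_diagseq that show thesis by blast
qed

text \<open>The model space carries an arbitrary norm and may have dimension 0. Compactness of balls
  and bounds for linear maps are therefore derived from coordinates in a chosen basis.\<close>

locale finite_basis =
  fixes B :: "'b::real_normed_vector set"
  assumes fin: "finite B" and indep: "independent B" and spanB: "span B = UNIV"
begin

abbreviation coord :: "'b \<Rightarrow> 'b \<Rightarrow> real" where "coord v \<equiv> representation B v"

lemma sum_coord: "(\<Sum>b\<in>B. coord v b *\<^sub>R b) = v"
  using sum_representation_eq[OF indep, of v B] fin spanB by auto

lemma coord_sum: "coord (\<Sum>b\<in>B. a b *\<^sub>R b) b = a b" if "b \<in> B" for a
proof -
  have "coord (\<Sum>b\<in>B. a b *\<^sub>R b) b = (\<Sum>b'\<in>B. a b' * coord b' b)"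
    using indep spanB by (simp add: representation_sum representation_scale)
  also have "\<dots> = (\<Sum>b'\<in>B. if b' = b then a b' else 0)"
    using indep that by (intro sum.cong) (auto simp: representation_basis)
  finally show ?thesis using fin that by simp
qed

lemma linear_coord: "linear (\<lambda>v. coord v b)"
  using indep spanB by (intro linearI) (simp_all add: representation_add representation_scale)

lemma linear_sum_coord: "linear L \<Longrightarrow> L v = (\<Sum>b\<in>B. coord v b *\<^sub>R L b)"
  by (subst (1) sum_coord[of v, symmetric]) (simp add: linear_sum linear_scale)

text \<open>Tychonoff in the space of all coefficient functions. The factor {0} outside
  \<open>B\<close> agrees with \<open>representation\<close>, which vanishes there.\<close>

lemma compact_box: "compact {a :: 'b \<Rightarrow> real. \<forall>b. a b \<in> (if b \<in> B then {-c..c} else {0})}" (is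
  "compact ?S")
proof -
  have "?S = (\<Pi>\<^sub>E b\<in>UNIV. if b \<in> B then {-c..c} else {0})"
    unfolding PiE_UNIV_domain Pi_def by simp
  moreover have "compactin (product_topology (\<lambda>_::'b. euclidean :: real topology) UNIV) (\<Pi>\<^sub>E b\<in>UNIV.
      if b \<in> B then {-c..c} else {0})"
    by (subst compactin_PiE) auto
  ultimately show ?thesis by (simp add: euclidean_product_topology)
qed

lemma coord_outside: "b \<notin> B \<Longrightarrow> coord v b = 0"
  using representation_ne_zero by blast

lemma continuous_combination: "continuous_on UNIV (\<lambda>a :: 'b \<Rightarrow> real. \<Sum>b\<in>B. a b *\<^sub>R b)"
  by (intro continuous_intros continuous_on_product_coordinates)

text \<open>Equivalence of norms. On the compact set \<open>S\<close> of coefficients with largest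
  absolute value 1, the norm of the combination is continuous and, by independence, has a positive
  lower bound \<open>m\<close>. Scaling by the largest coordinate gives the constant
  \<open>1/m\<close>.\<close>

lemma coord_bounded: obtains K where "K > 0" "\<And>v b. \<bar>coord v b\<bar> \<le> K * norm v"
proof -
  define S where "S = {a :: 'b \<Rightarrow> real. \<forall>b. a b \<in> (if b \<in> B then {-1..1} else {0})} \<inter> (\<Union>b\<in>B. {a.
      \<bar>a b\<bar> = 1})"
  define f where "f a = norm (\<Sum>b\<in>B. a b *\<^sub>R b)" for a :: "'b \<Rightarrow> real"
  have cf: "continuous_on UNIV f" unfolding f_def
    by (intro continuous_on_norm continuous_combination)
  have "closed (\<Union>b\<in>B. {a :: 'b \<Rightarrow> real. \<bar>a b\<bar> = 1})"
    by (intro closed_UN fin ballI closed_Collect_eq continuous_intros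
      continuous_on_product_coordinates)
  then have S: "compact S" unfolding S_def using compact_box[of 1]
    by (rule compact_Int_closed[rotated])
  obtain m where m: "m > 0" "\<And>a. a \<in> S \<Longrightarrow> m \<le> f a"
  proof (cases "S = {}")
    case False
    obtain a where a: "a \<in> S" "\<And>a'. a' \<in> S \<Longrightarrow> f a \<le> f a'"
      using continuous_attains_inf[OF S False continuous_on_subset[OF cf]] by auto
    have "f a \<noteq> 0"
    proof
      assume "f a = 0"
      then have 0: "(\<Sum>b\<in>B. a b *\<^sub>R b) = 0" by (simp add: f_def)
      have "a b = 0" if "b \<in> B" for b
        using coord_sum[OF that, of a] unfolding 0 by (simp add: representation_zero)
      then show False using a(1) by (auto simp: S_def)
    qed
    then have "f a > 0" by (simp add: f_def)
    with a that show thesis by blast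
  qed (use that[of 1] in auto)
  have "\<bar>coord v b\<bar> \<le> (1/m) * norm v" for v b
  proof (cases "b \<in> B \<and> coord v b \<noteq> 0")
    case True
    define c where "c = Max ((\<lambda>b. \<bar>coord v b\<bar>) ` B)"
    have le: "\<bar>coord v b'\<bar> \<le> c" if "b' \<in> B" for b' using that fin by (simp add: c_def)
    have "c \<in> (\<lambda>b. \<bar>coord v b\<bar>) ` B" unfolding c_def using True fin by (intro Max_in) auto
    then obtain b1 where b1: "b1 \<in> B" "\<bar>coord v b1\<bar> = c" by blast
    have c0: "c > 0" using le[of b] True by linarith
    define a where "a b = coord v b / c" for b
    have "\<bar>a b\<bar> \<le> 1" if "b \<in> B" for b using le[OF that] c0 by (simp add: a_def)
    then have "a b \<in> {-1..1}" if "b \<in> B" for b using that by (simp add: abs_le_iff minus_le_iff)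
    moreover have "\<bar>a b1\<bar> = 1" using b1(2) c0 by (simp add: a_def)
    ultimately have "a \<in> S" using b1(1) coord_outside unfolding S_def by (auto simp: a_def)
    then have "m \<le> f a" by (rule m)
    also have "(\<Sum>b\<in>B. a b *\<^sub>R b) = (1/c) *\<^sub>R v"
      using arg_cong[OF sum_coord[of v], of "\<lambda>x. (1/c) *\<^sub>R x"] by (simp add: a_def scaleR_sum_right)
    then have "f a = norm v / c" using c0 by (simp add: f_def)
    finally have "c \<le> norm v / m" using c0 m by (simp add: field_simps)
    with le[of b] True show ?thesis by simp
  qed (use m coord_outside in auto)
  then show thesis using that[of "1/m"] m by simp
qed

lemma bounded_linear_coord: "bounded_linear (\<lambda>v. coord v b)"
proof -
  obtain K where "K > 0" "\<And>v b. \<bar>coord v b\<bar> \<le> K * norm v" using coord_bounded by blast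
  then show ?thesis using linear_coord[of b]
    by (intro bounded_linear_intro[of _ K]) (simp_all add: linear_add[OF linear_coord]
      linear_scale[OF linear_coord] mult.commute)
qed

text \<open>The constant depends on the basis alone, so smallness of a linear map can be tested on
  \<open>B\<close>.\<close>

lemma linear_bound:
  obtains K where "K > 0" "\<And>(L :: 'b \<Rightarrow> 'c::real_normed_vector) v e. linear L \<Longrightarrow> (\<And>b. b \<in> B \<Longrightarrow>
      norm (L b) \<le> e) \<Longrightarrow> 0 \<le> e \<Longrightarrow> norm (L v) \<le> K * e * norm v"
proof -
  obtain K where K: "K > 0" "\<And>v b. \<bar>coord v b\<bar> \<le> K * norm v" using coord_bounded by blast
  \<comment> \<open>The summand 1 keeps the constant positive in dimension 0.\<close>
  have "norm (L v) \<le> (K * (card B + 1)) * e * norm v"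
    if L: "linear L" and e: "\<And>b. b \<in> B \<Longrightarrow> norm (L b) \<le> e" "0 \<le> e" for L :: "'b \<Rightarrow> 'c" and v e
  proof -
    have "norm (L v) \<le> (\<Sum>b\<in>B. norm (coord v b *\<^sub>R L b))"
      unfolding linear_sum_coord[OF L, of v] by (rule norm_sum)
    also have "\<dots> \<le> (\<Sum>b\<in>B. (K * norm v) * e)"
      by (intro sum_mono) (use K e in \<open>auto intro!: mult_mono\<close>)
    also have "\<dots> \<le> (K * (card B + 1)) * e * norm v"
      using K(1) e by (simp add: field_simps)
    finally show ?thesis .
  qed
  then show thesis using that[of "K * (card B + 1)"] K(1) by (simp add: add_pos_nonneg)
qed

text \<open>Convergence of the maps on the basis is enough for joint convergence, because the
  coordinates of \<open>v j\<close> converge as well.\<close>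

lemma tendsto_linear_apply:
  fixes L :: "'b \<Rightarrow> 'c::real_normed_vector"
  assumes "\<And>j. linear (Lj j)" "linear L" "\<And>b. b \<in> B \<Longrightarrow> (\<lambda>j. Lj j b) \<longlonglongrightarrow> L b" "v \<longlonglongrightarrow> w"
  shows "(\<lambda>j. Lj j (v j)) \<longlonglongrightarrow> L w"
proof -
  have "(\<lambda>j. coord (v j) b) \<longlonglongrightarrow> coord w b" for b
    using bounded_linear.tendsto[OF bounded_linear_coord assms(4)] .
  then have "(\<lambda>j. \<Sum>b\<in>B. coord (v j) b *\<^sub>R Lj j b) \<longlonglongrightarrow> (\<Sum>b\<in>B. coord w b *\<^sub>R L b)"
    by (intro tendsto_intros assms(3))
  then show ?thesis using assms(1,2) by (simp flip: linear_sum_coord)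
qed

lemma compact_cball: "compact (cball (0::'b) r)"
proof -
  obtain K where K: "K > 0" "\<And>v b. \<bar>coord v b\<bar> \<le> K * norm v" using coord_bounded by blast
  let ?f = "\<lambda>a :: 'b \<Rightarrow> real. \<Sum>b\<in>B. a b *\<^sub>R b"
  let ?S = "{a :: 'b \<Rightarrow> real. \<forall>b. a b \<in> (if b \<in> B then {-(K*r)..K*r} else {0})}"
  have *: "compact (?f ` ?S)"
    by (intro compact_continuous_image compact_box continuous_on_subset[OF continuous_combination])
      simp
  have "cball 0 r \<subseteq> ?f ` ?S"
  proof
    fix v :: 'b assume "v \<in> cball 0 r"
    then have "K * norm v \<le> K * r" using K(1) by simp
    then have "\<bar>coord v b\<bar> \<le> K * r" for b using K(2) order_trans by blast
    then have "coord v b \<in> {-(K*r)..K*r}" for b by (simp add: abs_le_iff minus_le_iff)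
    then have "coord v \<in> ?S" using coord_outside by simp
    then show "v \<in> ?f ` ?S" by (rule rev_image_eqI) (simp only: sum_coord)
  qed
  then have "cball 0 r = ?f ` ?S \<inter> cball 0 r" by (rule inf_absorb2[symmetric])
  then show ?thesis using compact_Int_closed[OF * closed_cball, of 0 r] by argo
qed

lemma bounded_seq_convergent:
  assumes "\<And>j. norm (v j :: 'b) \<le> r"
  obtains w s where "strict_mono (s::nat\<Rightarrow>nat)" "(\<lambda>j. v (s j)) \<longlonglongrightarrow> w"
proof -
  have "\<forall>j. v j \<in> cball 0 r" using assms by simp
  with compact_cball[of r] that show thesis unfolding compact_def o_def by metis
qed

text \<open>The mean value inequality for \<open>F - ?D q\<close> on a convex ball. That
  \<open>q\<close> may be any point of the ball lets the base point move in the compactness argument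
  that makes this estimate uniform.\<close>

lemma strictly_differentiable:
  fixes F :: "'b \<Rightarrow> 'b"
  assumes S: "open S" and C1: "Ck_on 1 S F" and p: "p \<in> S" and e: "0 < e"
  obtains r where "0 < r" "ball p r \<subseteq> S"
    "\<And>u u' q. u \<in> ball p r \<Longrightarrow> u' \<in> ball p r \<Longrightarrow> q \<in> ball p r \<Longrightarrow>
       norm (F u - F u' - frechet_derivative F (at q) (u - u')) \<le> e * norm (u - u')"
proof -
  let ?D = "\<lambda>x. frechet_derivative F (at x)"
  have diff: "F differentiable (at x)" if "x \<in> S" for x using C1 that by simp
  have cont: "continuous_on S (\<lambda>x. ?D x v)" for v using C1 by simp
  have lin: "linear (?D x)" if "x \<in> S" for x
    using diff[OF that] by (rule linear_frechet_derivative)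
  obtain K where K: "K > 0" "\<And>(L :: 'b \<Rightarrow> 'b) v e. linear L \<Longrightarrow> (\<And>b. b \<in> B \<Longrightarrow> norm (L b) \<le> e) \<Longrightarrow> 0 \<le> e \<Longrightarrow>
      norm (L v) \<le> K * e * norm v"
    using linear_bound by metis
  \<comment> \<open>Two derivatives in the ball are each within \<open>e'\<close> of
    \<open>?D p\<close> on the basis, so their difference is bounded by
    \<open>K * (2 * e') = e\<close>.\<close>
  define e' where "e' = e / K / 2"
  have e': "e' > 0" using e K by (simp add: e'_def)
  have "\<forall>\<^sub>F x in nhds p. \<forall>b\<in>B. dist (?D x b) (?D p b) < e'"
  proof (intro eventually_ball_finite fin ballI)
    fix b
    have "isCont (\<lambda>x. ?D x b) p" using cont S p continuous_on_eq_continuous_at by blast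
    then have "((\<lambda>x. ?D x b) \<longlongrightarrow> ?D p b) (nhds p)" by (simp add: isCont_def tendsto_nhds_iff)
    then show "\<forall>\<^sub>F x in nhds p. dist (?D x b) (?D p b) < e'" using e' by (rule tendstoD)
  qed
  moreover have "\<forall>\<^sub>F x in nhds p. x \<in> S" using S p by (rule eventually_nhds_in_open)
  ultimately have "\<forall>\<^sub>F x in nhds p. x \<in> S \<and> (\<forall>b\<in>B. dist (?D x b) (?D p b) < e')"
    by eventually_elim auto
  then obtain r where r: "r > 0" "\<And>x. dist x p < r \<Longrightarrow> x \<in> S \<and> (\<forall>b\<in>B. dist (?D x b) (?D p b) < e')"
    unfolding eventually_nhds_metric by blast
  have rS: "ball p r \<subseteq> S" using r(2) by (auto simp: dist_commute)
  show thesis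
  proof (rule that[OF r(1) rS])
    fix u u' q assume u: "u \<in> ball p r" "u' \<in> ball p r" and q: "q \<in> ball p r"
    have "norm ((F u - ?D q u) - (F u' - ?D q u')) \<le> e * norm (u - u')"
    proof (rule differentiable_bound[OF convex_ball, of p r "\<lambda>x. F x - ?D q x"
      "\<lambda>x v. ?D x v - ?D q v"])
      fix x assume x: "x \<in> ball p r"
      have bl: "bounded_linear (?D q)"
        using diff q rS frechet_derivative_works has_derivative_bounded_linear by blast
      show "((\<lambda>x. F x - ?D q x) has_derivative (\<lambda>v. ?D x v - ?D q v)) (at x within ball p r)"
        using diff x rS frechet_derivative_works has_derivative_at_withinI
        by (intro has_derivative_diff bounded_linear_imp_has_derivative[OF bl]) blast
      show "onorm (\<lambda>v. ?D x v - ?D q v) \<le> e"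
      proof (rule onorm_bound)
        fix v
        have "norm (?D x v - ?D q v) \<le> K * (2 * e') * norm v"
        proof (rule K(2))
          show "linear (\<lambda>v. ?D x v - ?D q v)" using lin x q rS by (intro linear_compose_sub) auto
          fix b assume b: "b \<in> B"
          have "dist (?D x b) (?D p b) < e'" "dist (?D q b) (?D p b) < e'"
            using r(2)[of x] r(2)[of q] x q b by (simp_all add: dist_commute)
          then show "norm (?D x b - ?D q b) \<le> 2 * e'" using dist_triangle2[of "?D x b" "?D q b"
            "?D p b"] by (simp add: dist_norm)
        qed (use e' in simp)
        then show "norm (?D x v - ?D q v) \<le> e * norm v" using K(1) by (simp add: e'_def)
      qed (use e in simp)
    qed (use u in auto)
    moreover have eq: "?D q (u - u') = ?D q u - ?D q u'" using lin q rS linear_diff by blast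
    have "F u - F u' - ?D q (u - u') = (F u - ?D q u) - (F u' - ?D q u')" unfolding eq by simp
    ultimately show "norm (F u - F u' - ?D q (u - u')) \<le> e * norm (u - u')" by (simp only:)
  qed
qed

end

section \<open>Periodic solutions of linear and nonlinear recurrences\<close>

lemma fun_scaleR_apply: "(c *\<^sub>R f) x = c *\<^sub>R f x"
  by (simp add: scaleR_fun_def)

lemma fun_sum_apply: "sum f S x = (\<Sum>i\<in>S. f i x)"
  by (induction S rule: infinite_finite_induct) auto

text \<open>The ambient space will consist of all integer-indexed sequences, so finite dimension
  enters through the finite set \<open>T\<close>. A vector of \<open>V\<close> outside the image
  would yield more independent vectors in \<open>span C\<close> than \<open>C\<close> has
  elements.\<close>

lemma injective_endomorphism_surj:
  fixes L :: "'v::real_vector \<Rightarrow> 'v"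
  assumes L: "linear L" and V: "subspace V" and fin: "finite T" "V \<subseteq> span T"
    and LV: "L ` V \<subseteq> V" and inj: "inj_on L V"
  shows "L ` V = V"
proof -
  obtain C where C: "C \<subseteq> V" "independent C" "V \<subseteq> span C" using maximal_independent_subset[of V]
    by blast
  have span_C: "span C = V" using span_minimal[OF C(1) V] C(3) by blast
  have finC: "finite C" using independent_span_bound[OF fin(1) C(2) order_trans[OF C(1) fin(2)]]
    by simp
  have ind: "independent (L ` C)" using linear_independent_injective_image[OF L C(2)] inj
    unfolding span_C by blast
  have card: "card (L ` C) = card C" using inj_on_subset[OF inj C(1)] by (rule card_image)
  have "V \<subseteq> span (L ` C)"
  proof (rule subsetI, rule ccontr)
    fix x assume x: "x \<in> V" "x \<notin> span (L ` C)"
    have 1: "x \<notin> L ` C" using x(2) span_base[of x "L ` C"] by argo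
    have 2: "independent (insert x (L ` C))" using x(2) ind by (rule independent_insertI)
    have 3: "insert x (L ` C) \<subseteq> span C" using x(1) LV C(1) unfolding span_C by blast
    show False using independent_span_bound[OF finC 2 3] card finC 1 by simp
  qed
  also have "span (L ` C) = L ` V" unfolding linear_span_image[OF L] span_C ..
  finally show ?thesis using LV by blast
qed

lemma periodic_mod:
  fixes v :: "int \<Rightarrow> 'v"
  assumes n: "n > 0" and per: "\<And>k. v (k + n) = v k"
  shows "v (k mod n) = v k"
proof -
  have *: "v (j + int i * n) = v j" for i j
  proof (induction i)
    case (Suc i)
    have "v (j + int (Suc i) * n) = v ((j + int i * n) + n)" by (simp add: algebra_simps)
    also have "\<dots> = v (j + int i * n)" by (rule per)
    finally show ?case using Suc by simp
  qed simp
  have "v k = v (k mod n)"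
  proof (cases "0 \<le> k div n")
    case True
    then show ?thesis using *[of "k mod n" "nat (k div n)"] by simp
  next
    case False
    have "k + - (k div n) * n = k mod n" by (simp add: minus_div_mult_eq_mod[symmetric])
    then show ?thesis using False *[of k "nat (- (k div n))"] by simp
  qed
  then show ?thesis by simp
qed

lemma periodic_attains_max_norm:
  fixes v :: "int \<Rightarrow> 'v::real_normed_vector"
  assumes n: "n > 0" and per: "\<And>k. v (k + n) = v k"
  obtains k0 where "\<And>k. norm (v k) \<le> norm (v k0)"
proof -
  let ?N = "(\<lambda>k. norm (v k)) ` {0..<n}"
  have "Max ?N \<in> ?N" using n by (intro Max_in) auto
  then obtain k0 where k0: "Max ?N = norm (v k0)" by blast
  have "norm (v k) \<le> norm (v k0)" for k
  proof -
    have "norm (v (k mod n)) \<le> Max ?N" using n by (intro Max_ge) auto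
    then show ?thesis using k0 periodic_mod[where v = v and n = n and k = k] n per by simp
  qed
  then show thesis by (rule that)
qed

context finite_basis
begin

text \<open>\<open>L\<close> maps the finite-dimensional space of \<open>n\<close>-periodic
  sequences to itself, so a trivial kernel makes it surjective.\<close>

lemma periodic_linear_solvable:
  assumes n: "n > (0::int)" and lin: "\<And>k. linear (A k)" and per: "\<And>k. A (k + n) = A k" and w:
    "\<And>k. w (k + n) = w k"
    and inj: "\<And>v. (\<And>k. v (k + n) = v k) \<Longrightarrow> (\<And>k. v (k + 1) = A k (v k)) \<Longrightarrow> v = 0"
  obtains v :: "int \<Rightarrow> 'b" where "\<And>k. v (k + n) = v k" "\<And>k. v (k + 1) - A k (v k) = w k"
proof -
  define V where "V = {v :: int \<Rightarrow> 'b. \<forall>k. v (k + n) = v k}"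
  define L where "L v = (\<lambda>k. v (k + 1) - A k (v k))" for v :: "int \<Rightarrow> 'b"
  \<comment> \<open>For i in \<open>{0..<n}\<close>, the sequence \<open>ev (i, b)\<close> equals
    \<open>b\<close> on the residue class of i and 0 elsewhere; these sequences span
    \<open>V\<close>.\<close>
  define ev :: "int \<times> 'b \<Rightarrow> int \<Rightarrow> 'b" where "ev = (\<lambda>(i, b) k. if k mod n = i then b else 0)"
  have linL: "linear L"
    by (rule linearI) (auto simp: L_def fun_eq_iff scaleR_fun_def linear_add[OF lin] linear_scale[OF
      lin] algebra_simps)
  have V: "subspace V" by (auto simp: subspace_def V_def scaleR_fun_def)
  have LV: "L ` V \<subseteq> V"
  proof
    fix u assume "u \<in> L ` V"
    then obtain v where v: "v \<in> V" "u = L v" by blast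
    have "v (k + n + 1) = v (k + 1)" for k
      using v(1)[unfolded V_def, simplified, rule_format, of "k + 1"] by (simp add: ac_simps)
    moreover have "v (k + n) = v k" for k using v(1) by (simp add: V_def)
    ultimately show "u \<in> V" using per by (simp add: V_def v(2) L_def)
  qed
  have mod: "v (k mod n) = v k" if "v \<in> V" for v k
    using periodic_mod[where v = v and n = n and k = k] n that by (simp add: V_def)
  have span: "V \<subseteq> span (ev ` ({0..<n} \<times> B))"
  proof
    fix v assume v: "v \<in> V"
    have "v = (\<Sum>p\<in>{0..<n}\<times>B. coord (v (fst p)) (snd p) *\<^sub>R ev p)"
    proof
      fix k
      have "(\<Sum>p\<in>{0..<n}\<times>B. coord (v (fst p)) (snd p) *\<^sub>R ev p) k
          = (\<Sum>i\<in>{0..<n}. \<Sum>b\<in>B. coord (v i) b *\<^sub>R (if k mod n = i then b else 0))"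
        by (simp add: fun_sum_apply fun_scaleR_apply ev_def sum.cartesian_product case_prod_unfold)
      also have "\<dots> = (\<Sum>i\<in>{0..<n}. if k mod n = i then v i else 0)"
        by (intro sum.cong) (auto simp: sum_coord)
      also have "\<dots> = v (k mod n)" using n by simp
      finally show "v k = (\<Sum>p\<in>{0..<n}\<times>B. coord (v (fst p)) (snd p) *\<^sub>R ev p) k" using mod[OF v]
        by simp
    qed
    also have "\<dots> \<in> span (ev ` ({0..<n} \<times> B))" by (intro span_sum span_scale span_base) auto
    finally show "v \<in> span (ev ` ({0..<n} \<times> B))" .
  qed
  have "inj_on L V"
  proof (rule inj_onI)
    fix u v assume uv: "u \<in> V" "v \<in> V" "L u = L v"
    have "u (k + 1) - v (k + 1) = A k (u k - v k)" for k
      using fun_cong[OF uv(3), of k] by (simp add: L_def linear_diff[OF lin] algebra_simps)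
    then have "u - v = 0" using uv(1,2) by (intro inj) (auto simp: V_def)
    then show "u = v" by simp
  qed
  then have "L ` V = V" using injective_endomorphism_surj[OF linL V _ span LV] fin by simp
  moreover have "w \<in> V" using w by (simp add: V_def)
  ultimately have "w \<in> L ` V" by simp
  then obtain v where v: "w = L v" "v \<in> V" by (rule imageE)
  show thesis
  proof (rule that[of v])
    show "v (k + n) = v k" for k using v(2) by (simp add: V_def)
    show "v (k + 1) - A k (v k) = w k" for k by (simp add: v(1) L_def)
  qed
qed

lemma periodic_solution:
  assumes n: "n > (0::int)" and lin: "\<And>k. linear (A k)" and perA: "\<And>k. A (k + n) = A k" and perG:
    "\<And>k. G (k + n) = G k"
    and \<kappa>: "\<kappa> > 0" and \<rho>: "\<rho> > 0"
    and bound: "\<And>v b. (\<And>k. v (k + n) = v k) \<Longrightarrow> (\<And>k. norm (v (k + 1) - A k (v k)) \<le> \<kappa> * b) \<Longrightarrow>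
        (\<And>k. norm (v k) \<le> b)"
    and G: "\<And>k u u'. norm u \<le> \<rho> \<Longrightarrow> norm u' \<le> \<rho> \<Longrightarrow> norm (G k u - G k u' - A k (u - u')) \<le>
        \<kappa>/2 * norm (u - u')"
    and G0: "\<And>k. norm (G k 0) \<le> \<kappa>/2 * \<rho>"
  obtains v :: "int \<Rightarrow> 'b" where "\<And>k. v (k + n) = v k" "\<And>k. v (k + 1) = G k (v k)"
    "\<And>k. norm (v k) \<le> \<rho>"
proof -
  have bound0: "v = 0" if "\<And>k. v (k + n) = v k" "\<And>k. v (k + 1) = A k (v k)" for v :: "int \<Rightarrow> 'b"
    using bound[of v 0] that by fastforce
  define per where "per v \<longleftrightarrow> (\<forall>k. v (k + n) = v k)" for v :: "int \<Rightarrow> 'b"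
  define step where "step v u \<longleftrightarrow> per u \<and> (\<forall>k. u (k + 1) - A k (u k) = G k (v k) - A k (v k))"
    for v u :: "int \<Rightarrow> 'b"
  have "\<exists>u. per v \<longrightarrow> step v u" for v
  proof (cases "per v")
    case True
    obtain u where "\<And>k. u (k + n) = u k" "\<And>k. u (k + 1) - A k (u k) = G k (v k) - A k (v k)"
      by (rule periodic_linear_solvable[where A = A and n = n and w = "\<lambda>k. G k (v k) - A k (v k)"])
         (use n lin True perA perG bound0 in \<open>auto simp: per_def\<close>)
    then show ?thesis by (auto simp: step_def per_def)
  qed simp
  then obtain T where T: "\<And>v. per v \<Longrightarrow> step v (T v)" by metis
  define vs where "vs j = (T ^^ j) 0" for j
  have per_vs: "per (vs j)" for j
    by (induction j) (use T in \<open>auto simp: vs_def step_def per_def\<close>)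
  have step_vs: "step (vs j) (vs (Suc j))" for j using T[OF per_vs[of j]] by (simp add: vs_def)
  have vs0: "vs 0 = 0" by (simp add: vs_def)
  have shrink: "x \<le> \<rho>" if "x \<le> \<rho> * (1 - 1 / 2 ^ i)" for x :: real and i :: nat
  proof -
    have "\<rho> * (1 - 1 / 2 ^ i) \<le> \<rho> * 1" using \<rho> by (intro mult_left_mono) auto
    with that show ?thesis by simp
  qed
  \<comment> \<open>The defect at 0 gives a first step of size at most \<open>\<rho> / 2\<close>.
    The geometric sum then keeps all iterates in the ball of radius \<rho>, where \<open>G\<close>
    is controlled.\<close>
  have main: "(\<forall>k. norm (vs (Suc j) k - vs j k) \<le> \<rho> / 2 ^ Suc j) \<and>
      (\<forall>k. norm (vs (Suc j) k) \<le> \<rho> * (1 - 1 / 2 ^ Suc j))" for j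
  proof (induction j rule: less_induct)
    case (less j)
    have vsj: "norm (vs j k) \<le> \<rho> * (1 - 1 / 2 ^ j)" for k
      using less[of "j - 1"] vs0 by (cases j) auto
    have inball: "norm (vs j k) \<le> \<rho>" for k
      using vsj by (rule shrink)
    have diff: "norm (vs (Suc j) k - vs j k) \<le> \<rho> / 2 ^ Suc j" for k
    proof (rule bound[where v = "\<lambda>k. vs (Suc j) k - vs j k"])
      show "vs (Suc j) (k + n) - vs j (k + n) = vs (Suc j) k - vs j k" for k
        using per_vs by (simp add: per_def)
      fix k
      have e1: "vs (Suc j) (k + 1) = A k (vs (Suc j) k) + (G k (vs j k) - A k (vs j k))"
        using step_vs[of j] by (auto simp: step_def algebra_simps)
      show "norm (vs (Suc j) (k + 1) - vs j (k + 1) - A k (vs (Suc j) k - vs j k)) \<le>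
          \<kappa> * (\<rho> / 2 ^ Suc j)"
      proof (cases j)
        case 0
        then show ?thesis using e1 G0[of k] vs0 by (simp add: linear_0[OF lin] algebra_simps)
      next
        case (Suc i)
        have e2: "vs j (k + 1) = A k (vs j k) + (G k (vs i k) - A k (vs i k))"
          using step_vs[of i] Suc by (auto simp: step_def algebra_simps)
        have "norm (vs i k) \<le> \<rho> * (1 - 1 / 2 ^ i)"
          using less[of "i - 1"] vs0 Suc by (cases i) auto
        then have "norm (vs i k) \<le> \<rho>" by (rule shrink)
        then have "norm (G k (vs j k) - G k (vs i k) - A k (vs j k - vs i k)) \<le>
            \<kappa>/2 * norm (vs j k - vs i k)"
          by (intro G inball)
        also have "\<dots> \<le> \<kappa>/2 * (\<rho> / 2 ^ Suc i)"
          using less[of i] Suc \<kappa> by (intro mult_left_mono) auto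
        also have "\<dots> = \<kappa> * (\<rho> / 2 ^ Suc j)" using Suc by simp
        also have "G k (vs j k) - G k (vs i k) - A k (vs j k - vs i k) =
            vs (Suc j) (k + 1) - vs j (k + 1) - A k (vs (Suc j) k - vs j k)"
          unfolding e1 e2 by (simp add: linear_diff[OF lin])
        finally show ?thesis .
      qed
    qed
    have "norm (vs (Suc j) k) \<le> \<rho> * (1 - 1 / 2 ^ Suc j)" for k
    proof -
      have "norm (vs (Suc j) k) \<le> norm (vs j k) + norm (vs (Suc j) k - vs j k)"
        by (metis norm_triangle_sub)
      also have "\<dots> \<le> \<rho> * (1 - 1 / 2 ^ j) + \<rho> / 2 ^ Suc j" using vsj diff by (rule add_mono)
      also have "\<dots> = \<rho> * (1 - 1 / 2 ^ Suc j)" by (simp add: field_simps)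
      finally show ?thesis .
    qed
    with diff show ?case by blast
  qed
  have inball: "norm (vs j k) \<le> \<rho>" for j k
  proof (cases j)
    case (Suc i)
    have "norm (vs j k) \<le> \<rho> * (1 - 1 / 2 ^ Suc i)" using main Suc by blast
    then show ?thesis by (rule shrink)
  qed (use vs0 \<rho> in simp)
  \<comment> \<open>The limit comes from compactness of balls. Since consecutive iterates merge, the
    subsequence shifted by one step has the same limit, and the equation relating two iterates
    passes to it.\<close>
  obtain r where r: "strict_mono r" "\<And>k. convergent (\<lambda>j. vs (r j) k)"
  proof (rule diagonal_subsequence[of "\<lambda>k s. convergent (\<lambda>j. vs (s j) k)"])
    fix k and s :: "nat \<Rightarrow> nat"
    obtain w t where "strict_mono (t::nat\<Rightarrow>nat)" "(\<lambda>j. vs (s (t j)) k) \<longlonglongrightarrow> w"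
      using bounded_seq_convergent[of "\<lambda>j. vs (s j) k"] inball by metis
    then show "\<exists>r. strict_mono (r::nat\<Rightarrow>nat) \<and> convergent (\<lambda>j. vs ((s \<circ> r) j) k)"
      by (auto simp: convergent_def)
  next
    fix k and s t :: "nat \<Rightarrow> nat" assume "strict_mono t" "convergent (\<lambda>j. vs (s j) k)"
    then show "convergent (\<lambda>j. vs ((s \<circ> t) j) k)"
      using convergent_subseq_convergent[of "\<lambda>j. vs (s j) k" t] by (simp add: o_def)
  next
    fix k and s :: "nat \<Rightarrow> nat" and m assume "convergent (\<lambda>j. vs ((s \<circ> (+) m) j) k)"
    then show "convergent (\<lambda>j. vs (s j) k)"
      using convergent_ignore_initial_segment[of "\<lambda>j. vs (s j) k" m] by (simp add: add.commute)
  qed blast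
  then obtain v where v: "\<And>k. (\<lambda>j. vs (r j) k) \<longlonglongrightarrow> v k" unfolding convergent_def by metis
  have v': "(\<lambda>j. vs (Suc (r j)) k) \<longlonglongrightarrow> v k" for k
  proof -
    have "(\<lambda>j. \<rho> / 2 ^ Suc j) \<longlonglongrightarrow> 0" by (rule LIMSEQ_Suc[of
      "\<lambda>j. \<rho> / 2 ^ j"]) (use LIMSEQ_divide_realpow_zero[of 2 \<rho>] in simp)
    then have "(\<lambda>j. vs (Suc j) k - vs j k) \<longlonglongrightarrow> 0"
      by (rule Lim_null_comparison[rotated]) (use main in auto)
    then have "(\<lambda>j. vs (Suc (r j)) k - vs (r j) k) \<longlonglongrightarrow> 0"
      using LIMSEQ_subseq_LIMSEQ[OF _ r(1)] by (force simp: o_def)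
    from tendsto_add[OF this v[of k]] show ?thesis by simp
  qed
  have v_ball: "norm (v k) \<le> \<rho>" for k
    by (rule LIMSEQ_le_const2[OF tendsto_norm[OF v[of k]]]) (use inball in blast)
  have A_lim: "(\<lambda>j. A k (x j)) \<longlonglongrightarrow> A k y" if "x \<longlonglongrightarrow> y" for k x y
    by (rule tendsto_linear_apply[OF lin lin tendsto_const that])
  \<comment> \<open>Continuity of \<open>G k\<close> at the limit follows from its Lipschitz
    estimate relative to the linear map \<open>A k\<close>.\<close>
  have G_lim: "(\<lambda>j. G k (vs (r j) k)) \<longlonglongrightarrow> G k (v k)" for k
  proof -
    have d: "(\<lambda>j. vs (r j) k - v k) \<longlonglongrightarrow> 0" using v LIM_zero by blast
    have "(\<lambda>j. \<kappa>/2 * norm (vs (r j) k - v k)) \<longlonglongrightarrow> 0"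
      using tendsto_mult_right_zero[OF tendsto_norm_zero[OF d], of "\<kappa>/2"] .
    then have "(\<lambda>j. G k (vs (r j) k) - G k (v k) - A k (vs (r j) k - v k)) \<longlonglongrightarrow> 0"
      by (rule Lim_null_comparison[rotated]) (use G inball v_ball in auto)
    from tendsto_add[OF this A_lim[OF d, of k]] show ?thesis
      by (simp add: linear_0[OF lin] LIM_zero_iff)
  qed
  have "v (k + 1) = G k (v k)" for k
  proof -
    have 1: "(\<lambda>j. vs (Suc (r j)) (k + 1) - A k (vs (Suc (r j)) k)) \<longlonglongrightarrow> v (k + 1) - A k (v k)"
      by (intro tendsto_diff v' A_lim)
    have 2: "(\<lambda>j. G k (vs (r j) k) - A k (vs (r j) k)) \<longlonglongrightarrow> G k (v k) - A k (v k)"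
      by (intro tendsto_diff v A_lim G_lim)
    have 3: "vs (Suc (r j)) (k + 1) - A k (vs (Suc (r j)) k) = G k (vs (r j) k) - A k (vs (r j) k)"
      for j
      using step_vs by (simp add: step_def)
    have "v (k + 1) - A k (v k) = G k (v k) - A k (v k)" by (rule LIMSEQ_unique[OF 1[unfolded 3] 2])
    then show ?thesis by simp
  qed
  moreover have "v (k + n) = v k" for k
  proof (rule LIMSEQ_unique[OF _ v[of k]])
    show "(\<lambda>j. vs (r j) k) \<longlonglongrightarrow> v (k + n)" using v[of "k + n"] per_vs by (simp add: per_def)
  qed
  ultimately show thesis using that v_ball by blast
qed

end

section \<open>Metrizability\<close>

text \<open>Urysohn's metrization theorem. Each of the countably many pairs of basic open sets with
  disjoint closures receives a separating function. Together these functions define an injective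
  continuous map into a countable product of lines, which is an embedding by compactness.\<close>

lemma compact_Hausdorff_second_countable_metrizable:
  assumes comp: "compact_space X" and haus: "Hausdorff_space X" and sec: "second_countable X"
  shows "metrizable_space X"
proof -
  obtain \<B> where \<B>: "countable \<B>" "\<And>V. V \<in> \<B> \<Longrightarrow> openin X V"
    "\<And>U x. openin X U \<Longrightarrow> x \<in> U \<Longrightarrow> \<exists>V\<in>\<B>. x \<in> V \<and> V \<subseteq> U"
    using sec unfolding second_countable_def by metis
  define I where "I = {(U, V) \<in> \<B> \<times> \<B>. disjnt (X closure_of U) (X closure_of V)}"
  have normal: "normal_space X"
    using comp haus by (simp add: compact_Hausdorff_or_regular_imp_normal_space)
  have "\<exists>f. p \<in> I \<longrightarrow> continuous_map X euclideanreal f \<and> f ` (X closure_of fst p) \<subseteq> {0} \<and>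
      f ` (X closure_of snd p) \<subseteq> {1}" for p
  proof (cases "p \<in> I")
    case True
    then have "disjnt (X closure_of fst p) (X closure_of snd p)" by (auto simp: I_def)
    then obtain f where "continuous_map X (top_of_set {0..1::real}) f"
      "f ` (X closure_of fst p) \<subseteq> {0}" "f ` (X closure_of snd p) \<subseteq> {1}"
      using Urysohn_lemma[OF normal closedin_closure_of closedin_closure_of, of "fst p" "snd p" 0 1]
        by auto
    then show ?thesis by (auto simp: continuous_map_in_subtopology)
  qed simp
  then obtain f where f: "\<And>p. p \<in> I \<Longrightarrow> continuous_map X euclideanreal (f p)"
    "\<And>p. p \<in> I \<Longrightarrow> f p ` (X closure_of fst p) \<subseteq> {0}" "\<And>p. p \<in> I \<Longrightarrow> f p ` (X closure_of snd p) \<subseteq> {1}"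
    by metis
  define \<phi> where "\<phi> x = (\<lambda>p\<in>I. f p x)" for x
  have "countable I" using \<B>(1) by (auto simp: I_def intro: countable_subset[OF _ countable_SIGMA[of
    \<B> "\<lambda>_. \<B>"]])
  then have metr: "metrizable_space (product_topology (\<lambda>_. euclideanreal) I)"
    by (auto simp: metrizable_space_product_topology metrizable_space_euclidean)
  \<comment> \<open>Regularity allows basic neighbourhoods with closure inside a given open set, so
    any two points are separated by some pair in \<open>I\<close>.\<close>
  have sep: "\<exists>V\<in>\<B>. x \<in> V \<and> X closure_of V \<subseteq> U" if U: "openin X U" "x \<in> U" for U x
  proof -
    have "neighbourhood_base_of (closedin X) X"
      using compact_Hausdorff_imp_regular_space[OF comp haus]
        by (simp add: neighbourhood_base_of_closedin)
    then obtain W C where WC: "openin X W" "closedin X C" "x \<in> W" "W \<subseteq> C" "C \<subseteq> U"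
      using U unfolding neighbourhood_base_of by meson
    then obtain V where "V \<in> \<B>" "x \<in> V" "V \<subseteq> W" using \<B>(3) by blast
    moreover from this have "X closure_of V \<subseteq> C" using WC by (meson closure_of_minimal order_trans)
    ultimately show ?thesis using WC by blast
  qed
  have "inj_on \<phi> (topspace X)"
  proof (rule inj_onI, rule ccontr)
    fix x y assume xy: "x \<in> topspace X" "y \<in> topspace X" "\<phi> x = \<phi> y" "x \<noteq> y"
    obtain U V where UV: "openin X U" "openin X V" "x \<in> U" "y \<in> V" "disjnt U V"
      using haus xy unfolding Hausdorff_space_def by blast
    obtain U' V' where U': "U' \<in> \<B>" "x \<in> U'" "X closure_of U' \<subseteq> U" and V': "V' \<in> \<B>" "y \<in> V'"
      "X closure_of V' \<subseteq> V"
      using sep[OF UV(1,3)] sep[OF UV(2,4)] by blast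
    have I: "(U', V') \<in> I" using U' V' UV(5) by (auto simp: I_def disjnt_iff)
    have "x \<in> X closure_of U'" "y \<in> X closure_of V'"
      using U' V' \<B>(2) closure_of_subset openin_subset by (metis subsetD)+
    then have "f (U', V') x = 0" "f (U', V') y = 1" using f(2,3)[OF I] by auto
    then show False using fun_cong[OF xy(3), of "(U', V')"] I by (simp add: \<phi>_def)
  qed
  moreover have "continuous_map X (product_topology (\<lambda>_. euclideanreal) I) \<phi>"
    using f(1) by (auto simp: continuous_map_componentwise \<phi>_def)
  moreover have "Hausdorff_space (product_topology (\<lambda>_. euclideanreal) I)"
    using metr by (rule metrizable_imp_Hausdorff_space)
  ultimately have "embedding_map X (product_topology (\<lambda>_. euclideanreal) I) \<phi>"
    using comp continuous_imp_embedding_map by blast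
  then show ?thesis
    using metr metrizable_space_subtopology embedding_map_imp_homeomorphic_space
      homeomorphic_metrizable_space by blast
qed

section \<open>Charts and differentials\<close>

locale manifold_diffeo = compact_homeo M d f f' + finite_basis B
  for M :: "'a set" and d f f' and B :: "'b::real_normed_vector set" +
  fixes A :: "('a, 'b) chart set"
  assumes chart: "c \<in> A \<Longrightarrow> is_chart mtopology c"
    and cover: "(\<Union>c\<in>A. fst c) = M"
    and transition: "c \<in> A \<Longrightarrow> c' \<in> A \<Longrightarrow> Ck_on 1 (snd c ` (fst c \<inter> fst c')) (snd c' \<circ> chart_inv c)"
    and C1_f: "c \<in> A \<Longrightarrow> c' \<in> A \<Longrightarrow> Ck_on 1 (snd c ` {x \<in> fst c.
        f x \<in> fst c'}) (snd c' \<circ> f \<circ> chart_inv c)"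
    and C1_f': "c \<in> A \<Longrightarrow> c' \<in> A \<Longrightarrow> Ck_on 1 (snd c ` {x \<in> fst c.
        f' x \<in> fst c'}) (snd c' \<circ> f' \<circ> chart_inv c)"
begin

lemma dom_open: "c \<in> A \<Longrightarrow> openin mtopology (fst c)"
  and image_open: "c \<in> A \<Longrightarrow> open (snd c ` fst c)"
  and chart_homeo: "c \<in> A \<Longrightarrow> homeomorphic_map (subtopology mtopology (fst c)) (top_of_set (snd c `
      fst c)) (snd c)"
  using chart by (auto simp: is_chart_def)

lemma dom_subset: "c \<in> A \<Longrightarrow> fst c \<subseteq> M"
  using openin_subset[OF dom_open] by simp

lemma chart_inj: "c \<in> A \<Longrightarrow> inj_on (snd c) (fst c)"
  using homeomorphic_imp_injective_map[OF chart_homeo[of c]] dom_subset[of c]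
    by (simp add: inf_absorb2)

lemma chart_inv_chart [simp]: "c \<in> A \<Longrightarrow> x \<in> fst c \<Longrightarrow> chart_inv c (snd c x) = x"
  unfolding chart_inv_def using chart_inj by (rule inv_into_f_f)

lemma chart_chart_inv [simp]: "u \<in> snd c ` fst c \<Longrightarrow> snd c (chart_inv c u) = u"
  unfolding chart_inv_def by (rule f_inv_into_f)

lemma chart_exists: "x \<in> M \<Longrightarrow> \<exists>c\<in>A. x \<in> fst c"
  using cover by blast

lemma eventually_in_open:
  "limitin mtopology s x sequentially \<Longrightarrow> openin mtopology U \<Longrightarrow> x \<in> U \<Longrightarrow> \<forall>\<^sub>F j in sequentially. s j \<in> U"
  by (auto simp: limitin_def)

lemma tendsto_chart:
  assumes "c \<in> A" "limitin mtopology s x sequentially" "x \<in> fst c"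
  shows "(\<lambda>j. snd c (s j)) \<longlonglongrightarrow> snd c x"
proof -
  have "limitin (subtopology mtopology (fst c)) s x sequentially"
    using assms eventually_in_open[OF assms(2) dom_open] by (simp add: limitin_subtopology)
  from continuous_map_limit[OF homeomorphic_imp_continuous_map[OF chart_homeo[OF assms(1)]] this]
  show ?thesis by (simp add: o_def limitin_subtopology)
qed

lemma continuous_chart_inv:
  assumes "c \<in> A"
  shows "continuous_map (top_of_set (snd c ` fst c)) (subtopology mtopology (fst c)) (chart_inv c)"
proof -
  have top: "topspace (subtopology mtopology (fst c)) = fst c" using dom_subset[OF assms] by auto
  obtain g where g: "homeomorphic_maps (subtopology mtopology (fst c)) (top_of_set (snd c ` fst c))
      (snd c) g"
    using chart_homeo[OF assms] homeomorphic_map_maps by blast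
  have "g u = chart_inv c u" if u: "u \<in> snd c ` fst c" for u
  proof -
    obtain x where x: "x \<in> fst c" "u = snd c x" using u by blast
    then have "g u = x" using g unfolding homeomorphic_maps_def top by simp
    then show ?thesis using x assms by simp
  qed
  moreover have "continuous_map (top_of_set (snd c ` fst c)) (subtopology mtopology (fst c)) g"
    using g by (simp add: homeomorphic_maps_def)
  ultimately show ?thesis by (metis continuous_map_eq topspace_euclidean_subtopology)
qed

lemma limitin_chart_inv:
  assumes "c \<in> A" "u \<longlonglongrightarrow> p" "p \<in> snd c ` fst c"
  shows "limitin mtopology (\<lambda>j. chart_inv c (u j)) (chart_inv c p) sequentially"
proof -
  have "limitin (top_of_set (snd c ` fst c)) u p sequentially"
    using assms topological_tendstoD[OF assms(2) image_open[OF assms(1)]]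
      by (simp add: limitin_subtopology)
  from continuous_map_limit[OF continuous_chart_inv[OF assms(1)] this]
  show ?thesis by (simp add: o_def limitin_subtopology)
qed

lemma open_chart_image:
  assumes "c \<in> A" "openin mtopology W" "W \<subseteq> fst c"
  shows "open (snd c ` W)"
proof -
  have "openin (top_of_set (snd c ` fst c)) (snd c ` W)"
    using homeomorphic_map_openness[OF chart_homeo[OF assms(1)], of W] assms dom_subset[OF assms(1)]
      openin_subtopology_Int2[OF assms(2), of "fst c"]
    by (simp add: inf_absorb1 inf_absorb2)
  then show ?thesis using image_open[OF assms(1)] by (simp add: openin_open_eq)
qed

lemma open_transfer_domain:
  assumes "c \<in> A" "c' \<in> A" "continuous_map mtopology mtopology g"
  shows "open (snd c ` {x \<in> fst c. g x \<in> fst c'})"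
proof (rule open_chart_image[OF assms(1)])
  have "openin mtopology (fst c \<inter> {x \<in> topspace mtopology. g x \<in> fst c'})"
    using openin_continuous_map_preimage[OF assms(3) dom_open[OF assms(2)]] dom_open[OF assms(1)]
      by blast
  moreover have "fst c \<inter> {x \<in> topspace mtopology. g x \<in> fst c'} = {x \<in> fst c. g x \<in> fst c'}"
    using dom_subset[OF assms(1)] by auto
  ultimately show "openin mtopology {x \<in> fst c. g x \<in> fst c'}" by simp
qed auto

text \<open>For the identity this is the coordinate change from \<open>c\<close> to
  \<open>c'\<close>, so that one chain rule covers maps, coordinate changes and the compatibility of
  tangent vectors.\<close>

definition local_rep :: "('a \<Rightarrow> 'a) \<Rightarrow> ('a, 'b) chart \<Rightarrow> ('a, 'b) chart \<Rightarrow> 'b \<Rightarrow> 'b" where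
  "local_rep g c c' = snd c' \<circ> g \<circ> chart_inv c"

definition local_deriv :: "('a \<Rightarrow> 'a) \<Rightarrow> ('a, 'b) chart \<Rightarrow> ('a, 'b) chart \<Rightarrow> 'a \<Rightarrow> 'b \<Rightarrow> 'b" where
  "local_deriv g c c' x = frechet_derivative (local_rep g c c') (at (snd c x))"

text \<open>Pointwise differentiability in charts, without continuity of the derivative: enough for
  the chain rule and closed under composition, hence valid for all iterates of \<open>f\<close> and
  \<open>f'\<close>.\<close>

definition smooth :: "('a \<Rightarrow> 'a) \<Rightarrow> bool" where
  "smooth g \<longleftrightarrow> continuous_map mtopology mtopology g \<and>
    (\<forall>c\<in>A. \<forall>c'\<in>A. \<forall>x\<in>fst c. g x \<in> fst c' \<longrightarrow> local_rep g c c' differentiable (at (snd c x)))"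

lemma smooth_in: "smooth g \<Longrightarrow> x \<in> M \<Longrightarrow> g x \<in> M"
  by (auto simp: smooth_def continuous_map_def Pi_iff)

lemma smooth_has_derivative:
  assumes "smooth g" "c \<in> A" "c' \<in> A" "x \<in> fst c" "g x \<in> fst c'"
  shows "(local_rep g c c' has_derivative local_deriv g c c' x) (at (snd c x))"
proof -
  have "local_rep g c c' differentiable (at (snd c x))" using assms unfolding smooth_def by blast
  then show ?thesis unfolding local_deriv_def by (simp flip: frechet_derivative_works)
qed

lemma smooth_id: "smooth (\<lambda>x. x)"
proof -
  have "local_rep (\<lambda>x. x) c c' = snd c' \<circ> chart_inv c" for c c' by (auto simp: local_rep_def)
  then show ?thesis using transition unfolding smooth_def by auto
qed

lemma smooth_f: "smooth f" and smooth_f': "smooth f'"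
  unfolding smooth_def local_rep_def using cont_g cont_h C1_f C1_f' by auto

lemma local_deriv_linear:
  assumes "smooth g" "c \<in> A" "c' \<in> A" "x \<in> fst c" "g x \<in> fst c'"
  shows "linear (local_deriv g c c' x)"
  using smooth_has_derivative[OF assms] has_derivative_linear by blast

text \<open>The chart \<open>c'\<close> at the intermediate point is arbitrary. Since
  \<open>k\<close> agrees with the composite on \<open>M\<close> only, the two representations are
  compared on an open coordinate domain.\<close>

lemma local_rep_comp:
  assumes g: "smooth g" and h: "smooth h" and k: "\<And>y. y \<in> M \<Longrightarrow> k y = h (g y)"
    and c: "c \<in> A" "c' \<in> A" "c'' \<in> A" and x: "x \<in> fst c" "g x \<in> fst c'" "h (g x) \<in> fst c''"
  shows "(local_rep k c c'' has_derivative (\<lambda>v.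
      local_deriv h c' c'' (g x) (local_deriv g c c' x v))) (at (snd c x))"
proof (rule has_derivative_transform_within_open)
  have eq: "local_rep g c c' (snd c x) = snd c' (g x)" using c x by (simp add: local_rep_def)
  show "((local_rep h c' c'' \<circ> local_rep g c c') has_derivative (\<lambda>v.
      local_deriv h c' c'' (g x) (local_deriv g c c' x v))) (at (snd c x))"
    using diff_chain_at[OF smooth_has_derivative[OF g c(1,2) x(1,2)], of "local_rep h c' c''"
      "local_deriv h c' c'' (g x)"]
      smooth_has_derivative[OF h c(2,3) x(2,3)] eq by (simp add: o_def)
  show "open (snd c ` {x \<in> fst c. g x \<in> fst c'})"
    using open_transfer_domain[OF c(1,2)] g by (simp add: smooth_def)
  show "snd c x \<in> snd c ` {x \<in> fst c. g x \<in> fst c'}" using x by blast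
  fix u assume "u \<in> snd c ` {x \<in> fst c. g x \<in> fst c'}"
  then obtain y where y: "y \<in> fst c" "g y \<in> fst c'" "u = snd c y" by blast
  then show "(local_rep h c' c'' \<circ> local_rep g c c') u = local_rep k c c'' u"
    using c k[OF subsetD[OF dom_subset[OF c(1)] y(1)]] by (simp add: local_rep_def)
qed

lemma smooth_comp:
  assumes g: "smooth g" and h: "smooth h"
  shows "smooth (\<lambda>x. h (g x))"
  unfolding smooth_def
proof (intro conjI ballI impI)
  show "continuous_map mtopology mtopology (\<lambda>x. h (g x))"
    using continuous_map_compose[of mtopology mtopology g mtopology h] g h
      by (simp add: smooth_def o_def)
  fix c c'' x assume c: "c \<in> A" "c'' \<in> A" "x \<in> fst c" "h (g x) \<in> fst c''"
  then have "g x \<in> M" using smooth_in[OF g] dom_subset by blast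
  then obtain c' where "c' \<in> A" "g x \<in> fst c'" using chart_exists by blast
  then show "local_rep (\<lambda>x. h (g x)) c c'' differentiable at (snd c x)"
    using local_rep_comp[OF g h, of "\<lambda>x. h (g x)" c c' c'' x] c unfolding differentiable_def
      by blast
qed

lemma smooth_funpow: "smooth g \<Longrightarrow> smooth (g ^^ n)"
proof (induction n)
  case 0 then show ?case using smooth_id by (simp add: id_def)
next
  case (Suc n) then show ?case using smooth_comp[of "g ^^ n" g] by (simp add: o_def)
qed

lemma local_deriv_comp:
  assumes "smooth g" "smooth h" "\<And>y. y \<in> M \<Longrightarrow> k y = h (g y)"
    "c \<in> A" "c' \<in> A" "c'' \<in> A" "x \<in> fst c" "g x \<in> fst c'" "h (g x) \<in> fst c''"
  shows "local_deriv k c c'' x v = local_deriv h c' c'' (g x) (local_deriv g c c' x v)"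
  unfolding local_deriv_def[of k]
  by (rule fun_cong[OF sym]) (rule frechet_derivative_at[OF local_rep_comp[OF assms]])

lemma local_deriv_id:
  assumes "c \<in> A" "x \<in> fst c"
  shows "local_deriv (\<lambda>x. x) c c x v = v"
proof -
  have "(local_rep (\<lambda>x. x) c c has_derivative (\<lambda>v. v)) (at (snd c x))"
    by (rule has_derivative_transform_within_open[OF has_derivative_ident image_open[OF assms(1)]])
       (use assms in \<open>auto simp: local_rep_def\<close>)
  from frechet_derivative_at[OF this] show ?thesis unfolding local_deriv_def by metis
qed

lemma tangent_space_iff:
  "v \<in> tangent_space A x \<longleftrightarrow>
    (\<forall>c\<in>A. \<forall>c'\<in>A. x \<in> fst c \<longrightarrow> x \<in> fst c' \<longrightarrow> v c' = local_deriv (\<lambda>x. x) c c' x (v c)) \<and>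
    (\<forall>c. \<not> (c \<in> A \<and> x \<in> fst c) \<longrightarrow> v c = 0)"
proof -
  have "local_rep (\<lambda>x. x) c c' = snd c' \<circ> chart_inv c" for c c' by (auto simp: local_rep_def)
  then show ?thesis
    unfolding local_deriv_def
    by (simp add: tangent_space_def charts_at_def Ball_def imp_conjL del: split_paired_All)
qed

lemma tangent_coord:
  "v \<in> tangent_space A x \<Longrightarrow> c \<in> A \<Longrightarrow> c' \<in> A \<Longrightarrow> x \<in> fst c \<Longrightarrow> x \<in> fst c' \<Longrightarrow>
      v c' = local_deriv (\<lambda>x. x) c c' x (v c)"
  unfolding tangent_space_iff by blast

lemma tangent_outside: "v \<in> tangent_space A x \<Longrightarrow> \<not> (c \<in> A \<and> x \<in> fst c) \<Longrightarrow> v c = 0"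
  unfolding tangent_space_iff by blast

lemma tangent_spaceI:
  assumes "\<And>c c'. c \<in> A \<Longrightarrow> c' \<in> A \<Longrightarrow> x \<in> fst c \<Longrightarrow> x \<in> fst c' \<Longrightarrow> v c' = local_deriv (\<lambda>x. x) c c' x (v c)"
    "\<And>c. \<not> (c \<in> A \<and> x \<in> fst c) \<Longrightarrow> v c = 0"
  shows "v \<in> tangent_space A x"
  using assms unfolding tangent_space_iff by blast

lemma tangent_eqI:
  assumes "v \<in> tangent_space A x" "w \<in> tangent_space A x" "c \<in> A" "x \<in> fst c" "v c = w c"
  shows "v = w"
proof
  fix c'
  show "v c' = w c'"
    using tangent_coord[OF assms(1,3), of c'] tangent_coord[OF assms(2,3), of c'] tangent_outside[OF
      assms(1), of c'] tangent_outside[OF assms(2), of c'] assms(4,5)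
    by (cases "c' \<in> A \<and> x \<in> fst c'") auto
qed

lemma subspace_tangent_space: "subspace (tangent_space A x)"
proof (rule subspaceI)
  have lin: "linear (local_deriv (\<lambda>x. x) c c' x)" if "c \<in> A" "c' \<in> A" "x \<in> fst c" "x \<in> fst c'"
    for c c'
    using local_deriv_linear[OF smooth_id] that by blast
  show "0 \<in> tangent_space A x"
    by (rule tangent_spaceI) (simp_all add: linear_0[OF lin])
  fix v assume v: "v \<in> tangent_space A x"
  show "v + w \<in> tangent_space A x" if w: "w \<in> tangent_space A x" for w
  proof (rule tangent_spaceI)
    fix c c' assume c: "c \<in> A" "c' \<in> A" "x \<in> fst c" "x \<in> fst c'"
    show "(v + w) c' = local_deriv (\<lambda>x. x) c c' x ((v + w) c)"
      using tangent_coord[OF v c] tangent_coord[OF w c] by (simp add: linear_add[OF lin[OF c]])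
  qed (use tangent_outside[OF v] tangent_outside[OF w] in simp)
  show "a *\<^sub>R v \<in> tangent_space A x" for a
  proof (rule tangent_spaceI)
    fix c c' assume c: "c \<in> A" "c' \<in> A" "x \<in> fst c" "x \<in> fst c'"
    show "(a *\<^sub>R v) c' = local_deriv (\<lambda>x. x) c c' x ((a *\<^sub>R v) c)"
      using tangent_coord[OF v c] by (simp add: scaleR_fun_def linear_scale[OF lin[OF c]])
  qed (use tangent_outside[OF v] in \<open>simp add: scaleR_fun_def\<close>)
qed

text \<open>The inverse of reading a tangent vector at \<open>x\<close> in the chart
  \<open>c\<close>.\<close>

definition tangent_lift :: "'a \<Rightarrow> ('a, 'b) chart \<Rightarrow> 'b \<Rightarrow> ('a, 'b) tvec" where
  "tangent_lift x c u = (\<lambda>c'. if c' \<in> A \<and> x \<in> fst c' then local_deriv (\<lambda>x. x) c c' x u else 0)"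

lemma tangent_lift:
  assumes "c \<in> A" "x \<in> fst c"
  shows "tangent_lift x c u \<in> tangent_space A x" "tangent_lift x c u c = u"
proof -
  have *: "local_deriv (\<lambda>x. x) c c'' x u = local_deriv (\<lambda>x. x) c' c'' x (local_deriv (\<lambda>x.
      x) c c' x u)"
    if "c' \<in> A" "c'' \<in> A" "x \<in> fst c'" "x \<in> fst c''" for c' c''
    by (rule local_deriv_comp[OF smooth_id smooth_id refl assms(1) that(1,2) assms(2) that(3,4)])
  show "tangent_lift x c u \<in> tangent_space A x"
  proof (rule tangent_spaceI)
    fix c1 c2 assume c: "c1 \<in> A" "c2 \<in> A" "x \<in> fst c1" "x \<in> fst c2"
    then show "tangent_lift x c u c2 = local_deriv (\<lambda>x. x) c1 c2 x (tangent_lift x c u c1)"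
      using *[OF c] by (simp only: tangent_lift_def if_True conj_absorb simp_thms)
  qed (auto simp: tangent_lift_def)
  show "tangent_lift x c u c = u" using assms by (simp add: tangent_lift_def local_deriv_id)
qed

text \<open>\<open>differential\<close> evaluates in a chart picked by choice. The passage from
  \<open>c\<close> to that chart is a coordinate change, which the chain rule absorbs.\<close>

lemma differential_coord:
  assumes g: "smooth g" and v: "v \<in> tangent_space A x" and c: "c \<in> A" "c' \<in> A" "x \<in> fst c"
    "g x \<in> fst c'"
  shows "differential A g x v c' = local_deriv g c c' x (v c)"
proof -
  define c0 where "c0 = (SOME c. c \<in> charts_at A x)"
  have "c0 \<in> charts_at A x" unfolding c0_def using c by (intro someI) (auto simp: charts_at_def)
  then have c0: "c0 \<in> A" "x \<in> fst c0" by (auto simp: charts_at_def)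
  have "differential A g x v c' = local_deriv g c0 c' x (v c0)"
    using c by (simp add: differential_def charts_at_def c0_def local_deriv_def local_rep_def
      Let_def)
  also have "v c0 = local_deriv (\<lambda>x. x) c c0 x (v c)" using tangent_coord[OF v] c c0 by blast
  also have "local_deriv g c0 c' x \<dots> = local_deriv g c c' x (v c)"
    using local_deriv_comp[OF smooth_id g, of g c c0 c' x] c c0 by simp
  finally show ?thesis .
qed

lemma differential_in:
  assumes g: "smooth g" and v: "v \<in> tangent_space A x" and x: "x \<in> M"
  shows "differential A g x v \<in> tangent_space A (g x)"
proof -
  obtain c where c: "c \<in> A" "x \<in> fst c" using x chart_exists by blast
  show ?thesis
  proof (rule tangent_spaceI)
    fix c1 c2 assume *: "c1 \<in> A" "c2 \<in> A" "g x \<in> fst c1" "g x \<in> fst c2"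
    show "differential A g x v c2 = local_deriv (\<lambda>x. x) c1 c2 (g x) (differential A g x v c1)"
      using differential_coord[OF g v c(1) _ c(2)] * local_deriv_comp[OF g smooth_id, of g c c1 c2
        x] c by simp
  next
    fix c' assume "\<not> (c' \<in> A \<and> g x \<in> fst c')"
    then show "differential A g x v c' = 0" by (auto simp: differential_def charts_at_def)
  qed
qed

lemma differential_comp:
  assumes g: "smooth g" and h: "smooth h" and k: "smooth k" "\<And>y. y \<in> M \<Longrightarrow> k y = h (g y)"
    and v: "v \<in> tangent_space A x" and x: "x \<in> M"
  shows "differential A k x v = differential A h (g x) (differential A g x v)"
proof -
  obtain c where c: "c \<in> A" "x \<in> fst c" using x chart_exists by blast
  obtain c' where c': "c' \<in> A" "g x \<in> fst c'" using x chart_exists smooth_in[OF g] by blast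
  obtain c'' where c'': "c'' \<in> A" "h (g x) \<in> fst c''"
    using x chart_exists smooth_in[OF g] smooth_in[OF h] by blast
  show ?thesis
  proof (rule tangent_eqI[OF _ _ c''])
    show "differential A k x v \<in> tangent_space A (h (g x))"
      using differential_in[OF k(1) v x] k(2)[OF x] by simp
    show "differential A h (g x) (differential A g x v) \<in> tangent_space A (h (g x))"
      by (rule differential_in[OF h differential_in[OF g v x] smooth_in[OF g x]])
    show "differential A k x v c'' = differential A h (g x) (differential A g x v) c''"
      using differential_coord[OF k(1) v c(1) c''(1) c(2)] k(2)[OF x] c''
        differential_coord[OF h differential_in[OF g v x] c'(1) c''(1) c'(2) c''(2)]
          differential_coord[OF g v c(1) c'(1) c(2) c'(2)]
        local_deriv_comp[OF g h k(2) c(1) c'(1) c''(1) c(2) c'(2) c''(2)] by simp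
  qed
qed

lemma differential_ident:
  assumes k: "smooth k" "\<And>y. y \<in> M \<Longrightarrow> k y = y" and v: "v \<in> tangent_space A x" and x: "x \<in> M"
  shows "differential A k x v = v"
proof -
  obtain c where c: "c \<in> A" "x \<in> fst c" using x chart_exists by blast
  have kx: "k x = x" using k x by simp
  show ?thesis
  proof (rule tangent_eqI[OF _ v c])
    show "differential A k x v \<in> tangent_space A x" using differential_in[OF k(1) v x] kx by simp
    have "differential A k x v c = local_deriv k c c x (v c)"
      using differential_coord[OF k(1) v] c kx by simp
    also have "\<dots> = local_deriv (\<lambda>x. x) c c x (local_deriv (\<lambda>x. x) c c x (v c))"
      using local_deriv_comp[OF smooth_id smooth_id k(2), of c c c x] c by simp
    finally show "differential A k x v c = v c" using local_deriv_id[OF c] by simp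
  qed
qed

lemma differential_linear:
  assumes g: "smooth g" and v: "v \<in> tangent_space A x" and w: "w \<in> tangent_space A x" and x: "x \<in> M"
  shows "differential A g x (v + w) = differential A g x v + differential A g x w"
proof -
  obtain c where c: "c \<in> A" "x \<in> fst c" using x chart_exists by blast
  obtain c' where c': "c' \<in> A" "g x \<in> fst c'" using x chart_exists smooth_in[OF g] by blast
  have vw: "v + w \<in> tangent_space A x" using v w subspace_add[OF subspace_tangent_space] by blast
  show ?thesis
  proof (rule tangent_eqI[OF differential_in[OF g vw x] _ c'])
    show "differential A g x v + differential A g x w \<in> tangent_space A (g x)"
      by (intro subspace_add[OF subspace_tangent_space] differential_in g v w x)
    show "differential A g x (v + w) c' = (differential A g x v + differential A g x w) c'"
      using differential_coord[OF g _ c(1) c'(1) c(2) c'(2)] v w vw linear_add[OF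
        local_deriv_linear[OF g c(1) c'(1) c(2) c'(2)]] by simp
  qed
qed

end

section \<open>Uniform estimates over a finite atlas\<close>

lemma finite_range_constant_subseq:
  fixes s :: "nat \<Rightarrow> 'x"
  assumes "finite S" "\<And>j. s j \<in> S"
  obtains r a where "strict_mono (r :: nat \<Rightarrow> nat)" "a \<in> S" "\<And>j. s (r j) = a"
proof -
  have "finite (range s)" using assms by (meson finite_subset image_subsetI)
  from pigeonhole_infinite[OF infinite_UNIV_nat this]
  obtain j0 where "infinite {j \<in> UNIV. s j = s j0}" by blast
  then have inf: "infinite {j. s j = s j0}" by simp
  show thesis
  proof (rule that[of "enumerate {j. s j = s j0}" "s j0"])
    show "strict_mono (enumerate {j. s j = s j0})" using inf by (rule strict_mono_enumerate)
    show "s (enumerate {j. s j = s j0} j) = s j0" for j using enumerate_in_set[OF inf, of j] by simp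
  qed (rule assms(2))
qed

context manifold_diffeo
begin

text \<open>The points whose distance to the outside of the chart domain is at least
  \<open>r\<close>. This set is closed, so limits of its points stay in the domain, and everything
  within \<open>r\<close> of it can be read in the same chart.\<close>

definition core :: "real \<Rightarrow> ('a, 'b) chart \<Rightarrow> 'a set" where
  "core r c = {x \<in> M. \<forall>y\<in>M. d x y < r \<longrightarrow> y \<in> fst c}"

lemma core_subset: "0 < r \<Longrightarrow> core r c \<subseteq> fst c"
  by (auto simp: core_def)

lemma limitin_core:
  assumes "limitin mtopology s x sequentially" "\<And>j. s j \<in> core r c"
  shows "x \<in> core r c"
proof -
  have x: "x \<in> M" using assms(1) limitin_in by blast
  have "y \<in> fst c" if y: "y \<in> M" "d x y < r" for y
  proof -
    have "limitin mtopology (\<lambda>j. y) y sequentially" using y by simp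
    from order_tendstoD(2)[OF limitin_dist[OF assms(1) this] y(2)]
    obtain j where "d (s j) y < r" by (auto simp: eventually_sequentially)
    then show ?thesis using assms(2)[of j] y by (auto simp: core_def)
  qed
  with x show ?thesis by (auto simp: core_def)
qed

lemma compactin_core: "compactin mtopology (core r c)"
  unfolding compactin_sequentially
proof (intro conjI allI impI)
  show "core r c \<subseteq> M" by (auto simp: core_def)
  fix s :: "nat \<Rightarrow> 'a" assume s: "range s \<subseteq> core r c"
  then have "s j \<in> M" for j by (auto simp: core_def)
  then obtain x q where q: "strict_mono (q::nat\<Rightarrow>nat)"
    "limitin mtopology (\<lambda>j. s (q j)) x sequentially"
    using seq_compact by blast
  moreover have "x \<in> core r c" by (rule limitin_core[OF q(2)]) (use s in blast)
  ultimately show "\<exists>l q. l \<in> core r c \<and> strict_mono q \<and> limitin mtopology (s \<circ> q) l sequentially"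
    unfolding o_def by blast
qed

text \<open>\<open>r\<close> is a Lebesgue number of a finite subcover: points lying in no core as
  the radius shrinks to 0 would accumulate inside some open chart domain.\<close>

lemma finite_atlas:
  obtains A0 r where "finite A0" "A0 \<subseteq> A" "0 < r" "\<And>x. x \<in> M \<Longrightarrow> \<exists>c\<in>A0. x \<in> core r c"
proof -
  have "compactin mtopology M" using compact by (simp add: compact_space_def)
  then have "\<exists>\<F>. finite \<F> \<and> \<F> \<subseteq> fst ` A \<and> M \<subseteq> \<Union>\<F>"
    by (rule compactinD) (use dom_open cover in auto)
  then obtain A0 where A0: "finite A0" "A0 \<subseteq> A" "M \<subseteq> (\<Union>c\<in>A0. fst c)"
    by (metis finite_subset_image)
  have "\<exists>r>0. \<forall>x\<in>M. \<exists>c\<in>A0. x \<in> core r c"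
  proof (rule ccontr)
    assume "\<not> ?thesis"
    then have "\<exists>x\<in>M. \<forall>c\<in>A0. x \<notin> core (inverse (Suc j)) c" for j
      by (meson inverse_positive_iff_positive of_nat_0_less_iff zero_less_Suc)
    then obtain x where x: "\<And>j. x j \<in> M" "\<And>j c. c \<in> A0 \<Longrightarrow> x j \<notin> core (inverse (Suc j)) c" by metis
    obtain p q where p: "p \<in> M" "strict_mono (q::nat\<Rightarrow>nat)"
      "limitin mtopology (\<lambda>j. x (q j)) p sequentially"
      using seq_compact[of x] x(1) by blast
    obtain c where c: "c \<in> A0" "p \<in> fst c" using A0(3) p(1) by blast
    have "\<exists>y. y \<in> M \<and> d (x j) y < inverse (Suc j) \<and> y \<notin> fst c" for j
      using x(1)[of j] x(2)[OF c(1), of j] by (auto simp: core_def)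
    then obtain y where y: "\<And>j. y j \<in> M" "\<And>j. d (x j) (y j) < inverse (Suc j)" "\<And>j. y j \<notin> fst c"
      by metis
    have "(\<lambda>j. d (x j) (y j)) \<longlonglongrightarrow> 0"
      by (rule null_seq_le_inverse) (use y(2) in \<open>auto intro: less_imp_le\<close>)
    then have "(\<lambda>j. d (x (q j)) (y (q j))) \<longlonglongrightarrow> 0"
      using LIMSEQ_subseq_LIMSEQ[OF _ p(2), of "\<lambda>j. d (x j) (y j)"] by (simp add: o_def)
    then have "limitin mtopology (\<lambda>j. y (q j)) p sequentially"
      by (rule limitin_same[OF p(3)]) (rule x y)+
    from eventually_in_open[OF this dom_open c(2)] c(1) A0(2)
    have "\<forall>\<^sub>F j in sequentially. y (q j) \<in> fst c" by blast
    then show False using y(3) by simp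
  qed
  with A0 that show thesis by metis
qed

lemma tendsto_local_deriv:
  assumes "c \<in> A" "c' \<in> A" "limitin mtopology s x sequentially" "x \<in> fst c" "f x \<in> fst c'"
  shows "(\<lambda>j. local_deriv f c c' (s j) v) \<longlonglongrightarrow> local_deriv f c c' x v"
proof -
  let ?S = "snd c ` {x \<in> fst c. f x \<in> fst c'}"
  have "continuous_on ?S (\<lambda>u. frechet_derivative (local_rep f c c') (at u) v)"
    using C1_f[OF assms(1,2)] by (simp add: local_rep_def)
  moreover have "open ?S" by (rule open_transfer_domain[OF assms(1,2) cont_g])
  moreover have "snd c x \<in> ?S" using assms(4,5) by blast
  ultimately have "isCont (\<lambda>u. frechet_derivative (local_rep f c c') (at u) v) (snd c x)"
    using continuous_on_eq_continuous_at by blast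
  from isCont_tendsto_compose[OF this tendsto_chart[OF assms(1,3,4)]]
  show ?thesis by (simp add: local_deriv_def)
qed

text \<open>The continuity of a Riemannian metric is expressed through continuous sections;
  coordinate frames provide them.\<close>

lemma continuous_section_lift:
  assumes c: "c \<in> A"
  shows "continuous_section mtopology A (fst c) (\<lambda>p. tangent_lift p c b)"
  unfolding continuous_section_def
proof (intro conjI ballI)
  show "tangent_lift p c b \<in> tangent_space A p" if "p \<in> fst c" for p
    using tangent_lift(1)[OF c that] .
  fix c' assume c': "c' \<in> A"
  let ?h = "\<lambda>u. frechet_derivative (snd c' \<circ> chart_inv c) (at u) b" and ?S =
    "snd c ` (fst c \<inter> fst c')"
  have "continuous_on ?S ?h" using transition[OF c c'] by simp
  then have h: "continuous_map (top_of_set ?S) euclidean ?h" by simp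
  have "continuous_map (subtopology mtopology (fst c)) euclidean (snd c)"
    using homeomorphic_imp_continuous_map[OF chart_homeo[OF c]]
      by (simp add: continuous_map_in_subtopology)
  then have "continuous_map (subtopology mtopology (fst c \<inter> fst c')) euclidean (snd c)"
    by (rule continuous_map_from_subtopology_mono) simp
  then have "continuous_map (subtopology mtopology (fst c \<inter> fst c')) (top_of_set ?S) (snd c)"
    by (auto simp: continuous_map_in_subtopology)
  from continuous_map_compose[OF this h]
  have "continuous_map (subtopology mtopology (fst c \<inter> fst c')) euclidean (?h \<circ> snd c)" .
  then show "continuous_map (subtopology mtopology (fst c \<inter> fst c')) euclidean (\<lambda>p.
      tangent_lift p c b c')"
  proof (rule continuous_map_eq)
    have "local_rep (\<lambda>x. x) c c' = snd c' \<circ> chart_inv c" by (auto simp: local_rep_def)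
    then show "(?h \<circ> snd c) p = tangent_lift p c b c'"
      if "p \<in> topspace (subtopology mtopology (fst c \<inter> fst c'))" for p
      using that c' by (simp add: tangent_lift_def local_deriv_def)
  qed
qed

lemma tangent_lift_sum:
  assumes "c \<in> A" "p \<in> fst c"
  shows "tangent_lift p c u = (\<Sum>b\<in>B. coord u b *\<^sub>R tangent_lift p c b)"
proof
  fix c'
  show "tangent_lift p c u c' = (\<Sum>b\<in>B. coord u b *\<^sub>R tangent_lift p c b) c'"
  proof (cases "c' \<in> A \<and> p \<in> fst c'")
    case True
    then have "tangent_lift p c b c' = local_deriv (\<lambda>x. x) c c' p b" for b
      by (simp only: tangent_lift_def if_True simp_thms)
    then show ?thesis
      using linear_sum_coord[OF local_deriv_linear[OF smooth_id assms(1) _ assms(2)], of c' u] True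
      by (simp add: fun_sum_apply fun_scaleR_apply)
  next
    case False
    then have "tangent_lift p c b c' = 0" for b by (auto simp: tangent_lift_def)
    then show ?thesis by (simp add: fun_sum_apply fun_scaleR_apply)
  qed
qed


text \<open>Here \<open>x'\<close> plays the next point of a pseudo-orbit: it lies in the core of
  the next chart, while \<open>f x\<close> is merely close to it. Along a sequence of
  counterexamples both converge to \<open>f l\<close>, which therefore lies in that core too, and
  strict differentiability near \<open>l\<close> contradicts the failure at nearby base
  points.\<close>

lemma uniform_strict_differentiability:
  assumes A0: "finite A0" "A0 \<subseteq> A" and r: "0 < r" and e: "0 < e"
  shows "\<exists>\<rho>>0. \<forall>c\<in>A0. \<forall>c'\<in>A0. \<forall>x\<in>core r c. \<forall>x'\<in>core r c'. d (f x) x' < \<rho> \<longrightarrow>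
      ball (snd c x) \<rho> \<subseteq> snd c ` {y \<in> fst c. f y \<in> fst c'} \<and>
      (\<forall>u\<in>ball (snd c x) \<rho>. \<forall>u'\<in>ball (snd c x) \<rho>.
        norm (local_rep f c c' u - local_rep f c c' u' - local_deriv f c c' x (u - u'))
          \<le> e * norm (u - u'))"
proof (rule ccontr)
  define Q where "Q \<rho> c c' x \<longleftrightarrow> ball (snd c x) \<rho> \<subseteq> snd c ` {y \<in> fst c. f y \<in> fst c'} \<and>
      (\<forall>u\<in>ball (snd c x) \<rho>. \<forall>u'\<in>ball (snd c x) \<rho>.
        norm (local_rep f c c' u - local_rep f c c' u' - local_deriv f c c' x (u - u'))
          \<le> e * norm (u - u'))" for \<rho> c c' x
  assume "\<not> ?thesis"
  then have no: "\<not> (\<exists>\<rho>>0. \<forall>c\<in>A0. \<forall>c'\<in>A0. \<forall>x\<in>core r c. \<forall>x'\<in>core r c'. d (f x) x' < \<rho> \<longrightarrow> Q \<rho> c c' x)"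
    unfolding Q_def .
  have "\<exists>p x x'. p \<in> A0 \<times> A0 \<and> x \<in> core r (fst p) \<and> x' \<in> core r (snd p) \<and>
      d (f x) x' < inverse (Suc j) \<and> \<not> Q (inverse (Suc j)) (fst p) (snd p) x" for j
  proof -
    have "0 < inverse (real (Suc j))" by simp
    then obtain c c' x x' where "c \<in> A0" "c' \<in> A0" "x \<in> core r c" "x' \<in> core r c'"
      "d (f x) x' < inverse (Suc j)" "\<not> Q (inverse (Suc j)) c c' x"
      using no by blast
    then show ?thesis by (intro exI[of _ "(c, c')"] exI[of _ x] exI[of _ x']) simp
  qed
  then obtain p x x' where px: "\<And>j. p j \<in> A0 \<times> A0" "\<And>j. x j \<in> core r (fst (p j))"
    "\<And>j. x' j \<in> core r (snd (p j))"
    "\<And>j. d (f (x j)) (x' j) < inverse (Suc j)"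
      "\<And>j. \<not> Q (inverse (Suc j)) (fst (p j)) (snd (p j)) (x j)" by metis
  have xM: "x j \<in> M" "x' j \<in> M" for j using px(2,3) by (auto simp: core_def)
  obtain s1 a where s1: "strict_mono (s1::nat\<Rightarrow>nat)" "a \<in> A0 \<times> A0" "\<And>j. p (s1 j) = a"
    using finite_range_constant_subseq[OF finite_cartesian_product[OF A0(1) A0(1)], of p] px(1)
      by blast
  obtain l s2 where l: "strict_mono (s2::nat\<Rightarrow>nat)"
    "limitin mtopology (\<lambda>j. x (s1 (s2 j))) l sequentially"
    using seq_compact[of "\<lambda>j. x (s1 j)"] xM by metis
  define s where "s j = s1 (s2 j)" for j
  define c c' where "c = fst a" and "c' = snd a"
  have s: "strict_mono s" using strict_mono_o[OF s1(1) l(1)] by (simp add: s_def[abs_def] o_def)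
  have cA: "c \<in> A" "c' \<in> A" using s1(2) A0(2) by (auto simp: c_def c'_def)
  have pc: "fst (p (s j)) = c" "snd (p (s j)) = c'" for j using s1(3)
    by (simp_all add: s_def c_def c'_def)
  have xl: "limitin mtopology (\<lambda>j. x (s j)) l sequentially" using l(2) by (simp add: s_def)
  have snull: "(\<lambda>j. inverse (real (Suc (s j)))) \<longlonglongrightarrow> 0"
    using LIMSEQ_subseq_LIMSEQ[OF LIMSEQ_inverse_real_of_nat s] by (simp add: o_def)
  have fl: "limitin mtopology (\<lambda>j. f (x (s j))) (f l) sequentially"
    using continuous_map_limit[OF cont_g xl] by (simp add: o_def)
  have x'l: "limitin mtopology (\<lambda>j. x' (s j)) (f l) sequentially"
  proof (rule limitin_same[OF fl])
    show "(\<lambda>j. d (f (x (s j))) (x' (s j))) \<longlonglongrightarrow> 0"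
    proof (rule null_seq_le[OF snull])
      show "\<bar>d (f (x (s j))) (x' (s j))\<bar> \<le> inverse (real (Suc (s j)))" for j using px(4)[of "s j"]
        by simp
    qed
  qed (use xM in auto)
  have lc: "l \<in> core r c" by (rule limitin_core[OF xl]) (use px(2)[of "s _"] pc in simp)
  have flc: "f l \<in> core r c'" by (rule limitin_core[OF x'l]) (use px(3)[of "s _"] pc in simp)
  have dom: "l \<in> fst c" "f l \<in> fst c'" using lc flc core_subset[OF r] by blast+
  let ?S = "snd c ` {y \<in> fst c. f y \<in> fst c'}"
  have S: "open ?S" "Ck_on 1 ?S (local_rep f c c')" "snd c l \<in> ?S"
    using open_transfer_domain[OF cA cont_g] C1_f[OF cA] dom unfolding local_rep_def by blast+
  obtain q where q: "0 < q" "ball (snd c l) q \<subseteq> ?S"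
    "\<And>u u' z. u \<in> ball (snd c l) q \<Longrightarrow> u' \<in> ball (snd c l) q \<Longrightarrow> z \<in> ball (snd c l) q \<Longrightarrow>
       norm (local_rep f c c' u - local_rep f c c' u' - frechet_derivative (local_rep f c c') (at z)
         (u - u')) \<le> e * norm (u - u')"
    using strictly_differentiable[OF S e] by blast
  \<comment> \<open>Half of \<open>q\<close> absorbs the displacement of the base point, the other
    half the radius of the ball around it.\<close>
  have "\<forall>\<^sub>F j in sequentially. dist (snd c (x (s j))) (snd c l) < q / 2"
    using tendstoD[OF tendsto_chart[OF cA(1) xl dom(1)], of "q / 2"] q(1) by simp
  moreover have "\<forall>\<^sub>F j in sequentially. inverse (real (Suc (s j))) < q / 2"
    using order_tendstoD(2)[OF snull, of "q / 2"] q(1) by simp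
  ultimately have "\<forall>\<^sub>F j in sequentially. dist (snd c (x (s j))) (snd c l) < q / 2 \<and>
      inverse (real (Suc (s j))) < q / 2"
    by eventually_elim blast
  then obtain j where j: "dist (snd c (x (s j))) (snd c l) < q / 2"
    "inverse (real (Suc (s j))) < q / 2"
    by (auto simp: eventually_sequentially)
  have sub: "ball (snd c (x (s j))) (inverse (real (Suc (s j)))) \<subseteq> ball (snd c l) q"
  proof
    fix u assume "u \<in> ball (snd c (x (s j))) (inverse (real (Suc (s j))))"
    then have "dist u (snd c (x (s j))) < q / 2" using j(2) by (simp add: dist_commute)
    then show "u \<in> ball (snd c l) q"
      using j(1) dist_triangle[of u "snd c l" "snd c (x (s j))"] by (simp add: dist_commute)
  qed
  have xin: "snd c (x (s j)) \<in> ball (snd c l) q" using j(1) q(1) by (simp add: dist_commute)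
  have "Q (inverse (real (Suc (s j)))) c c' (x (s j))"
    unfolding Q_def
  proof (intro conjI ballI)
    show "ball (snd c (x (s j))) (inverse (real (Suc (s j)))) \<subseteq> ?S" using sub q(2)
      by (rule order_trans)
    fix u u' assume "u \<in> ball (snd c (x (s j))) (inverse (real (Suc (s j))))"
      "u' \<in> ball (snd c (x (s j))) (inverse (real (Suc (s j))))"
    then show "norm (local_rep f c c' u - local_rep f c c' u' - local_deriv f c c' (x (s j)) (u -
        u')) \<le> e * norm (u - u')"
      unfolding local_deriv_def using sub xin by (intro q(3)) blast+
  qed
  then show False using px(5)[of "s j"] pc by simp
qed

lemma uniform_chart_inv:
  assumes A0: "finite A0" "A0 \<subseteq> A" and r: "0 < r" and e: "0 < e"
  shows "\<exists>\<rho>>0. \<forall>c\<in>A0. \<forall>x\<in>core r c. \<forall>u\<in>snd c ` fst c. dist u (snd c x) < \<rho> \<longrightarrow> d (chart_inv c u) x < e"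
proof (rule ccontr)
  assume no: "\<not> ?thesis"
  have "\<exists>c x u. c \<in> A0 \<and> x \<in> core r c \<and> u \<in> snd c ` fst c \<and> dist u (snd c x) < inverse (Suc j) \<and>
      e \<le> d (chart_inv c u) x" for j
  proof -
    have "0 < inverse (real (Suc j))" by simp
    with no show ?thesis by (meson not_le)
  qed
  then obtain c x u where px: "\<And>j. c j \<in> A0" "\<And>j. x j \<in> core r (c j)"
    "\<And>j. u j \<in> snd (c j) ` fst (c j)"
    "\<And>j. dist (u j) (snd (c j) (x j)) < inverse (Suc j)" "\<And>j. e \<le> d (chart_inv (c j) (u j)) (x j)"
      by metis
  have xM: "x j \<in> M" for j using px(2) by (auto simp: core_def)
  obtain s1 a where s1: "strict_mono (s1::nat\<Rightarrow>nat)" "a \<in> A0" "\<And>j. c (s1 j) = a"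
    using finite_range_constant_subseq[OF A0(1), of c] px(1) by blast
  obtain l s2 where l: "strict_mono (s2::nat\<Rightarrow>nat)"
    "limitin mtopology (\<lambda>j. x (s1 (s2 j))) l sequentially"
    using seq_compact[of "\<lambda>j. x (s1 j)"] xM by metis
  define s where "s j = s1 (s2 j)" for j
  have s: "strict_mono s" using strict_mono_o[OF s1(1) l(1)] by (simp add: s_def[abs_def] o_def)
  have aA: "a \<in> A" using s1(2) A0(2) by auto
  have pc: "c (s j) = a" for j using s1(3) by (simp add: s_def)
  have xl: "limitin mtopology (\<lambda>j. x (s j)) l sequentially" using l(2) by (simp add: s_def)
  have snull: "(\<lambda>j. inverse (real (Suc (s j)))) \<longlonglongrightarrow> 0"
    using LIMSEQ_subseq_LIMSEQ[OF LIMSEQ_inverse_real_of_nat s] by (simp add: o_def)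
  have "l \<in> core r a" by (rule limitin_core[OF xl]) (use px(2)[of "s _"] pc in simp)
  then have dom: "l \<in> fst a" using core_subset[OF r] by blast
  have chx: "(\<lambda>j. snd a (x (s j))) \<longlonglongrightarrow> snd a l" by (rule tendsto_chart[OF aA xl dom])
  have "(\<lambda>j. u (s j) - snd a (x (s j))) \<longlonglongrightarrow> 0"
  proof (rule Lim_null_comparison[OF always_eventually snull], rule allI)
    show "norm (u (s j) - snd a (x (s j))) \<le> inverse (real (Suc (s j)))" for j
      using px(4)[of "s j"] pc[of j] by (simp add: dist_norm)
  qed
  from tendsto_add[OF this chx] have "(\<lambda>j. u (s j)) \<longlonglongrightarrow> snd a l" by simp
  from limitin_chart_inv[OF aA this] dom aA
  have "limitin mtopology (\<lambda>j. chart_inv a (u (s j))) l sequentially" by simp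
  from limitin_dist[OF this xl] have "(\<lambda>j. d (chart_inv a (u (s j))) (x (s j))) \<longlonglongrightarrow> 0"
    using limitin_in[OF xl] by simp
  then have "e \<le> 0" by (rule LIMSEQ_le_const) (use px(5)[of "s _"] pc in auto)
  with e show False by simp
qed

lemma uniform_chart:
  assumes A0: "finite A0" "A0 \<subseteq> A" and r: "0 < r" and e: "0 < e"
  shows "\<exists>\<rho>>0. \<rho> \<le> r \<and> (\<forall>c\<in>A0. \<forall>x\<in>core r c. \<forall>y\<in>M. d x y < \<rho> \<longrightarrow> y \<in> fst c \<and>
      dist (snd c y) (snd c x) < e)"
proof (rule ccontr)
  assume no: "\<not> ?thesis"
  have "\<exists>c x y. c \<in> A0 \<and> x \<in> core r c \<and> y \<in> M \<and> d x y < min r (inverse (Suc j)) \<and>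
      e \<le> dist (snd c y) (snd c x)" for j
  proof -
    have *: "0 < min r (inverse (real (Suc j)))" "min r (inverse (real (Suc j))) \<le> r" using r
      by auto
    obtain c x y where "c \<in> A0" "x \<in> core r c" "y \<in> M" "d x y < min r (inverse (Suc j))"
      "\<not> (y \<in> fst c \<and> dist (snd c y) (snd c x) < e)"
      using no * by blast
    moreover from this have "y \<in> fst c" by (auto simp: core_def)
    ultimately show ?thesis by (meson not_le)
  qed
  then obtain c x y where px: "\<And>j. c j \<in> A0" "\<And>j. x j \<in> core r (c j)" "\<And>j. y j \<in> M"
    "\<And>j. d (x j) (y j) < min r (inverse (Suc j))" "\<And>j. e \<le> dist (snd (c j) (y j)) (snd (c j) (x j))"
      by metis
  have xM: "x j \<in> M" for j using px(2) by (auto simp: core_def)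
  obtain s1 a where s1: "strict_mono (s1::nat\<Rightarrow>nat)" "a \<in> A0" "\<And>j. c (s1 j) = a"
    using finite_range_constant_subseq[OF A0(1), of c] px(1) by blast
  obtain l s2 where l: "strict_mono (s2::nat\<Rightarrow>nat)"
    "limitin mtopology (\<lambda>j. x (s1 (s2 j))) l sequentially"
    using seq_compact[of "\<lambda>j. x (s1 j)"] xM by metis
  define s where "s j = s1 (s2 j)" for j
  have s: "strict_mono s" using strict_mono_o[OF s1(1) l(1)] by (simp add: s_def[abs_def] o_def)
  have aA: "a \<in> A" using s1(2) A0(2) by auto
  have pc: "c (s j) = a" for j using s1(3) by (simp add: s_def)
  have xl: "limitin mtopology (\<lambda>j. x (s j)) l sequentially" using l(2) by (simp add: s_def)
  have snull: "(\<lambda>j. inverse (real (Suc (s j)))) \<longlonglongrightarrow> 0"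
    using LIMSEQ_subseq_LIMSEQ[OF LIMSEQ_inverse_real_of_nat s] by (simp add: o_def)
  have "l \<in> core r a" by (rule limitin_core[OF xl]) (use px(2)[of "s _"] pc in simp)
  then have dom: "l \<in> fst a" using core_subset[OF r] by blast
  have yl: "limitin mtopology (\<lambda>j. y (s j)) l sequentially"
  proof (rule limitin_same[OF xl])
    show "(\<lambda>j. d (x (s j)) (y (s j))) \<longlonglongrightarrow> 0"
    proof (rule null_seq_le[OF snull])
      show "\<bar>d (x (s j)) (y (s j))\<bar> \<le> inverse (real (Suc (s j)))" for j using px(4)[of "s j"]
        by simp
    qed
  qed (use xM px(3) in auto)
  have "(\<lambda>j. dist (snd a (y (s j))) (snd a (x (s j)))) \<longlonglongrightarrow> dist (snd a l) (snd a l)"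
    by (intro tendsto_dist tendsto_chart[OF aA _ dom] xl yl)
  then have "e \<le> dist (snd a l) (snd a l)" by (rule LIMSEQ_le_const) (use px(5)[of
    "s _"] pc in auto)
  with e show False by simp
qed

end

section \<open>Hyperbolic sets\<close>

locale hyperbolic_system = manifold_diffeo M d f f' B A
  for M :: "'a set" and d f f' and B :: "'b::real_normed_vector set" and A :: "('a, 'b) chart set" +
  fixes \<Lambda> :: "'a set" and Es Eu :: "'a \<Rightarrow> ('a, 'b) tvec set"
    and G :: "'a \<Rightarrow> ('a, 'b) tvec \<Rightarrow> ('a, 'b) tvec \<Rightarrow> real" and C l :: real
  assumes \<Lambda>_closed: "closedin mtopology \<Lambda>" and \<Lambda>_invariant: "f ` \<Lambda> = \<Lambda>"
    and subspace_Es: "x \<in> \<Lambda> \<Longrightarrow> subspace (Es x)" and subspace_Eu: "x \<in> \<Lambda> \<Longrightarrow> subspace (Eu x)"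
    and split: "x \<in> \<Lambda> \<Longrightarrow> tangent_space A x = {v + w | v w. v \<in> Es x \<and> w \<in> Eu x}"
    and Es_invariant: "x \<in> \<Lambda> \<Longrightarrow> differential A f x ` Es x = Es (f x)"
    and Eu_invariant: "x \<in> \<Lambda> \<Longrightarrow> differential A f x ` Eu x = Eu (f x)"
    and riemannian: "riemannian_metric mtopology A G"
    and l: "0 < l" "l < 1"
    and contract_Es: "x \<in> \<Lambda> \<Longrightarrow> v \<in> Es x \<Longrightarrow>
      sqrt (G ((f ^^ n) x) (differential A (f ^^ n) x v) (differential A (f ^^ n) x v))
        \<le> C * l ^ n * sqrt (G x v v)"
    and contract_Eu: "x \<in> \<Lambda> \<Longrightarrow> v \<in> Eu x \<Longrightarrow>
      sqrt (G ((f' ^^ n) x) (differential A (f' ^^ n) x v) (differential A (f' ^^ n) x v))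
        \<le> C * l ^ n * sqrt (G x v v)"
begin

section \<open>Bounded orbits of the tangent map\<close>

lemma \<Lambda>_subset: "\<Lambda> \<subseteq> M"
  using closedin_subset[OF \<Lambda>_closed] by simp

lemma Es_tangent: "x \<in> \<Lambda> \<Longrightarrow> v \<in> Es x \<Longrightarrow> v \<in> tangent_space A x"
  using split subspace_0[OF subspace_Eu] by force

lemma Eu_tangent: "x \<in> \<Lambda> \<Longrightarrow> v \<in> Eu x \<Longrightarrow> v \<in> tangent_space A x"
  using split subspace_0[OF subspace_Es] by force

lemma G_comb: "p \<in> M \<Longrightarrow> u \<in> tangent_space A p \<Longrightarrow> v \<in> tangent_space A p \<Longrightarrow> w \<in> tangent_space A p \<Longrightarrow>
    G p (a *\<^sub>R u + b *\<^sub>R v) w = a * G p u w + b * G p v w"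
  and G_sym: "p \<in> M \<Longrightarrow> u \<in> tangent_space A p \<Longrightarrow> v \<in> tangent_space A p \<Longrightarrow> G p u v = G p v u"
  and G_pos: "p \<in> M \<Longrightarrow> u \<in> tangent_space A p \<Longrightarrow> u \<noteq> 0 \<Longrightarrow> 0 < G p u u"
  using riemannian unfolding riemannian_metric_def topspace_mtopology by blast+

lemma G_add: "p \<in> M \<Longrightarrow> u \<in> tangent_space A p \<Longrightarrow> v \<in> tangent_space A p \<Longrightarrow> w \<in> tangent_space A p \<Longrightarrow>
    G p (u + v) w = G p u w + G p v w"
  using G_comb[of p u v w 1 1] by simp

lemma G_scale: "p \<in> M \<Longrightarrow> u \<in> tangent_space A p \<Longrightarrow> w \<in> tangent_space A p \<Longrightarrow>
    G p (a *\<^sub>R u) w = a * G p u w"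
  using G_comb[of p u 0 w a 0] subspace_0[OF subspace_tangent_space] by simp

lemma G_scale2: "p \<in> M \<Longrightarrow> u \<in> tangent_space A p \<Longrightarrow> G p (a *\<^sub>R u) (a *\<^sub>R u) = a\<^sup>2 * G p u u"
  using G_scale[of p u "a *\<^sub>R u" a] G_sym[of p u
    "a *\<^sub>R u"] G_scale[of p u u a] subspace_scale[OF subspace_tangent_space]
  by (simp add: power2_eq_square)

lemma G_nonneg: "p \<in> M \<Longrightarrow> u \<in> tangent_space A p \<Longrightarrow> 0 \<le> G p u u"
  using G_pos[of p u] G_scale[of p u u 0] by (cases "u = 0") auto

text \<open>Nonnegativity of \<open>G p (u - v) (u - v)\<close> in the parallelogram law. The
  quadratic form with a factor 2 takes the place of a triangle inequality. Bilinearity holds on the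
  tangent space only, so each expansion carries membership facts.\<close>

lemma G_add2:
  assumes p: "p \<in> M" and u: "u \<in> tangent_space A p" and v: "v \<in> tangent_space A p"
  shows "G p (u + v) (u + v) \<le> 2 * G p u u + 2 * G p v v"
proof -
  have T: "u + v \<in> tangent_space A p" "- v \<in> tangent_space A p" "u - v \<in> tangent_space A p"
    using subspace_add[OF subspace_tangent_space] subspace_neg[OF subspace_tangent_space]
      subspace_diff[OF subspace_tangent_space] u v by blast+
  have neg: "G p (- v) w = - G p v w" if "w \<in> tangent_space A p" for w
    using G_scale[OF p v that, of "- 1"] by simp
  have T2: "u + - v \<in> tangent_space A p" using T(3) by simp
  have sym: "G p v u = G p u v" by (rule G_sym[OF p v u])
  have "G p u (u + - v) = G p u u - G p v u"
    by (subst G_sym[OF p u T2], subst G_add[OF p u T(2) u], subst neg[OF u]) simp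
  moreover have "G p v (u + - v) = G p u v - G p v v"
    by (subst G_sym[OF p v T2], subst G_add[OF p u T(2) v], subst neg[OF v]) simp
  moreover have "G p (u + - v) (u + - v) = G p u (u + - v) - G p v (u + - v)"
    by (subst G_add[OF p u T(2) T2], subst neg[OF T2]) simp
  moreover have "0 \<le> G p (u + - v) (u + - v)" by (rule G_nonneg[OF p T2])
  moreover have "G p u (u + v) = G p u u + G p v u"
    by (subst G_sym[OF p u T(1)], subst G_add[OF p u v u]) simp
  moreover have "G p v (u + v) = G p u v + G p v v"
    by (subst G_sym[OF p v T(1)], subst G_add[OF p u v v]) simp
  moreover have "G p (u + v) (u + v) = G p u (u + v) + G p v (u + v)"
    by (rule G_add[OF p u v T(1)])
  ultimately show ?thesis using sym by linarith
qed

lemma sq_le_of_sqrt_le: "0 \<le> a \<Longrightarrow> 0 \<le> b \<Longrightarrow> sqrt a \<le> K * sqrt b \<Longrightarrow> a \<le> K\<^sup>2 * b"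
  using power_mono[of "sqrt a" "K * sqrt b" 2] by (simp add: power_mult_distrib)

definition tangent_orbit :: "(int \<Rightarrow> 'a) \<Rightarrow> (int \<Rightarrow> ('a, 'b) tvec) \<Rightarrow> bool" where
  "tangent_orbit y w \<longleftrightarrow> (\<forall>k. y k \<in> \<Lambda> \<and> f (y k) = y (k + 1) \<and> w k \<in> tangent_space A (y k) \<and>
      differential A f (y k) (w k) = w (k + 1))"

lemma orbit_funpow: "(\<And>k. f (y k) = y (k + 1)) \<Longrightarrow> (f ^^ n) (y k) = y (k + int n)"
  by (induction n) (auto simp: algebra_simps)

lemma differential_funpow_Suc:
  assumes "x \<in> M" "v \<in> tangent_space A x"
  shows "differential A (f ^^ Suc n) x v = differential A f ((f ^^ n) x) (differential A (f ^^ n) x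
      v)"
  by (rule differential_comp[OF smooth_funpow[OF smooth_f] smooth_f smooth_funpow[OF smooth_f]
    _ assms(2,1)]) simp

lemma differential_0: "x \<in> M \<Longrightarrow> v \<in> tangent_space A x \<Longrightarrow> differential A (f ^^ 0) x v = v"
  by (rule differential_ident[OF smooth_funpow[OF smooth_f]]) auto

lemma funpow_in_\<Lambda>: "x \<in> \<Lambda> \<Longrightarrow> (f ^^ n) x \<in> \<Lambda>"
  using \<Lambda>_invariant by (induction n) auto

lemma differential_funpow_Es: "x \<in> \<Lambda> \<Longrightarrow> v \<in> Es x \<Longrightarrow> differential A (f ^^ n) x v \<in> Es ((f ^^ n) x)"
proof (induction n)
  case (Suc n)
  then have M: "x \<in> M" "v \<in> tangent_space A x" using \<Lambda>_subset Es_tangent by auto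
  have "differential A f ((f ^^ n) x) (differential A (f ^^ n) x v) \<in> Es (f ((f ^^ n) x))"
    using Suc Es_invariant[OF funpow_in_\<Lambda>[OF Suc.prems(1)]] by blast
  then show ?case unfolding differential_funpow_Suc[OF M] by simp
qed (use differential_0 Es_tangent \<Lambda>_subset in auto)

lemma differential_funpow_Eu: "x \<in> \<Lambda> \<Longrightarrow> v \<in> Eu x \<Longrightarrow> differential A (f ^^ n) x v \<in> Eu ((f ^^ n) x)"
proof (induction n)
  case (Suc n)
  then have M: "x \<in> M" "v \<in> tangent_space A x" using \<Lambda>_subset Eu_tangent by auto
  have "differential A f ((f ^^ n) x) (differential A (f ^^ n) x v) \<in> Eu (f ((f ^^ n) x))"
    using Suc Eu_invariant[OF funpow_in_\<Lambda>[OF Suc.prems(1)]] by blast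
  then show ?case unfolding differential_funpow_Suc[OF M] by simp
qed (use differential_0 Eu_tangent \<Lambda>_subset in auto)

lemma funpow_f'_f: "x \<in> M \<Longrightarrow> (f' ^^ n) ((f ^^ n) x) = x"
proof (induction n arbitrary: x)
  case (Suc n)
  have "(f ^^ n) x \<in> M" using Suc.prems smooth_in[OF smooth_funpow[OF smooth_f]] by blast
  have "(f' ^^ Suc n) ((f ^^ Suc n) x) = (f' ^^ n) (f' (f ((f ^^ n) x)))"
    by (simp add: funpow_swap1)
  also have "\<dots> = x" using Suc \<open>(f ^^ n) x \<in> M\<close> by simp
  finally show ?case .
qed simp

lemma differential_funpow_f'_f:
  assumes "x \<in> M" "v \<in> tangent_space A x"
  shows "differential A (f' ^^ n) ((f ^^ n) x) (differential A (f ^^ n) x v) = v"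
proof -
  note s = smooth_funpow[OF smooth_f, of n] smooth_funpow[OF smooth_f', of n]
  have "v = differential A (\<lambda>x. (f' ^^ n) ((f ^^ n) x)) x v"
    using differential_ident[OF smooth_comp[OF s] _ assms(2,1)] funpow_f'_f by simp
  also have "\<dots> = differential A (f' ^^ n) ((f ^^ n) x) (differential A (f ^^ n) x v)"
    by (rule differential_comp[OF s smooth_comp[OF s] refl assms(2,1)])
  finally show ?thesis by simp
qed

lemma tangent_orbit_funpow:
  assumes "tangent_orbit y w"
  shows "(f ^^ n) (y k) = y (k + int n)" "differential A (f ^^ n) (y k) (w k) = w (k + int n)"
proof -
  have o: "y k \<in> \<Lambda>" "f (y k) = y (k + 1)" "w k \<in> tangent_space A (y k)"
    "differential A f (y k) (w k) = w (k + 1)" for k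
    using assms by (auto simp: tangent_orbit_def)
  show 1: "(f ^^ n) (y k) = y (k + int n)" for n using orbit_funpow o(2) by blast
  have M: "y k \<in> M" using o(1) \<Lambda>_subset by blast
  show "differential A (f ^^ n) (y k) (w k) = w (k + int n)"
  proof (induction n)
    case 0 show ?case using differential_0[OF M o(3)] by (simp only: of_nat_0 add_0_right)
  next
    case (Suc n)
    then show ?case unfolding differential_funpow_Suc[OF M o(3)] 1 Suc.IH o(4)
      by (simp add: ac_simps)
  qed
qed

lemma null_power_bound:
  assumes "\<And>n. a \<le> (C * l ^ n)\<^sup>2 * K"
  shows "a \<le> (0::real)"
proof (rule LIMSEQ_le_const)
  have "(\<lambda>n. l ^ n) \<longlonglongrightarrow> 0" by (rule LIMSEQ_power_zero) (use l in simp)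
  then have "(\<lambda>n. (C * l ^ n)\<^sup>2 * K) \<longlonglongrightarrow> (C * 0)\<^sup>2 * K"
    by (intro tendsto_mult tendsto_power tendsto_const)
  then show "(\<lambda>n. (C * l ^ n)\<^sup>2 * K) \<longlonglongrightarrow> 0" by simp
qed (use assms in blast)

text \<open>The unstable part \<open>b\<close> of \<open>w k\<close> has bounded forward images,
  being the difference of the bounded orbit and the contracted stable part. Pulling them back over
  \<open>n\<close> steps shrinks them by \<open>C * l ^ n\<close>, so \<open>b = 0\<close>.\<close>

lemma bounded_tangent_orbit_Es:
  assumes o: "tangent_orbit y w" and bound: "\<And>k. G (y k) (w k) (w k) \<le> K"
  shows "w k \<in> Es (y k)"
proof -
  have y: "y k \<in> \<Lambda>" for k using o by (auto simp: tangent_orbit_def)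
  have M: "y k \<in> M" for k using y \<Lambda>_subset by blast
  have wT: "w k \<in> tangent_space A (y k)" for k using o by (auto simp: tangent_orbit_def)
  obtain a b where ab: "a \<in> Es (y k)" "b \<in> Eu (y k)" "w k = a + b" using split[OF y] wT by blast
  have T: "a \<in> tangent_space A (y k)" "b \<in> tangent_space A (y k)"
    using ab Es_tangent[OF y] Eu_tangent[OF y] by auto
  \<comment> \<open>The bound that \<open>G_add2\<close> yields for the forward images
    \<open>b' = w (k + n) - a'\<close>.\<close>
  define K1 where "K1 = 2 * K + 2 * (C\<^sup>2 * G (y k) a a)"
  have "G (y k) b b \<le> (C * l ^ n)\<^sup>2 * K1" for n
  proof -
    let ?p = "y (k + int n)"
    have p: "(f ^^ n) (y k) = ?p" by (rule tangent_orbit_funpow[OF o])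
    define a' b' where "a' = differential A (f ^^ n) (y k) a" and
      "b' = differential A (f ^^ n) (y k) b"
    have a': "a' \<in> Es ?p" and b': "b' \<in> Eu ?p"
      using differential_funpow_Es[OF y ab(1), of n] differential_funpow_Eu[OF y ab(2), of n] p
        by (auto simp: a'_def b'_def)
    then have T': "a' \<in> tangent_space A ?p" "b' \<in> tangent_space A ?p"
      using Es_tangent[OF y] Eu_tangent[OF y] by auto
    have "w (k + int n) = a' + b'"
      using tangent_orbit_funpow(2)[OF o, of n k] differential_linear[OF smooth_funpow[OF smooth_f]
        T M] ab(3) by (simp add: a'_def b'_def)
    then have b'_eq: "b' = w (k + int n) + (- 1) *\<^sub>R a'" by simp
    have "G ?p a' a' \<le> (C * l ^ n)\<^sup>2 * G (y k) a a"
      using contract_Es[OF y ab(1), of n] p G_nonneg[OF M T'(1)] G_nonneg[OF M T(1)]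
        by (intro sq_le_of_sqrt_le) (auto simp: a'_def)
    also have "\<dots> \<le> C\<^sup>2 * G (y k) a a"
    proof (rule mult_right_mono)
      have "(l ^ n)\<^sup>2 \<le> 1" using l by (intro power_le_one) (auto simp: power_le_one)
      then show "(C * l ^ n)\<^sup>2 \<le> C\<^sup>2" by (simp add: power_mult_distrib mult_left_le)
    qed (rule G_nonneg[OF M T(1)])
    finally have "G ?p a' a' \<le> C\<^sup>2 * G (y k) a a" .
    moreover have "G ?p b' b' \<le> 2 * G ?p (w (k + int n)) (w (k + int n)) + 2 * G ?p a' a'"
      using G_add2[OF M wT subspace_scale[OF subspace_tangent_space T'(1), of
        "- 1"]] G_scale2[OF M T'(1), of "- 1"] unfolding b'_eq by simp
    ultimately have K1: "G ?p b' b' \<le> K1" using bound[of "k + int n"] by (simp add: K1_def)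
    have ret: "(f' ^^ n) ?p = y k" "differential A (f' ^^ n) ?p b' = b"
      using funpow_f'_f[OF M, of n k] differential_funpow_f'_f[OF M T(2), of n] p
        by (simp_all add: b'_def)
    have "G (y k) b b \<le> (C * l ^ n)\<^sup>2 * G ?p b' b'"
      using contract_Eu[OF y b', of n] ret G_nonneg[OF M T(2)] G_nonneg[OF M T'(2)]
        by (intro sq_le_of_sqrt_le) auto
    also have "\<dots> \<le> (C * l ^ n)\<^sup>2 * K1" using K1 by (intro mult_left_mono) auto
    finally show ?thesis .
  qed
  then have "G (y k) b b \<le> 0" by (rule null_power_bound)
  then have "b = 0" using G_pos[OF M T(2)] by fastforce
  then show ?thesis using ab by simp
qed

text \<open>Each \<open>w k\<close> is the \<open>n\<close>-th forward image of the bounded stable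
  vector \<open>w (k - n)\<close>, hence arbitrarily small.\<close>

lemma bounded_tangent_orbit_zero:
  assumes o: "tangent_orbit y w" and bound: "\<And>k. G (y k) (w k) (w k) \<le> K"
  shows "w k = 0"
proof -
  have y: "y k \<in> \<Lambda>" for k using o by (auto simp: tangent_orbit_def)
  have M: "y k \<in> M" for k using y \<Lambda>_subset by blast
  have T: "w k \<in> tangent_space A (y k)" for k using o by (auto simp: tangent_orbit_def)
  have "G (y k) (w k) (w k) \<le> (C * l ^ n)\<^sup>2 * K" for n
  proof -
    let ?i = "k - int n"
    have p: "(f ^^ n) (y ?i) = y k" "differential A (f ^^ n) (y ?i) (w ?i) = w k"
      using tangent_orbit_funpow[OF o, of n ?i] by simp_all
    have "G (y k) (w k) (w k) \<le> (C * l ^ n)\<^sup>2 * G (y ?i) (w ?i) (w ?i)"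
      using contract_Es[OF y bounded_tangent_orbit_Es[OF o bound, of ?i], of n] unfolding p
      by (intro sq_le_of_sqrt_le G_nonneg M T)
    also have "\<dots> \<le> (C * l ^ n)\<^sup>2 * K" using bound by (intro mult_left_mono) auto
    finally show ?thesis .
  qed
  then have "G (y k) (w k) (w k) \<le> 0" by (rule null_power_bound)
  then show ?thesis using G_pos[OF M T] by fastforce
qed


text \<open>Continuity of \<open>G\<close> along coordinate frames bounds each frame vector on the
  compact set \<open>K\<close>; \<open>G_add2\<close> then adds them up by induction on the
  basis.\<close>

lemma G_lift_bounded:
  assumes c: "c \<in> A" and K: "compactin mtopology K" "K \<subseteq> fst c"
  shows "\<exists>K0. \<forall>p\<in>K. \<forall>u. norm u \<le> 1 \<longrightarrow> G p (tangent_lift p c u) (tangent_lift p c u) \<le> K0"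
proof -
  let ?e = "\<lambda>b p. tangent_lift p c b"
  have KM: "p \<in> M" and T: "?e b p \<in> tangent_space A p" if "p \<in> K" for p b
    using that K dom_subset[OF c] tangent_lift(1)[OF c] by auto
  have bas: "\<exists>K0. \<forall>p\<in>K. G p (?e b p) (?e b p) \<le> K0" for b
  proof -
    have "continuous_map (subtopology mtopology (fst c)) euclideanreal (\<lambda>p. G p (?e b p) (?e b p))"
      by (rule riemannian[unfolded riemannian_metric_def, THEN conjunct2, rule_format])
         (intro conjI dom_open[OF c] continuous_section_lift[OF c])
    moreover have "compactin (subtopology mtopology (fst c)) K" using K
      by (simp add: compactin_subtopology)
    ultimately have "compact ((\<lambda>p. G p (?e b p) (?e b p)) ` K)"
      using image_compactin compactin_euclidean_iff by blast
    then have "bdd_above ((\<lambda>p. G p (?e b p) (?e b p)) ` K)"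
      by (intro bounded_imp_bdd_above compact_imp_bounded)
    then show ?thesis by (auto simp: bdd_above_def)
  qed
  obtain K1 where K1: "K1 > 0" "\<And>v b. \<bar>coord v b\<bar> \<le> K1 * norm v" using coord_bounded by blast
  have sumT: "(\<Sum>b\<in>S. a b *\<^sub>R ?e b p) \<in> tangent_space A p" if "p \<in> K" for S p a
    by (intro subspace_sum[OF subspace_tangent_space] subspace_scale[OF subspace_tangent_space]
      T that)
  have "\<exists>K0. \<forall>p\<in>K. \<forall>a. (\<forall>b. \<bar>a b\<bar> \<le> K1) \<longrightarrow> G p (\<Sum>b\<in>S. a b *\<^sub>R ?e b p) (\<Sum>b\<in>S. a b *\<^sub>R ?e b p) \<le> K0"
    if "finite S" for S
    using that
  proof induction
    case empty
    have "G p 0 0 = 0" if "p \<in> K" for p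
      using G_scale[OF KM[OF that], of 0 0 0] subspace_0[OF subspace_tangent_space] by simp
    then have "G p 0 0 \<le> 0" if "p \<in> K" for p using eq_refl that by blast
    then show ?case unfolding sum.empty by (intro exI[of _ 0] ballI allI impI)
  next
    case (insert b0 S)
    then obtain K2 where K2: "\<And>p a. p \<in> K \<Longrightarrow> (\<And>b. \<bar>a b\<bar> \<le> K1) \<Longrightarrow>
        G p (\<Sum>b\<in>S. a b *\<^sub>R ?e b p) (\<Sum>b\<in>S. a b *\<^sub>R ?e b p) \<le> K2"
      by blast
    obtain K3 where K3: "\<And>p. p \<in> K \<Longrightarrow> G p (?e b0 p) (?e b0 p) \<le> K3" using bas[of b0] by blast
    have "G p (\<Sum>b\<in>insert b0 S. a b *\<^sub>R ?e b p) (\<Sum>b\<in>insert b0 S. a b *\<^sub>R ?e b p) \<le>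
        2 * (K1\<^sup>2 * \<bar>K3\<bar>) + 2 * K2"
      if p: "p \<in> K" and a: "\<And>b. \<bar>a b\<bar> \<le> K1" for p a
    proof -
      have "G p (\<Sum>b\<in>insert b0 S. a b *\<^sub>R ?e b p) (\<Sum>b\<in>insert b0 S. a b *\<^sub>R ?e b p)
          \<le> 2 * ((a b0)\<^sup>2 * G p (?e b0 p) (?e b0 p)) + 2 * G p (\<Sum>b\<in>S. a b *\<^sub>R ?e b p) (\<Sum>b\<in>S. a b *\<^sub>R
            ?e b p)"
        using G_add2[OF KM[OF p] subspace_scale[OF subspace_tangent_space T[OF p]] sumT[OF p], of
          "a b0" b0 a S]
          insert(1,2) G_scale2[OF KM[OF p] T[OF p]] by simp
      moreover have "(a b0)\<^sup>2 * G p (?e b0 p) (?e b0 p) \<le> K1\<^sup>2 * \<bar>K3\<bar>"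
      proof (rule mult_mono)
        show "(a b0)\<^sup>2 \<le> K1\<^sup>2" using a[of b0] by (metis abs_ge_zero power2_abs power_mono)
        show "G p (?e b0 p) (?e b0 p) \<le> \<bar>K3\<bar>" using K3[OF p] by simp
        show "0 \<le> G p (?e b0 p) (?e b0 p)" by (rule G_nonneg[OF KM[OF p] T[OF p]])
      qed simp
      moreover have "G p (\<Sum>b\<in>S. a b *\<^sub>R ?e b p) (\<Sum>b\<in>S. a b *\<^sub>R ?e b p) \<le> K2" by (rule K2[OF p a])
      ultimately show ?thesis by linarith
    qed
    then show ?case by blast
  qed
  from this[OF fin] obtain K0 where K0: "\<And>p a. p \<in> K \<Longrightarrow> (\<And>b. \<bar>a b\<bar> \<le> K1) \<Longrightarrow>
      G p (\<Sum>b\<in>B. a b *\<^sub>R ?e b p) (\<Sum>b\<in>B. a b *\<^sub>R ?e b p) \<le> K0"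
    by blast
  have "G p (tangent_lift p c u) (tangent_lift p c u) \<le> K0" if p: "p \<in> K" and u: "norm u \<le> 1"
    for p u
  proof -
    have "K1 * norm u \<le> K1" using K1(1) u by simp
    then have "\<bar>coord u b\<bar> \<le> K1" for b using K1(2)[of u b] by linarith
    then show ?thesis using K0[OF p, of "coord u"] tangent_lift_sum[OF c, of p u] p K(2) by auto
  qed
  then show ?thesis by blast
qed

text \<open>The charts vary along the orbit. Lifting the coordinate vectors gives an orbit of the
  differential, bounded uniformly because finitely many compact cores are involved.\<close>

lemma bounded_coordinate_orbit_zero:
  fixes y :: "int \<Rightarrow> 'a"
  assumes A0: "finite A0" "A0 \<subseteq> A" and r: "0 < r"
    and y: "\<And>k. y k \<in> \<Lambda>" "\<And>k. f (y k) = y (k + 1)" and c: "\<And>k. c k \<in> A0" "\<And>k. y k \<in> core r (c k)"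
    and w: "\<And>k. norm (w k) \<le> 1" "\<And>k. w (k + 1) = local_deriv f (c k) (c (k + 1)) (y k) (w k)"
  shows "w k = 0"
proof -
  have cA: "c k \<in> A" and yc: "y k \<in> fst (c k)" and M: "y k \<in> M" for k
    using c A0 core_subset[OF r] \<Lambda>_subset y(1) by blast+
  define W where "W k = tangent_lift (y k) (c k) (w k)" for k
  have WT: "W k \<in> tangent_space A (y k)" and Wc: "W k (c k) = w k" for k
    using tangent_lift[OF cA yc] by (auto simp: W_def)
  have "tangent_orbit y W"
    unfolding tangent_orbit_def
  proof (intro allI conjI)
    fix k
    show "differential A f (y k) (W k) = W (k + 1)"
    proof (rule tangent_eqI[OF _ WT cA yc])
      show "differential A f (y k) (W k) \<in> tangent_space A (y (k + 1))"
        using differential_in[OF smooth_f WT M, of k] y(2) by simp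
      show "differential A f (y k) (W k) (c (k + 1)) = W (k + 1) (c (k + 1))"
        using differential_coord[OF smooth_f WT cA cA yc, of k "k + 1"] yc[of "k + 1"] y(2)
          by (simp add: Wc w(2))
    qed
  qed (rule y WT)+
  moreover have "\<forall>c\<in>A0. \<exists>K. \<forall>p\<in>core r c. \<forall>u. norm u \<le> 1 \<longrightarrow>
      G p (tangent_lift p c u) (tangent_lift p c u) \<le> K"
    using G_lift_bounded[OF _ compactin_core core_subset[OF r]] A0(2) by blast
  then obtain K where K: "\<And>c p u. c \<in> A0 \<Longrightarrow> p \<in> core r c \<Longrightarrow> norm u \<le> 1 \<Longrightarrow>
      G p (tangent_lift p c u) (tangent_lift p c u) \<le> K c"
    by metis
  have "G (y k) (W k) (W k) \<le> Max (K ` A0)" for k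
    using K[OF c w(1), of k] A0(1) c(1)[of k] unfolding W_def
      by (meson Max_ge finite_imageI imageI order_trans)
  ultimately have "W k = 0" by (rule bounded_tangent_orbit_zero)
  then show ?thesis using Wc[of k] by simp
qed

text \<open>Counterexamples for \<kappa> tending to 0 are shifted so that the failure sits at index
  0 and scaled so that \<open>b\<close> becomes 1. A diagonal limit is a true orbit in \<Lambda>
  carrying a bounded tangent orbit of norm at least 1/2 at index 0, which hyperbolicity excludes.
  The a priori bound by \<open>b\<close> is what makes the limit exist.\<close>

lemma linear_bound_on_pseudo_orbits:
  assumes A0: "finite A0" "A0 \<subseteq> A" and r: "0 < r"
  shows "\<exists>\<kappa>>0. \<kappa> \<le> r \<and> (\<forall>x c v b k. (\<forall>k. x k \<in> \<Lambda> \<and> c k \<in> A0 \<and> x k \<in> core r (c k) \<and>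
      d (f (x k)) (x (k + 1)) < \<kappa> \<and> norm (v k) \<le> b \<and>
      norm (v (k + 1) - local_deriv f (c k) (c (k + 1)) (x k) (v k)) \<le> \<kappa> * b) \<longrightarrow> norm (v (k::int))
        \<le> b / 2)"
proof (rule ccontr)
  define Q where "Q \<kappa> x c v b \<longleftrightarrow> (\<forall>k. x k \<in> \<Lambda> \<and> c k \<in> A0 \<and> x k \<in> core r (c k) \<and>
      d (f (x k)) (x (k + 1)) < \<kappa> \<and> norm (v k) \<le> b \<and>
      norm (v (k + 1) - local_deriv f (c k) (c (k + 1)) (x k) (v k)) \<le> \<kappa> * b)"
    for \<kappa> b and x :: "int \<Rightarrow> 'a" and c v
  assume "\<not> ?thesis"
  then have no: "\<not> (\<exists>\<kappa>>0. \<kappa> \<le> r \<and> (\<forall>x c v b k. Q \<kappa> x c v b \<longrightarrow> norm (v k) \<le> b / 2))"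
    unfolding Q_def .
  \<comment> \<open>The minimum with \<open>r\<close> keeps \<open>f (X j i)\<close> in the domain
    of the chart used at the next index.\<close>
  define \<kappa> where "\<kappa> j = min r (inverse (Suc j))" for j
  have \<kappa>: "0 < \<kappa> j" "\<kappa> j \<le> r" "\<kappa> j \<le> inverse (Suc j)" for j using r by (auto simp: \<kappa>_def)
  have "\<exists>x c v b k. Q (\<kappa> j) x c v b \<and> b / 2 < norm (v k)" for j
    using no \<kappa>(1,2)[of j] by (meson not_le)
  then obtain x c v b k where Q: "\<And>j. Q (\<kappa> j) (x j) (c j) (v j) (b j)"
    "\<And>j. b j / 2 < norm (v j (k j))"
    by metis
  have b: "0 < b j" for j
  proof -
    have "norm (v j (k j)) \<le> b j" using Q(1)[of j] by (simp add: Q_def)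
    with Q(2)[of j] show ?thesis by linarith
  qed
  define X where "X j i = x j (i + k j)" for j i
  define D where "D j i = c j (i + k j)" for j i
  define V where "V j i = (1 / b j) *\<^sub>R v j (i + k j)" for j i
  have X: "X j i \<in> \<Lambda>" "D j i \<in> A0" "X j i \<in> core r (D j i)" "d (f (X j i)) (X j (i + 1)) < \<kappa> j"
    for i j
    using Q(1)[of j] by (auto simp: Q_def X_def D_def algebra_simps)
  have XM: "X j i \<in> M" for i j using X(1) \<Lambda>_subset by blast
  have DA: "D j i \<in> A" and Xdom: "X j i \<in> fst (D j i)" for i j using X A0 core_subset[OF r]
    by blast+
  have fX: "f (X j i) \<in> fst (D j (i + 1))" for i j
  proof -
    have "d (X j (i + 1)) (f (X j i)) < r" using X(4)[of j i] \<kappa>(2)[of j] by (simp add: commute)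
    then show ?thesis using X(3)[of j "i + 1"] XM by (auto simp: core_def)
  qed
  have lin: "linear (local_deriv f (D j i) (D j (i + 1)) (X j i))" for i j
    by (rule local_deriv_linear[OF smooth_f DA DA Xdom fX])
  have V: "norm (V j i) \<le> 1" for i j using Q(1)[of j] b[of j] by (auto simp: Q_def V_def)
  have V0: "1 / 2 < norm (V j 0)" for j using Q(2)[of j] b[of j] by (simp add: V_def field_simps)
  have Verr: "norm (V j (i + 1) - local_deriv f (D j i) (D j (i + 1)) (X j i) (V j i)) \<le>
      inverse (Suc j)" for i j
  proof -
    have e: "norm (v j (i + k j + 1) - local_deriv f (D j i) (D j (i + 1)) (X j i) (v j (i + k j)))
        \<le> \<kappa> j * b j"
      using Q(1)[of j] by (auto simp: Q_def X_def D_def algebra_simps)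
    have i: "i + 1 + k j = i + k j + 1" by simp
    have eq: "V j (i + 1) - local_deriv f (D j i) (D j (i + 1)) (X j i) (V j i) =
      (1 / b j) *\<^sub>R (v j (i + k j + 1) - local_deriv f (D j i) (D j (i + 1)) (X j i) (v j (i + k
        j)))"
      unfolding V_def i linear_scale[OF lin] scaleR_diff_right ..
    have "norm (V j (i + 1) - local_deriv f (D j i) (D j (i + 1)) (X j i) (V j i)) \<le> \<kappa> j"
      unfolding eq norm_scaleR using mult_left_mono[OF e, of "1 / b j"] b[of j] by simp
    then show ?thesis using \<kappa>(3)[of j] by linarith
  qed
  define P where "P i s \<longleftrightarrow> (\<exists>y C w. limitin mtopology (\<lambda>j. X (s j) i) y sequentially \<and>
      (\<forall>\<^sub>F j in sequentially. D (s j) i = C) \<and> (\<lambda>j. V (s j) i) \<longlonglongrightarrow> w)" for i and s :: "nat \<Rightarrow> nat"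
  obtain q where q: "strict_mono q" "\<And>i. P i q"
  proof (rule diagonal_subsequence[of P])
    fix i and s :: "nat \<Rightarrow> nat"
    obtain y s1 where 1: "strict_mono (s1::nat\<Rightarrow>nat)"
      "limitin mtopology (\<lambda>j. X (s (s1 j)) i) y sequentially"
      using seq_compact[of "\<lambda>j. X (s j) i"] XM by metis
    obtain s2 C where 2: "strict_mono (s2::nat\<Rightarrow>nat)" "\<And>j. D (s (s1 (s2 j))) i = C"
      using finite_range_constant_subseq[OF A0(1), of "\<lambda>j. D (s (s1 j)) i"] X(2) by metis
    obtain w s3 where 3: "strict_mono (s3::nat\<Rightarrow>nat)" "(\<lambda>j. V (s (s1 (s2 (s3 j)))) i) \<longlonglongrightarrow> w"
      using bounded_seq_convergent[of "\<lambda>j. V (s (s1 (s2 j))) i" 1] V by metis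
    have "strict_mono (s2 \<circ> s3)" using 2(1) 3(1) by (rule strict_mono_o)
    from limitin_subseq[OF 1(2) this] have "limitin mtopology (\<lambda>j.
        X (s (s1 (s2 (s3 j)))) i) y sequentially" by simp
    then have "P i (s \<circ> (s1 \<circ> s2 \<circ> s3))" using 2(2) 3(2) unfolding P_def by auto
    moreover have "strict_mono (s1 \<circ> s2 \<circ> s3)" using 1(1) 2(1) 3(1) by (intro strict_mono_o)
    ultimately show "\<exists>t. strict_mono (t::nat\<Rightarrow>nat) \<and> P i (s \<circ> t)" by blast
  next
    fix i and s t :: "nat \<Rightarrow> nat" assume t: "strict_mono t" and "P i s"
    then obtain y C w where *: "limitin mtopology (\<lambda>j. X (s j) i) y sequentially"
      "\<forall>\<^sub>F j in sequentially. D (s j) i = C" "(\<lambda>j. V (s j) i) \<longlonglongrightarrow> w" by (auto simp: P_def)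
    have "(\<lambda>j. V (s (t j)) i) \<longlonglongrightarrow> w" using LIMSEQ_subseq_LIMSEQ[OF *(3) t] by (simp add: o_def)
    then show "P i (s \<circ> t)"
      using limitin_subseq[OF *(1) t] eventually_subseq[OF t *(2)] unfolding P_def o_def by blast
  next
    fix i and s :: "nat \<Rightarrow> nat" and n assume "P i (s \<circ> (+) n)"
    then obtain y C w where *: "limitin mtopology (\<lambda>j. X (s (j + n)) i) y sequentially"
      "\<forall>\<^sub>F j in sequentially. D (s (j + n)) i = C" "(\<lambda>j. V (s (j + n)) i) \<longlonglongrightarrow> w"
        by (auto simp: P_def add.commute)
    have "\<forall>\<^sub>F j in sequentially. D (s j) i = C" using *(2) eventually_sequentially_seg[of
      "\<lambda>j. D (s j) i = C" n] by simp
    moreover have "(\<lambda>j. V (s j) i) \<longlonglongrightarrow> w" using *(3) LIMSEQ_offset by fastforce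
    moreover have "limitin mtopology (\<lambda>j. X (s j) i) y sequentially"
      using limitin_sequentially_offset_rev[of mtopology "\<lambda>j. X (s j) i"] *(1) by simp
    ultimately show "P i s" unfolding P_def by blast
  qed blast
  then obtain y C w where lim: "\<And>i. limitin mtopology (\<lambda>j. X (q j) i) (y i) sequentially"
      "\<And>i. \<forall>\<^sub>F j in sequentially. D (q j) i = C i" "\<And>i. (\<lambda>j. V (q j) i) \<longlonglongrightarrow> w i"
    unfolding P_def by metis
  have qnull: "(\<lambda>j. inverse (real (Suc (q j)))) \<longlonglongrightarrow> 0"
    using LIMSEQ_subseq_LIMSEQ[OF LIMSEQ_inverse_real_of_nat q(1)] by (simp add: o_def)
  have C: "C i \<in> A0" for i
  proof -
    obtain j where "D (q j) i = C i" using lim(2)[of i] by (auto simp: eventually_sequentially)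
    then show ?thesis using X(2) by metis
  qed
  have y\<Lambda>: "y i \<in> \<Lambda>" for i
    by (rule limitin_closedin[OF lim(1) \<Lambda>_closed]) (use X(1) in auto)
  have ycore: "y i \<in> core r (C i)" for i
  proof -
    obtain N where N: "\<And>j. N \<le> j \<Longrightarrow> D (q j) i = C i" using lim(2)[of i]
      by (auto simp: eventually_sequentially)
    have "limitin mtopology (\<lambda>j. X (q (j + N)) i) (y i) sequentially"
      using limitin_sequentially_offset[OF lim(1)] .
    then show ?thesis
    proof (rule limitin_core)
      show "X (q (j + N)) i \<in> core r (C i)" for j using X(3)[of "q (j + N)" i] N[of "j + N"] by simp
    qed
  qed
  have fy: "f (y i) = y (i + 1)" for i
  proof -
    have "limitin mtopology (\<lambda>j. f (X (q j) i)) (f (y i)) sequentially"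
      using continuous_map_limit[OF cont_g lim(1)] by (simp add: o_def)
    from limitin_dist[OF this lim(1)]
    have 1: "(\<lambda>j. d (f (X (q j) i)) (X (q j) (i + 1))) \<longlonglongrightarrow> d (f (y i)) (y (i + 1))" .
    have "(\<lambda>j. d (f (X (q j) i)) (X (q j) (i + 1))) \<longlonglongrightarrow> 0"
    proof (rule null_seq_le[OF qnull])
      show "\<bar>d (f (X (q j) i)) (X (q j) (i + 1))\<bar> \<le> inverse (real (Suc (q j)))" for j
        using X(4)[of "q j" i] \<kappa>(3)[of "q j"] by simp
    qed
    with 1 have "d (f (y i)) (y (i + 1)) = 0" using LIMSEQ_unique by blast
    then show ?thesis using y\<Lambda> \<Lambda>_subset g_in by (metis subsetD zero)
  qed
  have CA: "C i \<in> A" and ydom: "y i \<in> fst (C i)" for i using C ycore A0 core_subset[OF r] by blast+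
  have fydom: "f (y i) \<in> fst (C (i + 1))" for i unfolding fy by (rule ydom)
  have wstep: "w (i + 1) = local_deriv f (C i) (C (i + 1)) (y i) (w i)" for i
  proof -
    \<comment> \<open>For the finitely many \<open>j\<close> whose charts are not yet the limiting
      ones, the zero map keeps \<open>?L j\<close> linear.\<close>
    let ?L = "\<lambda>j. if D (q j) i = C i \<and> D (q j) (i + 1) =
        C (i + 1) then local_deriv f (C i) (C (i + 1)) (X (q j) i) else (\<lambda>v. 0)"
    have ev: "\<forall>\<^sub>F j in sequentially. D (q j) i = C i \<and> D (q j) (i + 1) = C (i + 1)"
      using lim(2)[of i] lim(2)[of "i + 1"] by eventually_elim simp
    have "(\<lambda>j. ?L j (V (q j) i)) \<longlonglongrightarrow> local_deriv f (C i) (C (i + 1)) (y i) (w i)"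
    proof (rule tendsto_linear_apply[where Lj = ?L and v = "\<lambda>j. V (q j) i" and L =
      "local_deriv f (C i) (C (i + 1)) (y i)" and w = "w i"])
      show "linear (?L j)" for j
      proof (cases "D (q j) i = C i \<and> D (q j) (i + 1) = C (i + 1)")
        case True then show ?thesis using lin[of "q j" i] by simp
      qed (auto simp: linear_iff)
      show "linear (local_deriv f (C i) (C (i + 1)) (y i))"
        by (rule local_deriv_linear[OF smooth_f CA CA ydom fydom])
      show "(\<lambda>j. ?L j b) \<longlonglongrightarrow> local_deriv f (C i) (C (i + 1)) (y i) b" if "b \<in> B" for b
        by (rule Lim_transform_eventually[OF tendsto_local_deriv[OF CA CA lim(1) ydom fydom]])
           (use ev in eventually_elim, simp)
    qed (rule lim(3))
    then have 1: "(\<lambda>j. V (q j) (i + 1) - ?L j (V (q j) i)) \<longlonglongrightarrow> w (i + 1) - local_deriv f (C i) (C (i +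
        1)) (y i) (w i)"
      by (intro tendsto_diff lim(3))
    have "(\<lambda>j. V (q j) (i + 1) - ?L j (V (q j) i)) \<longlonglongrightarrow> 0"
    proof (rule Lim_null_comparison[OF _ qnull])
      show "\<forall>\<^sub>F j in sequentially. norm (V (q j) (i + 1) - ?L j (V (q j) i)) \<le>
          inverse (real (Suc (q j)))"
        using ev
      proof eventually_elim
        case (elim j) then show ?case using Verr[of "q j" i] by simp
      qed
    qed
    with 1 have "w (i + 1) - local_deriv f (C i) (C (i + 1)) (y i) (w i) = 0"
      by (rule LIMSEQ_unique)
    then show ?thesis by simp
  qed
  have wle: "norm (w i) \<le> 1" for i
    by (rule LIMSEQ_le_const2[OF tendsto_norm[OF lim(3)[of i]]]) (use V in blast)
  have "w 0 = 0"
    by (rule bounded_coordinate_orbit_zero[where y = y and c = C and w = w])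
       (rule A0 r y\<Lambda> fy C ycore wle wstep)+
  moreover have "1 / 2 \<le> norm (w 0)"
    by (rule LIMSEQ_le_const[OF tendsto_norm[OF lim(3)[of 0]]]) (use V0 less_imp_le in blast)
  ultimately show False by simp
qed


section \<open>Expansivity and periodic shadowing\<close>

lemma it_in_\<Lambda>:
  assumes x: "x \<in> \<Lambda>"
  shows "it k x \<in> \<Lambda>"
proof -
  have M: "x \<in> M" using x \<Lambda>_subset by blast
  have f': "f' z \<in> \<Lambda>" if "z \<in> \<Lambda>" for z
  proof -
    obtain z' where z': "z' \<in> \<Lambda>" "z = f z'" using \<open>z \<in> \<Lambda>\<close> \<Lambda>_invariant by (metis imageE)
    then show ?thesis using hg[OF subsetD[OF \<Lambda>_subset z'(1)]] by simp
  qed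
  show ?thesis
  proof (induction k rule: int_induct[where k = 0])
    case (step1 i)
    then show ?case unfolding it_Suc[OF M] using \<Lambda>_invariant by blast
  next
    case (step2 i)
    then show ?case unfolding it_pred[OF M] by (intro f')
  qed (simp add: x)
qed

text \<open>The coordinate difference \<open>v\<close> of two close orbits satisfies the linearised
  recurrence along \<open>x\<close> up to an error \<open>\<kappa> * norm (v k)\<close>. Every
  uniform bound on \<open>v\<close> can therefore be halved, again and again.\<close>

lemma expansive_on_\<Lambda>:
  "\<exists>e>0. \<forall>x\<in>\<Lambda>. \<forall>y\<in>\<Lambda>. (\<forall>k. d (it k x) (it k y) \<le> e) \<longrightarrow> x = y"
proof -
  obtain A0 r where A0: "finite A0" "A0 \<subseteq> A" and r: "0 < r" and cov: "\<And>x. x \<in> M \<Longrightarrow>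
      \<exists>c\<in>A0. x \<in> core r c"
    using finite_atlas by blast
  obtain \<kappa> where \<kappa>: "0 < \<kappa>" "\<kappa> \<le> r" and L:
    "\<forall>x c v b k. (\<forall>k. x k \<in> \<Lambda> \<and> c k \<in> A0 \<and> x k \<in> core r (c k) \<and>
      d (f (x k)) (x (k + 1)) < \<kappa> \<and> norm (v k) \<le> b \<and>
      norm (v (k + 1) - local_deriv f (c k) (c (k + 1)) (x k) (v k)) \<le> \<kappa> * b) \<longrightarrow> norm (v (k::int))
        \<le> b / 2"
    using linear_bound_on_pseudo_orbits[OF A0 r] by blast
  obtain \<rho> where \<rho>: "0 < \<rho>" and D': "\<forall>c\<in>A0. \<forall>c'\<in>A0. \<forall>x\<in>core r c. \<forall>x'\<in>core r c'. d (f x) x' < \<rho> \<longrightarrow>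
      ball (snd c x) \<rho> \<subseteq> snd c ` {y \<in> fst c. f y \<in> fst c'} \<and>
      (\<forall>u\<in>ball (snd c x) \<rho>. \<forall>u'\<in>ball (snd c x) \<rho>.
        norm (local_rep f c c' u - local_rep f c c' u' - local_deriv f c c' x (u - u'))
          \<le> \<kappa> * norm (u - u'))"
    using uniform_strict_differentiability[OF A0 r \<kappa>(1)] by blast
  note D = D'[rule_format, THEN conjunct2, rule_format]
  obtain \<delta> where \<delta>: "0 < \<delta>" "\<delta> \<le> r"
    "\<forall>c\<in>A0. \<forall>x\<in>core r c. \<forall>y\<in>M. d x y < \<delta> \<longrightarrow> y \<in> fst c \<and> dist (snd c y) (snd c x) < \<rho>"
    using uniform_chart[OF A0 r \<rho>] by blast
  \<comment> \<open>Half of \<delta> turns the non-strict closeness into the strict one required by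
    the charts.\<close>
  show ?thesis
  proof (intro exI[of _ "\<delta> / 2"] conjI ballI impI)
    fix x y assume x: "x \<in> \<Lambda>" and y: "y \<in> \<Lambda>" and close': "\<forall>k. d (it k x) (it k y) \<le> \<delta> / 2"
    note close = close'[rule_format]
    have M: "x \<in> M" "y \<in> M" using subsetD[OF \<Lambda>_subset] x y by blast+
    note it\<Lambda> = it_in_\<Lambda>[OF x]
    obtain c where c: "\<And>k. c k \<in> A0" "\<And>k. it k x \<in> core r (c k)" using cov[OF it_in[OF M(1)]]
      by metis
    have cA: "c k \<in> A" for k using c A0 by blast
    have xdom: "it k x \<in> fst (c k)" for k using c core_subset[OF r] by blast
    have "d (it k x) (it k y) < \<delta>" for k using close[of k] \<delta>(1) by simp
    then have ydom: "it k y \<in> fst (c k)" and near: "dist (snd (c k) (it k y)) (snd (c k) (it k x)) <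
        \<rho>" for k
      using \<delta>(3)[rule_format, OF c it_in[OF M(2)]] by blast+
    define v where "v k = snd (c k) (it k y) - snd (c k) (it k x)" for k
    have rep: "local_rep f (c k) (c (k + 1)) (snd (c k) (it k z)) = snd (c (k + 1)) (it (k + 1) z)"
      if "z \<in> M" "it k z \<in> fst (c k)" for k z
      using that cA it_Suc[OF that(1)] by (simp add: local_rep_def)
    have err: "norm (v (k + 1) - local_deriv f (c k) (c (k + 1)) (it k x) (v k)) \<le> \<kappa> * norm (v k)"
      for k
    proof -
      have "d (f (it k x)) (it (k + 1) x) < \<rho>" using it_Suc[OF M(1), of k] M \<rho>
        by (simp flip: it_Suc)
      from D[OF c(1) c(1) c(2) c(2) this, of "snd (c k) (it k y)" "snd (c k) (it k x)"]
      show ?thesis using near[of k] \<rho> rep[OF M(1) xdom] rep[OF M(2) ydom]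
        by (simp add: v_def dist_commute)
    qed
    have half: "\<forall>k. norm (v k) \<le> \<rho> / 2 ^ m" for m
    proof (induction m)
      case 0 then show ?case using near less_imp_le by (auto simp: v_def dist_norm)
    next
      case (Suc m)
      show ?case
      proof
        fix k
        have "norm (v k) \<le> (\<rho> / 2 ^ m) / 2"
        proof (rule L[rule_format, of "\<lambda>k. it k x" c], intro conjI)
          show "d (f (it k x)) (it (k + 1) x) < \<kappa>" for k using it_Suc[OF M(1), of k] M \<kappa>
            by (simp flip: it_Suc)
          show "norm (v (k + 1) - local_deriv f (c k) (c (k + 1)) (it k x) (v k)) \<le> \<kappa> * (\<rho> / 2 ^ m)"
            for k
            using err[of k] mult_left_mono[OF Suc[rule_format, of k], of \<kappa>] \<kappa>(1) by linarith
        qed (use it\<Lambda> c Suc in auto)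
        then show "norm (v k) \<le> \<rho> / 2 ^ Suc m" by simp
      qed
    qed
    have "(\<lambda>m. \<rho> / 2 ^ m) \<longlonglongrightarrow> 0" by (rule LIMSEQ_divide_realpow_zero) simp
    then have "norm (v 0) \<le> 0" by (rule LIMSEQ_le_const) (use half in blast)
    then have "snd (c 0) y = snd (c 0) x" by (simp add: v_def)
    then show "x = y" using inj_onD[OF chart_inj[OF cA]] xdom[of 0] ydom[of 0] by fastforce
  qed (use \<delta>(1) in simp)
qed

text \<open>In coordinates the orbit sought is \<open>x k\<close> displaced by \<open>v k\<close>.
  Being an orbit becomes the recurrence \<open>v (k + 1) = H k (v k)\<close>, a small perturbation
  of the linearised one.\<close>

lemma periodic_shadowing:
  assumes e: "0 < e"
  shows "\<exists>\<delta>>0. \<forall>n x. 0 < n \<and> (\<forall>k. x k \<in> \<Lambda> \<and> x (k + n) = x k \<and> d (f (x k)) (x (k + 1)) < \<delta>) \<longrightarrow>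
      (\<exists>y\<in>M. it n y = y \<and> (\<forall>k. d (it k y) (x k) < e))"
proof -
  obtain A0 r where A0: "finite A0" "A0 \<subseteq> A" and r: "0 < r" and cov: "\<And>x. x \<in> M \<Longrightarrow>
      \<exists>c\<in>A0. x \<in> core r c"
    using finite_atlas by blast
  obtain \<kappa> where \<kappa>: "0 < \<kappa>" "\<kappa> \<le> r" and L:
    "\<forall>x c v b k. (\<forall>k. x k \<in> \<Lambda> \<and> c k \<in> A0 \<and> x k \<in> core r (c k) \<and>
      d (f (x k)) (x (k + 1)) < \<kappa> \<and> norm (v k) \<le> b \<and>
      norm (v (k + 1) - local_deriv f (c k) (c (k + 1)) (x k) (v k)) \<le> \<kappa> * b) \<longrightarrow> norm (v (k::int))
        \<le> b / 2"
    using linear_bound_on_pseudo_orbits[OF A0 r] by blast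
  obtain \<rho>1 where \<rho>1: "0 < \<rho>1" and D': "\<forall>c\<in>A0. \<forall>c'\<in>A0. \<forall>x\<in>core r c. \<forall>x'\<in>core r c'. d (f x) x' < \<rho>1 \<longrightarrow>
      ball (snd c x) \<rho>1 \<subseteq> snd c ` {y \<in> fst c. f y \<in> fst c'} \<and>
      (\<forall>u\<in>ball (snd c x) \<rho>1. \<forall>u'\<in>ball (snd c x) \<rho>1.
        norm (local_rep f c c' u - local_rep f c c' u' - local_deriv f c c' x (u - u'))
          \<le> \<kappa> / 2 * norm (u - u'))"
    using uniform_strict_differentiability[OF A0 r half_gt_zero[OF \<kappa>(1)]] by blast
  note D0 = D'[rule_format, THEN conjunct1] and D = D'[rule_format, THEN conjunct2, rule_format]
  obtain \<rho>2 where \<rho>2: "0 < \<rho>2"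
    "\<forall>c\<in>A0. \<forall>x\<in>core r c. \<forall>u\<in>snd c ` fst c. dist u (snd c x) < \<rho>2 \<longrightarrow> d (chart_inv c u) x < e"
    using uniform_chart_inv[OF A0 r e] by blast
  define \<rho> where "\<rho> = min \<rho>1 \<rho>2 / 2"
  have \<rho>: "0 < \<rho>" "\<rho> < \<rho>1" "\<rho> < \<rho>2" using \<rho>1 \<rho>2 by (auto simp: \<rho>_def)
  have "0 < \<kappa> / 2 * \<rho>" using \<kappa> \<rho> by simp
  then obtain \<delta>3 where \<delta>3: "0 < \<delta>3" "\<delta>3 \<le> r"
    "\<forall>c\<in>A0. \<forall>x\<in>core r c. \<forall>y\<in>M. d x y < \<delta>3 \<longrightarrow> y \<in> fst c \<and> dist (snd c y) (snd c x) < \<kappa> / 2 * \<rho>"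
    using uniform_chart[OF A0 r, of "\<kappa> / 2 * \<rho>"] by blast
  \<comment> \<open>\<kappa> serves the linear bound, \<rho>1 the strict differentiability, and
    \<delta>3 makes the defect \<open>H k 0\<close> at most
    \<open>\<kappa> / 2 * \<rho>\<close>.\<close>
  define \<delta> where "\<delta> = min \<kappa> (min \<rho>1 \<delta>3)"
  have \<delta>: "0 < \<delta>" "\<delta> \<le> \<kappa>" "\<delta> \<le> \<rho>1" "\<delta> \<le> \<delta>3" using \<kappa> \<rho>1 \<delta>3 by (auto simp: \<delta>_def)
  show ?thesis
  proof (intro exI[of _ \<delta>] conjI \<delta>(1) allI impI)
    fix n :: int and x assume "0 < n \<and> (\<forall>k. x k \<in> \<Lambda> \<and> x (k + n) = x k \<and>
        d (f (x k)) (x (k + 1)) < \<delta>)"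
    then have n: "0 < n" and x\<Lambda>: "x k \<in> \<Lambda>" and per: "x (k + n) = x k" and po:
      "d (f (x k)) (x (k + 1)) < \<delta>" for k
      by blast+
    have xM: "x k \<in> M" for k using x\<Lambda> \<Lambda>_subset by blast
    obtain ch where ch: "\<And>z. z \<in> M \<Longrightarrow> ch z \<in> A0" "\<And>z. z \<in> M \<Longrightarrow> z \<in> core r (ch z)" using cov by metis
    \<comment> \<open>The chart is a function of the point, so the charts repeat with the same
      period.\<close>
    define c where "c k = ch (x k)" for k
    have c: "c k \<in> A0" "x k \<in> core r (c k)" for k using ch xM by (auto simp: c_def)
    have cA: "c k \<in> A" for k using c A0 by blast
    have po': "d (f (x k)) (x (k + 1)) < \<rho>1" "d (f (x k)) (x (k + 1)) < \<kappa>"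
      "d (x (k + 1)) (f (x k)) < \<delta>3" for k
      using po[of k] \<delta> by (auto simp: commute)
    have xdom: "x k \<in> fst (c k)" for k using c core_subset[OF r] by blast
    have fxdom: "f (x k) \<in> fst (c (k + 1))" for k using \<delta>3(3)[rule_format, OF c _ po'(3)] xM by simp
    define A' where "A' k = local_deriv f (c k) (c (k + 1)) (x k)" for k
    define H where "H k v = local_rep f (c k) (c (k + 1)) (snd (c k) (x k) + v) - snd (c (k + 1)) (x
        (k + 1))" for k v
    have per1: "x (k + n + 1) = x (k + 1)" for k using per[of "k + 1"] by (simp add: ac_simps)
    have "\<exists>v. (\<forall>k. v (k + n) = v k) \<and> (\<forall>k. v (k + 1) = H k (v k)) \<and> (\<forall>k. norm (v k) \<le> \<rho>)"
    proof (rule periodic_solution[OF n, where A = A' and G = H and \<kappa> = \<kappa> and \<rho> = \<rho>])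
      show "linear (A' k)" for k unfolding A'_def
        by (rule local_deriv_linear[OF smooth_f cA cA xdom fxdom])
      show "A' (k + n) = A' k" for k using per per1 by (simp add: A'_def c_def)
      show "H (k + n) = H k" for k using per per1 by (intro ext) (simp add: H_def c_def)
      show "0 < \<kappa>" "0 < \<rho>" by (rule \<kappa> \<rho>)+
      show "norm (v k) \<le> b" if v: "\<And>k. v (k + n) = v k" "\<And>k. norm (v (k + 1) - A' k (v k)) \<le> \<kappa> * b"
        for v b k
      proof (rule ccontr)
        assume "\<not> ?thesis"
        then have b: "b < norm (v k)" by simp
        \<comment> \<open>The halving bound, applied with the maximal norm in place of
          \<open>b\<close>, shows that a maximum above \<open>b\<close> is at most half of
          itself.\<close>
        obtain k0 where k0: "\<And>k. norm (v k) \<le> norm (v k0)"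
          using periodic_attains_max_norm[OF n, of v] v(1) by blast
        have "b < norm (v k0)" using b k0[of k] by linarith
        then have "\<kappa> * b \<le> \<kappa> * norm (v k0)" using \<kappa>(1) by simp
        then have "norm (v (k + 1) - local_deriv f (c k) (c (k + 1)) (x k) (v k)) \<le> \<kappa> * norm (v k0)"
          for k
          using v(2)[of k] unfolding A'_def by linarith
        then have "norm (v k0) \<le> norm (v k0) / 2"
          by (intro L[rule_format, of x c] conjI x\<Lambda> c po'(2) k0)
        moreover have "0 \<le> \<kappa> * b" using v(2)[of 0] norm_ge_zero order_trans by blast
        then have "0 \<le> b" using \<kappa>(1) by (simp add: zero_le_mult_iff)
        ultimately show False using \<open>b < norm (v k0)\<close> by simp
      qed
      show "norm (H k u - H k u' - A' k (u - u')) \<le> \<kappa> / 2 * norm (u - u')"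
        if "norm u \<le> \<rho>" "norm u' \<le> \<rho>" for k u u'
        using D[OF c(1)[of k] c(1)[of "k + 1"] c(2)[of k] c(2)[of "k + 1"] po'(1)[of k], of
          "snd (c k) (x k) + u" "snd (c k) (x k) + u'"] that \<rho>(2)
        by (simp add: H_def A'_def dist_norm)
      have "H k 0 = snd (c (k + 1)) (f (x k)) - snd (c (k + 1)) (x (k + 1))" for k
        using cA xdom by (simp add: H_def local_rep_def)
      then show "norm (H k 0) \<le> \<kappa> / 2 * \<rho>" for k
        using \<delta>3(3)[rule_format, OF c _ po'(3), of k] xM by (simp add: dist_norm)
    qed blast
    then obtain v where v: "\<And>k. v (k + n) = v k" "\<And>k. v (k + 1) = H k (v k)" "\<And>k. norm (v k) \<le> \<rho>"
      by blast
    define u where "u k = snd (c k) (x k) + v k" for k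
    define y where "y k = chart_inv (c k) (u k)" for k
    have uball: "u k \<in> ball (snd (c k) (x k)) \<rho>1" for k using v(3)[of k] \<rho>(2)
      by (simp add: u_def dist_norm)
    have uim: "u k \<in> snd (c k) ` {y \<in> fst (c k). f y \<in> fst (c (k + 1))}" for k
      using D0[OF c(1) c(1) c(2) c(2) po'(1)] uball by blast
    have ydom: "y k \<in> fst (c k)" "f (y k) \<in> fst (c (k + 1))" and uy: "snd (c k) (y k) = u k" for k
      using uim[of k] cA by (auto simp: y_def)
    have fy: "f (y k) = y (k + 1)" for k
    proof (rule inj_onD[OF chart_inj[OF cA[of "k + 1"]]])
      have "snd (c (k + 1)) (f (y k)) = local_rep f (c k) (c (k + 1)) (u k)"
        by (simp add: local_rep_def y_def)
      also have "\<dots> = H k (v k) + snd (c (k + 1)) (x (k + 1))" by (simp add: H_def u_def)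
      also have "\<dots> = u (k + 1)" by (simp add: u_def flip: v(2))
      finally show "snd (c (k + 1)) (f (y k)) = snd (c (k + 1)) (y (k + 1))" by (simp add: uy)
    qed (rule ydom)+
    have yM: "y k \<in> M" for k using ydom(1) dom_subset[OF cA] by blast
    have it_y: "it k (y 0) = y k" for k
    proof (induction k rule: int_induct[where k = 0])
      case (step1 i) then show ?case using it_Suc[OF yM] fy by simp
    next
      case (step2 i)
      have "f' (y i) = y (i - 1)" using fy[of "i - 1"] hg[OF yM[of "i - 1"]] by simp
      then show ?case using step2 it_pred[OF yM] by simp
    qed simp
    have "y n = y 0" using v(1)[of 0] per[of 0] by (simp add: y_def u_def c_def)
    moreover have "d (y k) (x k) < e" for k
      unfolding y_def
    proof (rule \<rho>2(2)[rule_format, OF c])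
      show "u k \<in> snd (c k) ` fst (c k)" using uim by blast
      show "dist (u k) (snd (c k) (x k)) < \<rho>2" using v(3)[of k] \<rho>(3) by (simp add: u_def dist_norm)
    qed
    ultimately show "\<exists>y\<in>M. it n y = y \<and> (\<forall>k. d (it k y) (x k) < e)"
      using it_y yM by (intro bexI[of _ "y 0"]) auto
  qed
qed

end

section \<open>Basic sets\<close>

context hyperbolic_system
begin

lemma basic_set_Myhill:
  assumes \<Lambda>: "\<Lambda> = nonwandering_set mtopology f" and spec: "spectral_decomposition mtopology f \<X>"
    "X \<in> \<X>"
    and mix: "topologically_mixing (subtopology mtopology X) f"
  shows "dynamical_system (subtopology mtopology X) f \<and> Myhill_property (subtopology mtopology X) f"
proof -
  have X: "closedin mtopology X" "f ` X = X" "X \<subseteq> \<Lambda>" using spec \<Lambda>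
    unfolding spectral_decomposition_def by blast+
  have XM: "X \<subseteq> M" using X(3) \<Lambda>_subset by blast
  note top = invariant_subsystem(2)[OF X(1,2)]
  interpret S: compact_homeo X d f f' by (rule invariant_subsystem(1)[OF X(1,2)])
  obtain e where e: "e > 0" "\<forall>x\<in>\<Lambda>. \<forall>y\<in>\<Lambda>. (\<forall>k. d (it k x) (it k y) \<le> e) \<longrightarrow> x = y"
    using expansive_on_\<Lambda> by blast
  have exp: "S.expansive e" using e X(3) unfolding S.expansive_def by blast
  have conn: S.connecting by (rule S.connecting_if_mixing) (simp add: top mix)
  have rest: "closedin mtopology (\<Union>(\<X> - {X}))"
    using spec unfolding spectral_decomposition_def by (intro closedin_Union) auto
  have "disjoint \<X>" using spec(1) by (simp add: spectral_decomposition_def)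
  then have "X \<inter> Y = {}" if "Y \<in> \<X> - {X}" for Y
    using that spec(2) disjointD by (metis DiffE singletonI)
  then have "X \<inter> \<Union>(\<X> - {X}) = {}" by blast
  \<comment> \<open>The remaining basic sets form a closed set disjoint from \<open>X\<close>, so a
    point of \<Lambda> closer than \<open>e1\<close> to \<open>X\<close> belongs to
    \<open>X\<close>.\<close>
  from disjoint_closed_distance[OF X(1) rest this]
  obtain e1 where e1: "e1 > 0" "\<forall>x\<in>X. \<forall>y\<in>\<Union>(\<X> - {X}). e1 \<le> d x y" by (elim exE conjE)
  have near: "y \<in> X" if "y \<in> \<Lambda>" "x \<in> X" "d y x < e1" for x y
  proof (rule ccontr)
    assume "y \<notin> X"
    moreover have "y \<in> \<Union>\<X>" using that(1) spec(1) \<Lambda> by (simp add: spectral_decomposition_def)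
    ultimately have "y \<in> \<Union>(\<X> - {X})" by blast
    from e1(2)[rule_format, OF that(2) this] show False using that(3) commute[of x y] by linarith
  qed
  have shad: S.shadowing
    unfolding S.shadowing_def
  proof (intro allI impI)
    fix \<epsilon> :: real assume \<epsilon>: "0 < \<epsilon>"
    have "0 < min \<epsilon> e1" using \<epsilon> e1 by simp
    from periodic_shadowing[OF this]
    obtain \<delta> where \<delta>: "\<delta> > 0" "\<forall>n x. 0 < n \<and> (\<forall>k. x k \<in> \<Lambda> \<and> x (k + n) = x k \<and>
        d (f (x k)) (x (k + 1)) < \<delta>) \<longrightarrow>
      (\<exists>y\<in>M. it n y = y \<and> (\<forall>k. d (it k y) (x k) < min \<epsilon> e1))" by blast
    obtain N where N: "N \<ge> 1" "\<forall>a\<in>X. \<forall>b\<in>X. \<exists>z\<in>X. d z a < \<delta> \<and> d (it (int N) z) b < \<delta>"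
      using conn \<delta>(1) unfolding S.connecting_def by blast
    have "\<exists>y\<in>X. \<forall>k. d (it k y) (\<xi> k) \<le> \<epsilon>" if \<xi>: "S.pseudo_orbit \<delta> \<xi>" for \<xi>
    proof -
      have \<xi>X: "\<xi> k \<in> X" for k using \<xi> by (simp add: S.pseudo_orbit_def)
      \<comment> \<open>Only the window \<open>[-n, n]\<close> of \<xi> is closed up. The shadows of
        growing windows accumulate at a shadow of all of \<xi>.\<close>
      have "\<exists>y. y \<in> X \<and> (\<forall>k. \<bar>k\<bar> \<le> int n \<longrightarrow> d (it k y) (\<xi> k) \<le> \<epsilon>)" for n
      proof -
        obtain z where z: "z \<in> X" "d z (f (\<xi> (int n))) < \<delta>" "d (it (int N) z) (\<xi> (- int n)) < \<delta>"
          using N(2) \<xi>X S.g_in by meson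
        obtain x where x: "\<And>k. x k \<in> X" "\<And>k. x (k + (2 * int n + 1 + int N)) = x k"
          "\<And>k. d (f (x k)) (x (k + 1)) < \<delta>"
            "\<And>k. \<bar>k\<bar> \<le> int n \<Longrightarrow> x (k + int n) = \<xi> k"
          using S.periodic_closing[OF \<xi> N(1) z] by metis
        have P: "0 < 2 * int n + 1 + int N" by simp
        obtain w where w: "w \<in> M" "it (2 * int n + 1 + int N) w = w"
          "\<forall>k. d (it k w) (x k) < min \<epsilon> e1"
          using \<delta>(2)[rule_format, of "2 * int n + 1 + int N" x] x(1,2,3) X(3) P by blast
        have "w \<in> \<Lambda>" unfolding \<Lambda> by (rule periodic_nonwandering[OF w(1) P w(2)])
        moreover have "d w (x 0) < e1" using w(3)[rule_format, of 0] by simp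
        ultimately have wX: "w \<in> X" using near x(1) by blast
        \<comment> \<open>Closing up moves \<open>\<xi> k\<close> to index \<open>k + n\<close>,
          hence the shift of \<open>w\<close> by \<open>n\<close>.\<close>
        have "d (it k (it (int n) w)) (\<xi> k) \<le> \<epsilon>" if "\<bar>k\<bar> \<le> int n" for k
          using w(3)[rule_format, of "k + int n"] x(4)[OF that] it_add[OF w(1), of k "int n"]
            by simp
        then show ?thesis using S.it_in[OF wX] by blast
      qed
      then obtain y where y: "\<And>n. y n \<in> X" "\<And>n k. \<bar>k\<bar> \<le> int n \<Longrightarrow> d (it k (y n)) (\<xi> k) \<le> \<epsilon>" by metis
      obtain l r where l: "l \<in> X" "strict_mono (r::nat\<Rightarrow>nat)"
        "limitin S.mtopology (\<lambda>j. y (r j)) l sequentially"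
        using S.seq_compact[of y] y(1) by blast
      have "d (it k l) (\<xi> k) \<le> \<epsilon>" for k
      proof (rule LIMSEQ_le_const2)
        have "limitin S.mtopology (\<lambda>j. \<xi> k) (\<xi> k) sequentially" using \<xi>X by simp
        then show "(\<lambda>j. d (it k (y (r j))) (\<xi> k)) \<longlonglongrightarrow> d (it k l) (\<xi> k)"
          by (intro S.limitin_dist S.limitin_it l(3))
        have "d (it k (y (r j))) (\<xi> k) \<le> \<epsilon>" if "nat \<bar>k\<bar> \<le> j" for j
          using y(2)[of k "r j"] seq_suble[OF l(2), of j] that by linarith
        then show "\<exists>N. \<forall>j\<ge>N. d (it k (y (r j))) (\<xi> k) \<le> \<epsilon>" by blast
      qed
      with l(1) show ?thesis by blast
    qed
    with \<delta>(1) show "\<exists>\<delta>>0. \<forall>\<xi>. S.pseudo_orbit \<delta> \<xi> \<longrightarrow> (\<exists>y\<in>X. \<forall>k. d (it k y) (\<xi> k) \<le> \<epsilon>)" by blast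
  qed
  show ?thesis
    using S.dynamical_system_mtopology S.Myhill_property_if_specification[OF exp shad conn]
      by (simp add: top)
qed

end

section \<open>Passage from Axiom A to the abstract setting\<close>

lemma subspace_continuous_subbundle:
  assumes "continuous_subbundle M A \<Lambda> E" "x \<in> \<Lambda>"
  shows "subspace (E x)"
proof -
  obtain W and n :: nat and e where W: "x \<in> W" "\<forall>y\<in>W. E y = span ((\<lambda>i. e i y) ` {..<n})"
    using assms unfolding continuous_subbundle_def by metis
  then have "E x = span ((\<lambda>i. e i x) ` {..<n})" by blast
  then show ?thesis by simp
qed

theorem corollary4p3:
  fixes M :: "'a topology"
    and A :: "('a, 'b::real_normed_vector) chart set"
    and r :: enat
    and f :: "'a \<Rightarrow> 'a"
    and X :: "'a set"
  assumes "1 \<le> r"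
    and "Cr_manifold r M A"
    and "compact_space M"
    and "C1_diffeo M A f"
    and "Axiom_A M A f"
    and "elementary_basic_set M f X"
  shows "dynamical_system (subtopology M X) f \<and> Myhill_property (subtopology M X) f"
proof -
  let ?S = "topspace M"
  let ?f' = "inv_into ?S f"
  have man: "Hausdorff_space M" "second_countable M" "\<forall>c\<in>A. is_chart M c" "(\<Union>c\<in>A. fst c) = ?S"
    "\<forall>c\<in>A. \<forall>c'\<in>A. Cr_on r (snd c ` (fst c \<inter> fst c')) (snd c' \<circ> chart_inv c)"
    using assms(2) by (auto simp: Cr_manifold_def)
  obtain B0 :: "'b set" where "finite B0" "span B0 = UNIV" using assms(2) unfolding Cr_manifold_def
    by blast
  then obtain B :: "'b set" where B: "finite B" "independent B" "span B = UNIV"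
    by (rule finite_basis_exists)
  have "metrizable_space M"
    using assms(3) man(1,2) by (rule compact_Hausdorff_second_countable_metrizable)
  then obtain S d where Sd: "Metric_space S d" "M = Metric_space.mtopology S d"
    unfolding metrizable_space_def by blast
  have S: "S = ?S" using Metric_space.topspace_mtopology[OF Sd(1)] Sd(2) by simp
  interpret Metric_space ?S d using Sd(1) S by simp
  have top: "mtopology = M" using Sd(2) S by simp
  have bij: "bij_betw f ?S ?S" and C1: "C1_map M A f" "C1_map M A ?f'" using assms(4)
    by (auto simp: C1_diffeo_def)
  have cont: "continuous_map M M f" "continuous_map M M ?f'" using C1 by (auto simp: C1_map_def)
  have Ck1: "Ck_on 1 U F" if "Cr_on q U F" "1 \<le> q" for q U and F :: "'b \<Rightarrow> 'b"
    using that unfolding Cr_on_def one_enat_def by blast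
  have trans: "Ck_on 1 (snd c ` (fst c \<inter> fst c')) (snd c' \<circ> chart_inv c)" if "c \<in> A" "c' \<in> A"
    for c c'
    using man(5) that Ck1[OF _ assms(1)] by blast
  have C1f: "Ck_on 1 (snd c ` {x \<in> fst c. f x \<in> fst c'}) (snd c' \<circ> f \<circ> chart_inv c)"
    "Ck_on 1 (snd c ` {x \<in> fst c. ?f' x \<in> fst c'}) (snd c' \<circ> ?f' \<circ> chart_inv c)" if "c \<in> A" "c' \<in> A"
      for c c'
    using C1 that Ck1[OF _ order_refl] unfolding C1_map_def by blast+
  let ?\<Lambda> = "nonwandering_set M f"
  have "hyperbolic_set M A f ?\<Lambda>" using assms(5) by (simp add: Axiom_A_def)
  note hyp = this[unfolded hyperbolic_set_def Let_def]
  have closed: "closedin M ?\<Lambda>" and inv: "f ` ?\<Lambda> = ?\<Lambda>"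
    using hyp[THEN conjunct1] hyp[THEN conjunct2, THEN conjunct1] .
  obtain Es Eu G C l where bundles: "continuous_subbundle M A ?\<Lambda> Es"
    "continuous_subbundle M A ?\<Lambda> Eu"
    and split: "\<forall>x\<in>?\<Lambda>. Es x \<inter> Eu x = {0} \<and> tangent_space A x = {v + w | v w. v \<in> Es x \<and> w \<in> Eu x} \<and>
                differential A f x ` Es x = Es (f x) \<and> differential A f x ` Eu x = Eu (f x)"
    and G: "riemannian_metric M A G" and l: "0 < l" "l < 1"
    and contr: "\<forall>x\<in>?\<Lambda>. \<forall>v\<in>Es x. \<forall>w\<in>Eu x. \<forall>n.
        sqrt (G ((f ^^ n) x) (differential A (f ^^ n) x v) (differential A (f ^^ n) x v))
          \<le> C * l ^ n * sqrt (G x v v) \<and>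
        sqrt (G ((?f' ^^ n) x) (differential A (?f' ^^ n) x w) (differential A (?f' ^^ n) x w))
          \<le> C * l ^ n * sqrt (G x w w)"
    using hyp[THEN conjunct2, THEN conjunct2] by (elim exE conjE) (rule that)
  have sub: "subspace (Es x)" "subspace (Eu x)" if "x \<in> ?\<Lambda>" for x
    by (rule subspace_continuous_subbundle[OF bundles(1)
      that], rule subspace_continuous_subbundle[OF bundles(2) that])
  interpret hyperbolic_system ?S d f ?f' B A ?\<Lambda> Es Eu G C l
  proof (unfold_locales, unfold top)
    show "?f' (f x) = x" if "x \<in> ?S" for x using bij that by (simp add: bij_betw_inv_into_left)
    show "f (?f' x) = x" if "x \<in> ?S" for x using bij that by (simp add: bij_betw_inv_into_right)
    show "is_chart M c" if "c \<in> A" for c using man(3) that by (rule bspec)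
    show "(\<Union>c\<in>A. fst c) = ?S" by (rule man(4))
    fix x v n assume x: "x \<in> ?\<Lambda>"
    note sp = split[rule_format, OF x]
    show "tangent_space A x = {v + w | v w. v \<in> Es x \<and> w \<in> Eu x}"
      by (rule sp[THEN conjunct2, THEN conjunct1])
    show "differential A f x ` Es x = Es (f x)"
      by (rule sp[THEN conjunct2, THEN conjunct2, THEN conjunct1])
    show "differential A f x ` Eu x = Eu (f x)"
      by (rule sp[THEN conjunct2, THEN conjunct2, THEN conjunct2])
    \<comment> \<open>The two contraction estimates are quantified jointly over both bundles; each
      is extracted with the zero vector in the other one.\<close>
    show "sqrt (G ((f ^^ n) x) (differential A (f ^^ n) x v) (differential A (f ^^ n) x v)) \<le>
        C * l ^ n * sqrt (G x v v)"
      if "v \<in> Es x" by (rule contr[rule_format, OF x that subspace_0[OF sub(2)[OF x]], THEN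
        conjunct1])
    show "sqrt (G ((?f' ^^ n) x) (differential A (?f' ^^ n) x v) (differential A (?f' ^^ n) x v)) \<le>
        C * l ^ n * sqrt (G x v v)"
      if "v \<in> Eu x" by (rule contr[rule_format, OF x subspace_0[OF sub(1)[OF x]]
        that, THEN conjunct2])
  qed (rule assms(3) cont B trans C1f closed inv sub G l; assumption)+
  obtain \<X> where "spectral_decomposition M f \<X>" "X \<in> \<X>" and mix:
    "topologically_mixing (subtopology M X) f"
    using assms(6) unfolding elementary_basic_set_def basic_set_def by blast
  with basic_set_Myhill[of \<X> X] show ?thesis unfolding top by blast
qed

end
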